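(* Let $X=(X_t)_{t\ge 0}$ be a continuous Volterra process with kernel $K$ and covariance function $k$, let $T>0$, let $\gamma_\varepsilon>0$ with $\gamma_\varepsilon\to0$ as $\varepsilon\to0$, and, for almost every continuous function $\psi$ on $[0,T]$ (with respect to the law of $(W^{\alpha,\tilde\alpha}_t)_{t\in[0,T]}$), let $X^\psi$ be the conditioned process. Assume the following. (i) There is a function $\bar k$ such that $$\bar k(t,s)=\lim_{\varepsilon\to0}\frac{\operatorname{Cov}(X_{T+\varepsilon t}-X_T,\,X_{T+\varepsilon s}-X_T)}{\gamma_\varepsilon^2}$$ uniformly in $(t,s)\in[0,1]\times[0,1]$. (ii) There are constants $M,\tau>0$ such that for every $\varepsilon>0$ $$\sup_{s,t\in[0,1],\,s\ne t}\frac{\operatorname{Var}(X_{T+\varepsilon t}-X_{T+\varepsilon s})}{\gamma_\varepsilon^2|t-s|^{2\tau}}\le M.$$ (iii) There is a square integrable function $\bar K$ (possibly $0$) such that $$\lim_{\varepsilon\to0}\sqrt{\varepsilon}\,\frac{K(T+\varepsilon t,T+\varepsilon s)}{\gamma_\varepsilon}=\bar K(t,s)$$ uniformly in $(t,s)\in[0,1]\times[0,1]$. (iv) There are constants $c,\hat\tau>0$ such that for every $\varepsilon>0$ $$\sup_{s,t\in[0,1],\,s\neq t}\frac{\int_0^t\big(K(T+\varepsilon t,T+\varepsilon u)-K(T+\varepsilon s,T+\varepsilon u)\big)^2\,du}{\gamma_\varepsilon^2|t-s|^{2\hat\tau}}\le c.$$ Put $$\bar\Upsilon(t,s)=\frac{\alpha^2}{\alpha^2+\tilde\alpha^2}\int_0^{t\wedge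 s}\bar K(t,u)\bar K(s,u)\,du+\frac{\tilde\alpha^2}{\alpha^2+\tilde\alpha^2}\,\bar k(t,s),\qquad t,s\in[0,1],$$ and suppose that $\bar\Upsilon$ is regular enough that it is the covariance function of a centered Gaussian process on $[0,1]$ with continuous paths. Then the family of processes $\big((X^\psi_{T+\varepsilon t}-X^\psi_T)_{t\in[0,1]}\big)_{\varepsilon>0}$ satisfies a large deviation principle on $C[0,1]$ with the inverse speed $\gamma_\varepsilon^2$ and the good rate function $$I(h)=\begin{cases}\frac12\|h\|^2_{\bar{\mathscr H}},&h\in\bar{\mathscr H},\\+\infty,&\text{otherwise},\end{cases}$$ where $\bar{\mathscr H}$ and $\|\cdot\|_{\bar{\mathscr H}}$ denote the reproducing kernel Hilbert space and the related norm associated to the covariance function $\bar\Upsilon$.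
   Context: Volterra process: a centered Gaussian process $X=(X_t)_{t\ge0}$ is a Volterra process with kernel $K$ if for every $T>0$, $X_t=\int_0^T K(t,s)\,dB_s$ for $t\in[0,T]$, where $B$ is a Brownian motion and $K$ is square integrable on $[0,T]^2$ with $K(t,s)=0$ for $s>t$. Its covariance is $k(t,s)=\int_0^{s\wedge t}K(t,u)K(s,u)\,du$. "Continuous" means with continuous paths. Noisy Brownian motion: $\tilde B$ is a Brownian motion independent of $B$, $\alpha,\tilde\alpha\in\mathbb{R}$ are fixed and not both zero, and $W^{\alpha,\tilde\alpha}=\alpha B+\tilde\alpha\tilde B$, with generated filtration $(\mathscr F^{\alpha,\tilde\alpha}_t)_{t\ge0}$. Conditioned process: the regular conditional law of $X$ given $\mathscr F_T^{\alpha,\tilde\alpha}$ is Gaussian with random mean $\Psi_t(W^{\alpha,\tilde\alpha})=\mathbb E[X_t\mid\mathscr F^{\alpha,\tilde\alpha}_T]=\frac{\alpha}{\alpha^2+\tilde\alpha^2}\int_0^T K(t,u)\,dW^{\alpha,\tilde\alpha}_u$ (taken in its version continuous in $t$, and regarded as a measurable functional of the path of $W^{\alpha,\tilde\alpha}$ on $[0,T]$) and deterministic covariance $$\Upsilon(t,s)=\int_0^{t\wedge s}\Big(1-\tfrac{\alpha^2}{\alpha^2+\tilde\alpha^2}\mathbf 1_{[0,T]}(v)\Big)^2K(t,v)K(s,v)\,dv+\frac{\alpha^2\tilde\alpha^2}{(\alpha^2+\tilde\alpha^2)^2}\int_0^TK(t,v)K(s,v)\,dv .$$ For almost every continuous $\psi$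 on $[0,T]$, $m^\psi_t=\Psi_t(\psi)$ is a continuous function of $t\in[0,\infty)$, and $X^\psi=(X^\psi_t)_{t\ge0}$ denotes the continuous Gaussian process with mean function $m^\psi$ and covariance function $\Upsilon$ (informally, $X$ conditioned on $W^{\alpha,\tilde\alpha}_t=\psi_t$, $t\in[0,T]$). Large deviation principle: $C[0,1]$ carries the sup-norm topology and its Borel $\sigma$-algebra. A family of continuous processes $(U^\varepsilon)_{\varepsilon>0}$ on $[0,1]$ satisfies a large deviation principle with rate function $I$ (a lower semicontinuous map $I:C[0,1]\to[0,+\infty]$) and inverse speed $\eta_\varepsilon>0$, $\eta_\varepsilon\to0$, if $-\inf_{\Theta}I\le\liminf_{\varepsilon\to0}\eta_\varepsilon\log\mathbb{P}(U^\varepsilon\in\Theta)$ for every open $\Theta$ and $\limsup_{\varepsilon\to0}\eta_\varepsilon\log\mathbb{P}(U^\varepsilon\in\Gamma)\le-\inf_\Gamma I$ for every closed $\Gamma$. The rate function is good if $\{I\le a\}$ is compact for every $a\ge0$. *)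

theory Defs
  imports "HOL-Probability.Probability"
begin

section \<open>Spaces of continuous functions on an interval\<close>

text \<open>
  An element of \<open>C[0,T]\<close> is represented by the unique function on the reals that is continuous on
  \<open>{0..T}\<close> and takes the value \<^const>\<open>undefined\<close> elsewhere.
\<close>

definition C_space :: "real \<Rightarrow> (real \<Rightarrow> real) set" where
  "C_space T = {f \<in> extensional {0..T}. continuous_on {0..T} f}"

definition sup_dist :: "real \<Rightarrow> (real \<Rightarrow> real) \<Rightarrow> (real \<Rightarrow> real) \<Rightarrow> real" where
  "sup_dist T f g = (if f \<in> C_space T \<and> g \<in> C_space T then (SUP t\<in>{0..T}. \<bar>f t - g t\<bar>) else 0)"

lemma sup_dist_bound:
  assumes "f \<in> C_space T" "g \<in> C_space T" "t \<in> {0..T}"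
  shows "\<bar>f t - g t\<bar> \<le> sup_dist T f g"
proof -
  have "continuous_on {0..T} (\<lambda>t. \<bar>f t - g t\<bar>)"
    using assms by (auto simp: C_space_def intro!: continuous_intros)
  then have "bdd_above ((\<lambda>t. \<bar>f t - g t\<bar>) ` {0..T})"
    by (intro bounded_imp_bdd_above compact_imp_bounded compact_continuous_image compact_Icc)
  then show ?thesis
    using assms by (auto simp: sup_dist_def intro!: cSUP_upper)
qed

lemma Metric_space_C_space:
  assumes "0 \<le> T"
  shows "Metric_space (C_space T) (sup_dist T)"
proof
  have ne: "{0..T} \<noteq> {}"
    using assms by auto
  fix f g
  show nonneg: "0 \<le> sup_dist T f g"
  proof (cases "f \<in> C_space T \<and> g \<in> C_space T")
    case True
    then show ?thesis
      using sup_dist_bound[of f T g 0] assms by (auto intro: order_trans[OF abs_ge_zero])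
  qed (auto simp: sup_dist_def)
  show "sup_dist T f g = sup_dist T g f"
    by (simp add: sup_dist_def abs_minus_commute)
  assume f: "f \<in> C_space T" and g: "g \<in> C_space T"
  show "sup_dist T f g = 0 \<longleftrightarrow> f = g"
  proof
    assume "sup_dist T f g = 0"
    then have "f t = g t" if "t \<in> {0..T}" for t
      using sup_dist_bound[OF f g that] by simp
    then show "f = g"
      using f g by (auto simp: C_space_def intro: extensionalityI)
  next
    assume "f = g"
    then show "sup_dist T f g = 0"
      using ne by (simp add: sup_dist_def)
  qed
  fix h
  assume h: "h \<in> C_space T"
  have "\<bar>f t - h t\<bar> \<le> sup_dist T f g + sup_dist T g h" if "t \<in> {0..T}" for t
    using sup_dist_bound[OF f g that] sup_dist_bound[OF g h that] by linarith
  then show "sup_dist T f h \<le> sup_dist T f g + sup_dist T g h"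
    using ne f h unfolding sup_dist_def[of T f h] by (auto intro!: cSUP_least)
qed

definition C_topology :: "real \<Rightarrow> (real \<Rightarrow> real) topology" where
  "C_topology T = mtopology_of (metric (C_space T, sup_dist T))"

lemma topspace_C_topology: "0 \<le> T \<Longrightarrow> topspace (C_topology T) = C_space T"
  by (simp add: C_topology_def Metric_space.mspace_metric[OF Metric_space_C_space])

definition C_borel :: "real \<Rightarrow> (real \<Rightarrow> real) measure" where
  "C_borel T = sigma (C_space T) {U. openin (C_topology T) U}"


section \<open>Processes\<close>

text \<open>A real process is a map \<open>X\<close> taking a time and a sample point to a real number.\<close>

definition continuous_paths :: "'a measure \<Rightarrow> real set \<Rightarrow> (real \<Rightarrow> 'a \<Rightarrow> real) \<Rightarrow> bool" where
  "continuous_paths M I X \<longleftrightarrow> (\<forall>\<omega>\<in>space M. continuous_on I (\<lambda>t. X t \<omega>))"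

definition path :: "real \<Rightarrow> (real \<Rightarrow> 'a \<Rightarrow> real) \<Rightarrow> 'a \<Rightarrow> (real \<Rightarrow> real)" where
  "path T X \<omega> = (\<lambda>t\<in>{0..T}. X t \<omega>)"

definition path_law :: "'a measure \<Rightarrow> real \<Rightarrow> (real \<Rightarrow> 'a \<Rightarrow> real) \<Rightarrow> (real \<Rightarrow> real) measure" where
  "path_law M T X = distr M (C_borel T) (path T X)"

definition natural_filtration :: "'a measure \<Rightarrow> (real \<Rightarrow> 'a \<Rightarrow> real) \<Rightarrow> real \<Rightarrow> 'a measure" where
  "natural_filtration M X t =
     sigma (space M) {X s -` A \<inter> space M | s A. s \<in> {0..t} \<and> A \<in> sets borel}"

definition covariance :: "'a measure \<Rightarrow> ('a \<Rightarrow> real) \<Rightarrow> ('a \<Rightarrow> real) \<Rightarrow> real" where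
  "covariance M U V =
     (\<integral>\<omega>. (U \<omega> - (\<integral>\<omega>'. U \<omega>' \<partial>M)) * (V \<omega> - (\<integral>\<omega>'. V \<omega>' \<partial>M)) \<partial>M)"

text \<open>Constants count as Gaussian.\<close>

definition gaussian_rv :: "'a measure \<Rightarrow> ('a \<Rightarrow> real) \<Rightarrow> bool" where
  "gaussian_rv M Z \<longleftrightarrow> Z \<in> borel_measurable M \<and>
     ((\<exists>\<mu>. AE \<omega> in M. Z \<omega> = \<mu>) \<or>
      (\<exists>\<mu> \<sigma>. 0 < \<sigma> \<and> distributed M lborel Z (\<lambda>x. ennreal (normal_density \<mu> \<sigma> x))))"

definition gaussian_process :: "'a measure \<Rightarrow> real set \<Rightarrow> (real \<Rightarrow> 'a \<Rightarrow> real) \<Rightarrow> bool" where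
  "gaussian_process M I X \<longleftrightarrow> prob_space M \<and>
     (\<forall>J c. finite J \<and> J \<subseteq> I \<longrightarrow> gaussian_rv M (\<lambda>\<omega>. \<Sum>t\<in>J. c t * X t \<omega>))"

definition continuous_gaussian_process ::
  "'a measure \<Rightarrow> real set \<Rightarrow> (real \<Rightarrow> real) \<Rightarrow> (real \<Rightarrow> real \<Rightarrow> real) \<Rightarrow> (real \<Rightarrow> 'a \<Rightarrow> real) \<Rightarrow> bool" where
  "continuous_gaussian_process M I m R X \<longleftrightarrow>
     gaussian_process M I X \<and> continuous_paths M I X \<and>
     (\<forall>t\<in>I. (\<integral>\<omega>. X t \<omega> \<partial>M) = m t) \<and>
     (\<forall>t\<in>I. \<forall>s\<in>I. covariance M (X t) (X s) = R t s)"

definition brownian_motion :: "'a measure \<Rightarrow> (real \<Rightarrow> 'a \<Rightarrow> real) \<Rightarrow> bool" where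
  "brownian_motion M B \<longleftrightarrow> prob_space M \<and>
     (\<forall>t\<ge>0. B t \<in> borel_measurable M) \<and>
     (AE \<omega> in M. B 0 \<omega> = 0) \<and>
     (\<forall>s t. 0 \<le> s \<and> s < t \<longrightarrow>
        distributed M lborel (\<lambda>\<omega>. B t \<omega> - B s \<omega>) (\<lambda>x. ennreal (normal_density 0 (sqrt (t - s)) x))) \<and>
     (\<forall>n p. 0 \<le> p 0 \<and> (\<forall>i<n. p i \<le> p (Suc i)) \<longrightarrow>
        prob_space.indep_vars M (\<lambda>_. borel) (\<lambda>i \<omega>. B (p (Suc i)) \<omega> - B (p i) \<omega>) {..<n::nat}) \<and>
     continuous_paths M {0..} B"

definition independent_processes ::
  "'a measure \<Rightarrow> (real \<Rightarrow> 'a \<Rightarrow> real) \<Rightarrow> (real \<Rightarrow> 'a \<Rightarrow> real) \<Rightarrow> bool" where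
  "independent_processes M X Y \<longleftrightarrow>
     prob_space.indep_var M
       (\<Pi>\<^sub>M t\<in>{0..}. borel) (\<lambda>\<omega>. \<lambda>t\<in>{0..}. X t \<omega>)
       (\<Pi>\<^sub>M t\<in>{0..}. borel) (\<lambda>\<omega>. \<lambda>t\<in>{0..}. Y t \<omega>)"

definition noisy_bm ::
  "real \<Rightarrow> real \<Rightarrow> (real \<Rightarrow> 'a \<Rightarrow> real) \<Rightarrow> (real \<Rightarrow> 'a \<Rightarrow> real) \<Rightarrow> real \<Rightarrow> 'a \<Rightarrow> real" where
  "noisy_bm \<alpha> \<alpha>' B B' t \<omega> = \<alpha> * B t \<omega> + \<alpha>' * B' t \<omega>"


section \<open>Wiener integrals and Volterra processes\<close>

definition square_integrable :: "'a::euclidean_space set \<Rightarrow> ('a \<Rightarrow> real) \<Rightarrow> bool" where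
  "square_integrable A f \<longleftrightarrow>
     set_borel_measurable lebesgue A f \<and> set_integrable lebesgue A (\<lambda>x. (f x)\<^sup>2)"

definition step_fun :: "nat \<Rightarrow> (nat \<Rightarrow> real) \<Rightarrow> (nat \<Rightarrow> real) \<Rightarrow> real \<Rightarrow> real" where
  "step_fun n p c u = (\<Sum>i<n. c i * indicator {p i<..p (Suc i)} u)"

definition step_integral ::
  "(real \<Rightarrow> 'a \<Rightarrow> real) \<Rightarrow> nat \<Rightarrow> (nat \<Rightarrow> real) \<Rightarrow> (nat \<Rightarrow> real) \<Rightarrow> 'a \<Rightarrow> real" where
  "step_integral B n p c \<omega> = (\<Sum>i<n. c i * (B (p (Suc i)) \<omega> - B (p i) \<omega>))"

text \<open>
  \<open>is_wiener_integral M B T f Z\<close> says that \<open>Z\<close> is a version of \<open>\<integral>\<^sub>0\<^sup>T f(u) dB\<^sub>u\<close>: it is the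
  mean-square limit of the integrals of step functions converging to \<open>f\<close> in \<open>L\<^sup>2[0,T]\<close>.
\<close>

definition is_wiener_integral ::
  "'a measure \<Rightarrow> (real \<Rightarrow> 'a \<Rightarrow> real) \<Rightarrow> real \<Rightarrow> (real \<Rightarrow> real) \<Rightarrow> ('a \<Rightarrow> real) \<Rightarrow> bool" where
  "is_wiener_integral M B T f Z \<longleftrightarrow>
     square_integrable {0..T} f \<and>
     Z \<in> borel_measurable M \<and> integrable M (\<lambda>\<omega>. (Z \<omega>)\<^sup>2) \<and>
     (\<exists>n p c.
        (\<forall>k. 0 \<le> p k 0 \<and> (\<forall>i<n k. p k i \<le> p k (Suc i)) \<and> p k (n k) \<le> T) \<and>
        ((\<lambda>k. LINT u:{0..T}|lebesgue. (step_fun (n k) (p k) (c k) u - f u)\<^sup>2) \<longlonglongrightarrow> 0) \<and>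
        ((\<lambda>k. \<integral>\<omega>. (step_integral B (n k) (p k) (c k) \<omega> - Z \<omega>)\<^sup>2 \<partial>M) \<longlonglongrightarrow> 0))"

definition volterra_process ::
  "'a measure \<Rightarrow> (real \<Rightarrow> 'a \<Rightarrow> real) \<Rightarrow> (real \<Rightarrow> real \<Rightarrow> real) \<Rightarrow> (real \<Rightarrow> 'a \<Rightarrow> real) \<Rightarrow> bool" where
  "volterra_process M B K X \<longleftrightarrow>
     brownian_motion M B \<and>
     gaussian_process M {0..} X \<and> (\<forall>t\<ge>0. (\<integral>\<omega>. X t \<omega> \<partial>M) = 0) \<and>
     (\<forall>t s. 0 \<le> t \<and> t < s \<longrightarrow> K t s = 0) \<and>
     (\<forall>T>0. square_integrable ({0..T} \<times> {0..T}) (\<lambda>(t, s). K t s) \<and>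
            (\<forall>t\<in>{0..T}. is_wiener_integral M B T (K t) (X t)))"


section \<open>The conditioned process\<close>

text \<open>
  \<open>\<Psi> t\<close> is a measurable functional on \<open>C[0,T]\<close> representing the conditional expectation of \<open>X t\<close>
  given the path of \<open>W\<close> up to \<open>T\<close>, in a version that is continuous in \<open>t\<close>.
\<close>

definition conditional_mean_functional ::
  "'a measure \<Rightarrow> (real \<Rightarrow> 'a \<Rightarrow> real) \<Rightarrow> (real \<Rightarrow> 'a \<Rightarrow> real) \<Rightarrow> real \<Rightarrow>
   (real \<Rightarrow> (real \<Rightarrow> real) \<Rightarrow> real) \<Rightarrow> bool" where
  "conditional_mean_functional M X W T \<Psi> \<longleftrightarrow>
     (\<forall>t\<ge>0. \<Psi> t \<in> borel_measurable (C_borel T)) \<and>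
     (\<forall>t\<ge>0. AE \<omega> in M. \<Psi> t (path T W \<omega>) = real_cond_exp M (natural_filtration M W T) (X t) \<omega>) \<and>
     (AE \<psi> in path_law M T W. continuous_on {0..} (\<lambda>t. \<Psi> t \<psi>))"

definition Upsilon ::
  "real \<Rightarrow> real \<Rightarrow> (real \<Rightarrow> real \<Rightarrow> real) \<Rightarrow> real \<Rightarrow> real \<Rightarrow> real \<Rightarrow> real" where
  "Upsilon \<alpha> \<alpha>' K T t s =
     (LINT v:{0..min t s}|lebesgue.
        (1 - \<alpha>\<^sup>2 / (\<alpha>\<^sup>2 + \<alpha>'\<^sup>2) * indicator {0..T} v)\<^sup>2 * (K t v * K s v)) +
     \<alpha>\<^sup>2 * \<alpha>'\<^sup>2 / (\<alpha>\<^sup>2 + \<alpha>'\<^sup>2)\<^sup>2 * (LINT v:{0..T}|lebesgue. K t v * K s v)"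

definition Upsilon_bar ::
  "real \<Rightarrow> real \<Rightarrow> (real \<Rightarrow> real \<Rightarrow> real) \<Rightarrow> (real \<Rightarrow> real \<Rightarrow> real) \<Rightarrow> real \<Rightarrow> real \<Rightarrow> real" where
  "Upsilon_bar \<alpha> \<alpha>' Kbar kbar t s =
     \<alpha>\<^sup>2 / (\<alpha>\<^sup>2 + \<alpha>'\<^sup>2) * (LINT u:{0..min t s}|lebesgue. Kbar t u * Kbar s u) +
     \<alpha>'\<^sup>2 / (\<alpha>\<^sup>2 + \<alpha>'\<^sup>2) * kbar t s"


section \<open>Reproducing kernel Hilbert spaces\<close>

text \<open>
  Functions on \<open>S\<close> are extensional, so the vector space operations are the pointwise ones
  restricted to \<open>S\<close>. The Hilbert space is determined by \<open>k\<close> on \<open>S \<times> S\<close> (Moore--Aronszajn);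
  only the values of \<open>ip\<close> on \<open>H\<close> matter.
\<close>

locale rkhs =
  fixes S :: "'x set" and k :: "'x \<Rightarrow> 'x \<Rightarrow> real"
    and H :: "('x \<Rightarrow> real) set" and ip :: "('x \<Rightarrow> real) \<Rightarrow> ('x \<Rightarrow> real) \<Rightarrow> real"
  assumes subset_extensional: "H \<subseteq> extensional S"
    and zero_in: "(\<lambda>x\<in>S. 0) \<in> H"
    and add_in: "\<lbrakk>f \<in> H; g \<in> H\<rbrakk> \<Longrightarrow> (\<lambda>x\<in>S. f x + g x) \<in> H"
    and scale_in: "f \<in> H \<Longrightarrow> (\<lambda>x\<in>S. c * f x) \<in> H"
    and ip_commute: "\<lbrakk>f \<in> H; g \<in> H\<rbrakk> \<Longrightarrow> ip f g = ip g f"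
    and ip_add: "\<lbrakk>f \<in> H; g \<in> H; h \<in> H\<rbrakk> \<Longrightarrow> ip (\<lambda>x\<in>S. f x + g x) h = ip f h + ip g h"
    and ip_scale: "\<lbrakk>f \<in> H; h \<in> H\<rbrakk> \<Longrightarrow> ip (\<lambda>x\<in>S. c * f x) h = c * ip f h"
    and ip_nonneg: "f \<in> H \<Longrightarrow> 0 \<le> ip f f"
    and ip_definite: "\<lbrakk>f \<in> H; ip f f = 0\<rbrakk> \<Longrightarrow> f = (\<lambda>x\<in>S. 0)"
    and complete:
      "\<lbrakk>\<forall>n::nat. \<phi> n \<in> H;
        \<forall>e>0. \<exists>n0. \<forall>m\<ge>n0. \<forall>n\<ge>n0.
          sqrt (ip (\<lambda>x\<in>S. \<phi> m x - \<phi> n x) (\<lambda>x\<in>S. \<phi> m x - \<phi> n x)) < e\<rbrakk>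
       \<Longrightarrow> \<exists>f\<in>H. (\<lambda>n. sqrt (ip (\<lambda>x\<in>S. \<phi> n x - f x) (\<lambda>x\<in>S. \<phi> n x - f x))) \<longlonglongrightarrow> 0"
    and kernel_in: "s \<in> S \<Longrightarrow> (\<lambda>x\<in>S. k x s) \<in> H"
    and reproducing: "\<lbrakk>f \<in> H; s \<in> S\<rbrakk> \<Longrightarrow> ip f (\<lambda>x\<in>S. k x s) = f s"

definition rkhs_norm :: "(('x \<Rightarrow> real) \<Rightarrow> ('x \<Rightarrow> real) \<Rightarrow> real) \<Rightarrow> ('x \<Rightarrow> real) \<Rightarrow> real" where
  "rkhs_norm ip h = sqrt (ip h h)"

definition rkhs_rate ::
  "('x \<Rightarrow> real) set \<Rightarrow> (('x \<Rightarrow> real) \<Rightarrow> ('x \<Rightarrow> real) \<Rightarrow> real) \<Rightarrow> ('x \<Rightarrow> real) \<Rightarrow> ereal" where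
  "rkhs_rate H ip h = (if h \<in> H then ereal (1 / 2 * (rkhs_norm ip h)\<^sup>2) else \<infinity>)"


section \<open>Large deviation principles on the space of continuous functions on the unit interval\<close>

definition rate_function :: "((real \<Rightarrow> real) \<Rightarrow> ereal) \<Rightarrow> bool" where
  "rate_function I \<longleftrightarrow>
     (\<forall>h\<in>C_space 1. 0 \<le> I h) \<and>
     (\<forall>a. openin (C_topology 1) {h \<in> C_space 1. a < I h})"

definition good_rate_function :: "((real \<Rightarrow> real) \<Rightarrow> ereal) \<Rightarrow> bool" where
  "good_rate_function I \<longleftrightarrow>
     rate_function I \<and> (\<forall>a::real. 0 \<le> a \<longrightarrow> compactin (C_topology 1) {h \<in> C_space 1. I h \<le> ereal a})"

text \<open>The logarithm of a probability, with value \<open>-\<infinity>\<close> at \<open>0\<close> (\<^term>\<open>ln 0 = (0::real)\<close>).\<close>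

definition log_prob :: "real \<Rightarrow> ereal" where
  "log_prob q = (if q = 0 then -\<infinity> else ereal (ln q))"

text \<open>
  \<open>U \<epsilon>\<close> is a process on the probability space \<open>N\<close>, for every \<open>\<epsilon> > 0\<close>; the measurability
  clause says that it is a random element of \<open>C[0,1]\<close>.
\<close>

definition satisfies_LDP ::
  "'b measure \<Rightarrow> (real \<Rightarrow> real \<Rightarrow> 'b \<Rightarrow> real) \<Rightarrow> (real \<Rightarrow> real) \<Rightarrow> ((real \<Rightarrow> real) \<Rightarrow> ereal) \<Rightarrow> bool" where
  "satisfies_LDP N U \<eta> I \<longleftrightarrow>
     prob_space N \<and>
     (\<forall>\<epsilon>>0. path 1 (U \<epsilon>) \<in> measurable N (C_borel 1)) \<and>
     rate_function I \<and>
     (\<forall>\<epsilon>>0. 0 < \<eta> \<epsilon>) \<and> (\<eta> \<longlongrightarrow> 0) (at_right 0) \<and>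
     (\<forall>\<Theta>. openin (C_topology 1) \<Theta> \<longrightarrow>
        - (INF h\<in>\<Theta>. I h) \<le>
          Liminf (at_right 0)
            (\<lambda>\<epsilon>. ereal (\<eta> \<epsilon>) * log_prob (measure N {\<omega> \<in> space N. path 1 (U \<epsilon>) \<omega> \<in> \<Theta>}))) \<and>
     (\<forall>\<Gamma>. closedin (C_topology 1) \<Gamma> \<longrightarrow>
        Limsup (at_right 0)
            (\<lambda>\<epsilon>. ereal (\<eta> \<epsilon>) * log_prob (measure N {\<omega> \<in> space N. path 1 (U \<epsilon>) \<omega> \<in> \<Gamma>}))
          \<le> - (INF h\<in>\<Gamma>. I h))"

end

theory Submission
  imports Defs "HOL-Complex_Analysis.Great_Picard"
begin

text \<open>
  Fix \<open>\<psi>\<close> and let \<open>U \<epsilon> t = Xc \<psi> (T + \<epsilon> * t) - Xc \<psi> T\<close>. Write \<open>U \<epsilon> = m \<epsilon> + Z \<epsilon>\<close> with \<open>m \<epsilon>\<close> the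
  mean and \<open>Z \<epsilon>\<close> centered Gaussian with covariance \<open>(\<gamma> \<epsilon>)\<^sup>2 * R \<epsilon>\<close>. The mean tends to 0 uniformly on
  the unit interval because the conditional mean is continuous at \<open>T\<close>; so \<open>\<psi>\<close> disappears in the limit.

  Let \<open>b = \<alpha>'\<^sup>2 / (\<alpha>\<^sup>2 + \<alpha>'\<^sup>2)\<close> and \<open>a = 1 - b\<close>. The weights of the product \<open>K u * K v\<close> in the two integrals
  of \<open>Upsilon\<close> add up to \<open>b\<close> before time \<open>T\<close> and to 1 after it. With the Wiener isometry this gives
  \<open>(\<gamma> \<epsilon>)\<^sup>2 * R \<epsilon> t s = b * Cov (X (T + \<epsilon> * t) - X T) (X (T + \<epsilon> * s) - X T) + a * J\<close>,
  where \<open>J\<close> is the integral of \<open>K (T + \<epsilon> * t) * K (T + \<epsilon> * s)\<close> over the times after \<open>T\<close>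
  (\<open>increment_cov_eq\<close>). Rescaling \<open>J\<close> to the unit interval shows that \<open>R \<epsilon>\<close> converges to \<open>Upsilon_bar\<close>
  (\<open>increment_cov_tendsto\<close>). The variance of an increment of \<open>Z \<epsilon>\<close> is a convex combination of the
  integral of \<open>(K u - K v)\<^sup>2\<close> over the whole past and of the same integral over the times after \<open>T\<close>; it is
  therefore at most the variance of the increment of \<open>X\<close> (\<open>increment_cov_variance_le\<close>), which is
  controlled by the Hoelder bound with exponent \<open>\<tau>\<close>, uniformly in \<open>\<epsilon>\<close>.

  What remains is a statement on Gaussian families alone (\<open>gaussian_LDP\<close>): convergent covariances
  and a uniform Hoelder bound imply the large deviation principle. Its ingredients are as follows.

  \<^item> Chaining over dyadic times gives exponential tightness on the compact sets \<open>chaining_set L \<rho>\<close>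
    (\<open>exponential_tightness\<close>).

  \<^item> For a finite combination \<open>\<lambda>\<close> of point evaluations, the exponential Markov inequality bounds the
    probability of a half-space by the exponent \<open>\<lambda> h - Var \<lambda> / 2\<close>. Covering a compact set by such
    half-spaces gives the upper bound (\<open>upper_bound\<close>) with the rate \<open>SUP \<lambda>. \<lambda> h - Var \<lambda> / 2\<close>. This supremum
    is half the squared norm of \<open>h\<close> in the reproducing kernel Hilbert space, and it is infinite
    outside this space (\<open>bounded_legendre_transform\<close>).

  \<^item> Exponential tilting by \<open>\<lambda>\<close> turns \<open>Z \<epsilon>\<close> into a Gaussian process with the same covariance and with
    mean \<open>R \<epsilon> \<lambda>\<close>, so the tilted process concentrates at a finite combination of kernel functions. This
    gives the lower bound near such combinations at finitely many times (\<open>lower_bound_finite\<close>),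
    chaining extends it to the uniform distance (\<open>lower_bound_ball\<close>), and the combinations are dense
    (\<open>comb_dense\<close>).
\<close>

section \<open>The space of continuous functions on the unit interval\<close>

interpretation C1: Metric_space "C_space 1" "sup_dist 1"
  by (rule Metric_space_C_space) simp

lemma C_topology_1: "C_topology 1 = C1.mtopology"
  by (simp add: C_topology_def)

lemma sup_dist_least:
  assumes "0 \<le> T" "f \<in> C_space T" "g \<in> C_space T"
    and "\<And>t. t \<in> {0..T} \<Longrightarrow> \<bar>f t - g t\<bar> \<le> r"
  shows "sup_dist T f g \<le> r"
  using assms by (auto simp: sup_dist_def intro!: cSUP_least)

lemma continuous_map_evaluation:
  assumes "t \<in> {0..1}"
  shows "continuous_map (C_topology 1) euclideanreal (\<lambda>f. f t)"
  unfolding C_topology_1 C1.metric_continuous_map[OF Met_TC.Metric_space_axioms, simplified]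
  using sup_dist_bound[OF _ _ assms]
  by (auto simp: dist_real_def intro: le_less_trans)

lemma continuous_map_evaluation_sum:
  assumes "finite J" "J \<subseteq> {0..1}"
  shows "continuous_map (C_topology 1) euclideanreal (\<lambda>f. \<Sum>t\<in>J. c t * f t)"
  using assms by (intro continuous_map_sum continuous_map_real_mult continuous_map_evaluation) auto

lemma path_in_C_space:
  assumes "continuous_on {0..1} (\<lambda>t. X t \<omega>)"
  shows "path 1 X \<omega> \<in> C_space 1"
proof -
  have "continuous_on {0..1} (path 1 X \<omega>) \<longleftrightarrow> continuous_on {0..1} (\<lambda>t. X t \<omega>)"
    by (rule continuous_on_cong) (auto simp: path_def)
  with assms show ?thesis
    by (auto simp: C_space_def path_def)
qed

text \<open>
  Bernstein polynomials with rational coefficients: a countable dense subset of \<open>C[0,1]\<close>. It makes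
  every open set a countable union of balls, which is what the measurability of paths rests on.
\<close>

definition rational_bernstein :: "rat list \<Rightarrow> real \<Rightarrow> real" where
  "rational_bernstein qs =
     (\<lambda>t\<in>{0..1}. \<Sum>k\<le>length qs - 1. of_rat (qs ! k) * Bernstein (length qs - 1) k t)"

lemma rational_bernstein_in_C_space: "rational_bernstein qs \<in> C_space 1"
proof -
  have "continuous_on {0..1} (rational_bernstein qs) \<longleftrightarrow>
    continuous_on {0..1} (\<lambda>t. \<Sum>k\<le>length qs - 1. of_rat (qs ! k) * Bernstein (length qs - 1) k t)"
    by (rule continuous_on_cong) (auto simp: rational_bernstein_def)
  moreover have "continuous_on {0..1} (\<lambda>t. \<Sum>k\<le>length qs - 1. of_rat (qs ! k) * Bernstein (length qs - 1) k t)"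
    unfolding Bernstein_def by (intro continuous_intros)
  ultimately show ?thesis
    by (auto simp: C_space_def rational_bernstein_def)
qed

lemma rational_bernstein_dense:
  assumes f: "f \<in> C_space 1" and e: "0 < e"
  shows "\<exists>qs. sup_dist 1 (rational_bernstein qs) f < e"
proof -
  have "continuous_on {0..1} f" using f by (simp add: C_space_def)
  from Bernstein_Weierstrass[OF this, of "e/4"] e
  obtain n where n: "\<And>x. x \<in> {0..1} \<Longrightarrow> \<bar>f x - (\<Sum>k\<le>n. f (k/n) * Bernstein n k x)\<bar> < e/4"
    by auto
  have "\<forall>k::nat. \<exists>q::rat. \<bar>of_rat q - f (k/n)\<bar> < e/4"
  proof
    fix k :: nat
    obtain q where "f (k/n) - e/4 < of_rat q" "of_rat q < f (k/n)"
      using of_rat_dense[of "f (k/n) - e/4" "f (k/n)"] e by auto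
    then show "\<exists>q::rat. \<bar>of_rat q - f (k/n)\<bar> < e/4" by (intro exI[of _ q]) auto
  qed
  then obtain q :: "nat \<Rightarrow> rat" where q: "\<bar>of_rat (q k) - f (real k/n)\<bar> < e/4" for k
    by metis
  define qs where "qs = map q [0..<Suc n]"
  have len: "length qs - 1 = n" by (simp add: qs_def)
  have "\<bar>rational_bernstein qs t - f t\<bar> \<le> e/2" if t: "t \<in> {0..1}" for t
  proof -
    have "rational_bernstein qs t - (\<Sum>k\<le>n. f (k/n) * Bernstein n k t)
        = (\<Sum>k\<le>n. of_rat (q k) * Bernstein n k t) - (\<Sum>k\<le>n. f (k/n) * Bernstein n k t)"
      unfolding rational_bernstein_def len using t
      by (auto simp: qs_def nth_append simp del: upt_Suc intro!: sum.cong)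
    also have "\<dots> = (\<Sum>k\<le>n. (of_rat (q k) - f (k/n)) * Bernstein n k t)"
      by (simp add: sum_subtractf algebra_simps)
    also have "\<bar>\<dots>\<bar> \<le> (\<Sum>k\<le>n. e/4 * Bernstein n k t)"
      by (rule order_trans[OF sum_abs sum_mono])
        (use t q in \<open>auto simp only: abs_mult abs_of_nonneg[OF Bernstein_nonneg] atLeastAtMost_iff
            intro!: mult_right_mono less_imp_le[OF q] Bernstein_nonneg\<close>)
    also have "\<dots> = e/4"
      by (simp only: sum_distrib_left[symmetric] sum_Bernstein mult_1_right)
    finally show ?thesis using n[OF t] by linarith
  qed
  then have "sup_dist 1 (rational_bernstein qs) f \<le> e/2"
    by (intro sup_dist_least f rational_bernstein_in_C_space) auto
  with e show ?thesis by (intro exI[of _ qs]) auto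
qed

lemma closure_rationals_unit_interval: "closure ({0<..<1} \<inter> \<rat>) = {0..1::real}"
  using closure_open_Int_superset[of "{0<..<1::real}" "\<rat>"] by (simp add: Rats_closure_real)

text \<open>
  The margin \<open>1 / Suc n\<close> turns the strict inequality for the supremum into conditions at countably many
  rational times; these times are dense in the interval.
\<close>

lemma sup_dist_less_iff:
  assumes f: "f \<in> C_space 1" and g: "g \<in> C_space 1"
  shows "sup_dist 1 f g < r \<longleftrightarrow> (\<exists>n::nat. \<forall>t\<in>{0<..<1}\<inter>\<rat>. \<bar>f t - g t\<bar> \<le> r - 1 / Suc n)"
proof
  assume less: "sup_dist 1 f g < r"
  then obtain n :: nat where n: "1 / Suc n < r - sup_dist 1 f g"
    by (metis less diff_gt_0_iff_gt nat_approx_posE)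
  show "\<exists>n::nat. \<forall>t\<in>{0<..<1}\<inter>\<rat>. \<bar>f t - g t\<bar> \<le> r - 1 / Suc n"
  proof (intro exI ballI)
    fix t :: real assume "t \<in> {0<..<1} \<inter> \<rat>"
    then show "\<bar>f t - g t\<bar> \<le> r - 1 / Suc n"
      using n sup_dist_bound[OF f g, of t] by simp
  qed
next
  assume "\<exists>n::nat. \<forall>t\<in>{0<..<1}\<inter>\<rat>. \<bar>f t - g t\<bar> \<le> r - 1 / Suc n"
  then obtain n :: nat where "\<forall>t\<in>{0<..<1}\<inter>\<rat>. \<bar>f t - g t\<bar> \<le> r - 1 / Suc n" by (rule exE)
  then have n: "\<And>t. t\<in>{0<..<1}\<inter>\<rat> \<Longrightarrow> \<bar>f t - g t\<bar> \<le> r - 1 / Suc n" by (rule bspec)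
  have "\<bar>f t - g t\<bar> \<le> r - 1 / Suc n" if "t \<in> {0..1}" for t
    by (rule continuous_le_on_closure[where f="\<lambda>t. \<bar>f t - g t\<bar>" and S="{0<..<1}\<inter>\<rat>"])
      (use that f g n in \<open>auto simp: closure_rationals_unit_interval C_space_def intro!: continuous_intros\<close>)
  then have "sup_dist 1 f g \<le> r - 1 / Suc n"
    by (intro sup_dist_least f g) auto
  moreover have "0 < 1 / real (Suc n)" by simp
  ultimately show "sup_dist 1 f g < r" by linarith
qed

text \<open>
  The coordinates generate the Borel sets of \<open>C[0,1]\<close>: an open set is a countable union of balls around
  the polynomials \<open>rational_bernstein\<close>, and a ball depends on the values at rational times only.
\<close>

lemma path_measurable:
  assumes meas: "\<And>t. t \<in> {0..1} \<Longrightarrow> X t \<in> borel_measurable N"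
    and cont: "continuous_paths N {0..1} X"
  shows "path 1 X \<in> measurable N (C_borel 1)"
  unfolding C_borel_def
proof (rule measurable_measure_of)
  show "{U. openin (C_topology 1) U} \<subseteq> Pow (C_space 1)"
    using openin_subset topspace_C_topology[of 1] by fastforce
  show "path 1 X \<in> space N \<rightarrow> C_space 1"
    using cont by (auto simp: continuous_paths_def intro: path_in_C_space)
next
  fix U assume "U \<in> {U. openin (C_topology 1) U}"
  then have U: "U \<subseteq> C_space 1" "\<And>f. f \<in> U \<Longrightarrow> \<exists>r>0. C1.mball f r \<subseteq> U"
    by (auto simp: C_topology_1 C1.openin_mtopology)
  define I where "I = {(qs, q). C1.mball (rational_bernstein qs) (of_rat q) \<subseteq> U}"
  have "U \<subseteq> (\<Union>(qs, q)\<in>I. C1.mball (rational_bernstein qs) (of_rat q))"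
  proof
    fix f assume f: "f \<in> U"
    then obtain r where r: "r > 0" "C1.mball f r \<subseteq> U" using U by blast
    have fC: "f \<in> C_space 1" using f U by auto
    obtain qs where qs: "sup_dist 1 (rational_bernstein qs) f < r/3"
      using rational_bernstein_dense[OF fC, of "r/3"] r by auto
    obtain q where q: "r/3 < of_rat q" "of_rat q < r/2"
      using of_rat_dense[of "r/3" "r/2"] r by auto
    have "C1.mball (rational_bernstein qs) (of_rat q) \<subseteq> C1.mball f r"
      using qs q fC rational_bernstein_in_C_space[of qs]
      by (intro C1.mball_subset) auto
    with r have "(qs, q) \<in> I" by (auto simp: I_def)
    moreover have "f \<in> C1.mball (rational_bernstein qs) (of_rat q)"
      using qs q fC rational_bernstein_in_C_space by auto
    ultimately show "f \<in> (\<Union>(qs, q)\<in>I. C1.mball (rational_bernstein qs) (of_rat q))"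
      by (intro UN_I[of "(qs, q)"]) simp_all
  qed
  then have "U = (\<Union>(qs, q)\<in>I. C1.mball (rational_bernstein qs) (of_rat q))"
    unfolding I_def by blast
  then have "path 1 X -` U \<inter> space N =
      (\<Union>(qs, q)\<in>I. {\<omega>\<in>space N. path 1 X \<omega> \<in> C1.mball (rational_bernstein qs) (of_rat q)})"
    by blast
  also have "\<dots> = (\<Union>(qs, q)\<in>I. {\<omega>\<in>space N. \<exists>n::nat. \<forall>t\<in>{0<..<1}\<inter>\<rat>.
       \<bar>rational_bernstein qs t - X t \<omega>\<bar> \<le> of_rat q - 1 / Suc n})"
  proof -
    have "path 1 X \<omega> \<in> C1.mball (rational_bernstein qs) (of_rat q) \<longleftrightarrow>
       (\<exists>n::nat. \<forall>t\<in>{0<..<1}\<inter>\<rat>. \<bar>rational_bernstein qs t - X t \<omega>\<bar> \<le> of_rat q - 1 / Suc n)"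
      if "\<omega> \<in> space N" for \<omega> qs q
    proof -
      have C: "path 1 X \<omega> \<in> C_space 1"
        using cont that by (auto simp: continuous_paths_def intro: path_in_C_space)
      have "path 1 X \<omega> t = X t \<omega>" if "t \<in> {0<..<1}\<inter>\<rat>" for t
        using that by (auto simp: path_def)
      then show ?thesis
        using C rational_bernstein_in_C_space[of qs] by (auto simp: sup_dist_less_iff)
    qed
    then show ?thesis by (intro SUP_cong refl) auto
  qed
  also have "\<dots> \<in> sets N"
  proof -
    have count: "countable ({0<..<1}\<inter>(\<rat>::real set))" by (intro countable_Int2 countable_rat)
    have "{\<omega>\<in>space N. \<exists>n::nat. \<forall>t\<in>{0<..<1}\<inter>\<rat>.
       \<bar>rational_bernstein qs t - X t \<omega>\<bar> \<le> of_rat q - 1 / Suc n} \<in> sets N" for qs q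
      by (intro sets.sets_Collect_countable_Ex sets.sets_Collect_countable_All' count)
        (auto intro!: borel_measurable_le meas borel_measurable_abs borel_measurable_diff)
    moreover have "countable I" by (rule countableI_type)
    ultimately show ?thesis by (intro sets.countable_UN') auto
  qed
  finally show "path 1 X -` U \<inter> space N \<in> sets N" .
qed

lemma path_open_event:
  assumes "\<And>t. t \<in> {0..1} \<Longrightarrow> X t \<in> borel_measurable N" "continuous_paths N {0..1} X"
    and "openin (C_topology 1) U"
  shows "{\<omega> \<in> space N. path 1 X \<omega> \<in> U} \<in> sets N"
proof -
  have "{U. openin (C_topology 1) U} \<subseteq> Pow (C_space 1)"
    using openin_subset topspace_C_topology[of 1] by fastforce
  with assms(3) have "U \<in> sets (C_borel 1)"
    unfolding C_borel_def by (simp add: sets_measure_of)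
  from measurable_sets[OF path_measurable[OF assms(1,2)] this]
  show ?thesis by (simp add: vimage_def Int_def conj_commute)
qed

lemma path_closed_event:
  assumes "\<And>t. t \<in> {0..1} \<Longrightarrow> X t \<in> borel_measurable N" "continuous_paths N {0..1} X"
    and "closedin (C_topology 1) U"
  shows "{\<omega> \<in> space N. path 1 X \<omega> \<in> U} \<in> sets N"
proof -
  have op: "openin (C_topology 1) (C_space 1 - U)"
    using assms(3) topspace_C_topology[of 1] by (metis closedin_def zero_le_one)
  have "{\<omega> \<in> space N. path 1 X \<omega> \<in> U} = space N - {\<omega> \<in> space N. path 1 X \<omega> \<in> C_space 1 - U}"
    using assms(2) path_in_C_space[of X] closedin_subset[OF assms(3)] topspace_C_topology[of 1]
    by (auto simp: continuous_paths_def)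
  then show ?thesis using path_open_event[OF assms(1,2) op] by auto
qed

text \<open>
  Geometric control of all dyadic increments. These are the compact sets that carry almost all
  of the mass of the Gaussian families below.
\<close>

definition chaining_set :: "real \<Rightarrow> real \<Rightarrow> (real \<Rightarrow> real) set" where
  "chaining_set L \<rho> = {f \<in> C_space 1. f 0 = 0 \<and>
     (\<forall>n. \<forall>k<2^n. \<bar>f (real (Suc k) / 2^n) - f (real k / 2^n)\<bar> \<le> L * \<rho>^n)}"

definition dyadic_floor :: "nat \<Rightarrow> real \<Rightarrow> real" where
  "dyadic_floor n t = real (nat \<lfloor>2^n * t\<rfloor>) / 2^n"

lemma dyadic_floor_bounds:
  assumes "0 \<le> t"
  shows "dyadic_floor n t \<le> t" "t < dyadic_floor n t + 1 / 2^n"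
proof -
  have "real (nat \<lfloor>2^n * t\<rfloor>) = of_int \<lfloor>2^n * t\<rfloor>" using assms by simp
  then have "real (nat \<lfloor>2^n * t\<rfloor>) \<le> 2^n * t" "2^n * t < real (nat \<lfloor>2^n * t\<rfloor>) + 1" by linarith+
  then show "dyadic_floor n t \<le> t" "t < dyadic_floor n t + 1 / 2^n"
    by (simp_all add: dyadic_floor_def field_simps)
qed

lemma dyadic_floor_tendsto:
  assumes "0 \<le> t"
  shows "(\<lambda>n. dyadic_floor n t) \<longlonglongrightarrow> t"
proof (rule tendsto_sandwich[where f="\<lambda>n. t - (1/2)^n" and h="\<lambda>_. t"])
  show "(\<lambda>n. t - (1/2)^n) \<longlonglongrightarrow> t"
    by (rule tendsto_eq_intros LIMSEQ_power_zero | simp)+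
qed (use dyadic_floor_bounds[OF assms] in \<open>auto simp: power_one_over field_simps intro!: always_eventually less_imp_le\<close>)

lemma dyadic_floor_le: "t \<le> 1 \<Longrightarrow> nat \<lfloor>2^n * t\<rfloor> \<le> 2^n" for t :: real
proof -
  assume "t \<le> 1"
  then have "2^n * t \<le> 2^n" by simp
  then have "\<lfloor>2^n * t\<rfloor> \<le> \<lfloor>2^n :: real\<rfloor>" by (rule floor_mono)
  then have "\<lfloor>2^n * t\<rfloor> \<le> 2^n" by simp
  then show ?thesis by (simp add: nat_le_iff)
qed

lemma dyadic_in_unit_interval:
  assumes "k \<le> 2^n"
  shows "real k / 2^n \<in> {0..1}"
proof -
  have "real k \<le> 2^n" using assms by (metis of_nat_le_iff of_nat_numeral of_nat_power)
  then show ?thesis by (auto simp: divide_le_eq_1)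
qed

lemma dyadic_floor_in: "t \<in> {0..1} \<Longrightarrow> dyadic_floor n t \<in> {0..1}"
  using dyadic_floor_bounds[of t n] by (simp add: order.trans[of _ t]) (simp add: dyadic_floor_def)

lemma chaining_set_step:
  assumes f: "f \<in> chaining_set L \<rho>" and jk: "j \<le> k" "k \<le> Suc j" "k \<le> 2^n" and L: "0 \<le> L * \<rho>^n"
  shows "\<bar>f (real k / 2^n) - f (real j / 2^n)\<bar> \<le> L * \<rho>^n"
proof (cases "k = j")
  case False
  then have "k = Suc j" using jk by simp
  with f jk show ?thesis by (auto simp: chaining_set_def)
qed (use L in auto)

text \<open>
  Chaining: from level \<open>m\<close> to level \<open>Suc m\<close> the dyadic floor of \<open>t\<close> moves by at most one step of level \<open>Suc m\<close>,
  so the distance is bounded by the tail of a geometric series.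
\<close>

lemma chaining_set_approx:
  assumes f: "f \<in> chaining_set L \<rho>" and L: "0 \<le> L" and \<rho>: "0 < \<rho>" "\<rho> < 1" and t: "t \<in> {0..1}"
  shows "\<bar>f t - f (dyadic_floor n t)\<bar> \<le> L * \<rho>^n / (1 - \<rho>)"
proof -
  have step: "\<bar>f (dyadic_floor (Suc m) t) - f (dyadic_floor m t)\<bar> \<le> L * \<rho>^Suc m" for m
  proof -
    define k where "k = nat \<lfloor>2^m * t\<rfloor>"
    define k' where "k' = nat \<lfloor>2^Suc m * t\<rfloor>"
    have "2 * k \<le> k'" "k' \<le> Suc (2 * k)"
      unfolding k_def k'_def using t
      by (simp_all add: mult.assoc) linarith+
    moreover have "k' \<le> 2^Suc m" unfolding k'_def by (rule dyadic_floor_le) (use t in auto)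
    ultimately have "\<bar>f (real k' / 2^Suc m) - f (real (2*k) / 2^Suc m)\<bar> \<le> L * \<rho>^Suc m"
      by (intro chaining_set_step[OF f]) (use L \<rho> in auto)
    moreover have "real (2*k) / 2^Suc m = real k / 2^m" by simp
    ultimately show ?thesis by (simp only: dyadic_floor_def k_def k'_def)
  qed
  have "\<bar>f (dyadic_floor (n+j) t) - f (dyadic_floor n t)\<bar> \<le> L * \<rho>^n * ((1 - \<rho>^j) / (1 - \<rho>))" for j
  proof (induction j)
    case (Suc j)
    have "\<bar>f (dyadic_floor (n+Suc j) t) - f (dyadic_floor n t)\<bar> \<le> L * \<rho>^Suc (n+j) + L * \<rho>^n * ((1 - \<rho>^j) / (1 - \<rho>))"
      using step[of "n+j"] Suc by (simp only: add_Suc_right)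
    also have "\<dots> = L * \<rho>^n * (\<rho>^Suc j + (1 - \<rho>^j) / (1 - \<rho>))"
      by (simp add: power_add algebra_simps)
    also have "\<dots> \<le> L * \<rho>^n * (\<rho>^j + (1 - \<rho>^j) / (1 - \<rho>))"
      using L \<rho> by (intro mult_left_mono add_right_mono) (auto simp: mult_le_cancel_right2)
    also have "\<rho>^j + (1 - \<rho>^j) / (1 - \<rho>) = (1 - \<rho>^Suc j) / (1 - \<rho>)"
      using \<rho> by (simp add: field_simps)
    finally show ?case .
  qed simp
  then have "\<bar>f (dyadic_floor (n+j) t) - f (dyadic_floor n t)\<bar> \<le> L * \<rho>^n / (1 - \<rho>)" for j
  proof (rule order_trans)
    have "L * \<rho>^n * ((1 - \<rho>^j) / (1 - \<rho>)) \<le> L * \<rho>^n * (1 / (1 - \<rho>))"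
      using L \<rho> by (intro mult_left_mono divide_right_mono) auto
    then show "L * \<rho>^n * ((1 - \<rho>^j) / (1 - \<rho>)) \<le> L * \<rho>^n / (1 - \<rho>)" by simp
  qed
  moreover have "(\<lambda>j. \<bar>f (dyadic_floor (n+j) t) - f (dyadic_floor n t)\<bar>) \<longlonglongrightarrow> \<bar>f t - f (dyadic_floor n t)\<bar>"
  proof (intro tendsto_intros)
    have "(\<lambda>j. dyadic_floor (j+n) t) \<longlonglongrightarrow> t"
      by (intro LIMSEQ_ignore_initial_segment dyadic_floor_tendsto) (use t in auto)
    then have "(\<lambda>j. dyadic_floor (n+j) t) \<longlonglongrightarrow> t" by (simp add: add.commute)
    moreover have "continuous_on {0..1} f" using f by (auto simp: chaining_set_def C_space_def)
    ultimately show "(\<lambda>j. f (dyadic_floor (n+j) t)) \<longlonglongrightarrow> f t"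
      using dyadic_floor_in[OF t] t by (intro continuous_on_tendsto_compose[of "{0..1}" f]) auto
  qed
  ultimately show ?thesis
    by (intro tendsto_upperbound[where F=sequentially]) auto
qed

lemma chaining_set_modulus:
  assumes f: "f \<in> chaining_set L \<rho>" and L: "0 \<le> L" and \<rho>: "0 < \<rho>" "\<rho> < 1"
    and st: "s \<in> {0..1}" "t \<in> {0..1}" "\<bar>s - t\<bar> < 1 / 2^n"
  shows "\<bar>f s - f t\<bar> \<le> L * \<rho>^n * (1 + 2 / (1 - \<rho>))"
proof -
  have *: "\<bar>f (dyadic_floor n t) - f (dyadic_floor n s)\<bar> \<le> L * \<rho>^n"
    if st: "s \<in> {0..1}" "t \<in> {0..1}" "\<bar>s - t\<bar> < 1 / 2^n" "s \<le> t" for s t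
    unfolding dyadic_floor_def
  proof (rule chaining_set_step[OF f])
    have "2^n * s \<le> 2^n * t" using st by simp
    then show "nat \<lfloor>2^n * s\<rfloor> \<le> nat \<lfloor>2^n * t\<rfloor>" by (intro nat_mono floor_mono)
    have "2^n * t < 2^n * s + 1" using st by (simp add: field_simps)
    then show "nat \<lfloor>2^n * t\<rfloor> \<le> Suc (nat \<lfloor>2^n * s\<rfloor>)" using st by (simp add: nat_le_iff) linarith
    show "nat \<lfloor>2^n * t\<rfloor> \<le> 2^n" using st by (intro dyadic_floor_le) auto
  qed (use L \<rho> in auto)
  have "\<bar>f (dyadic_floor n t) - f (dyadic_floor n s)\<bar> \<le> L * \<rho>^n"
    using *[of s t] *[of t s] st by (cases "s \<le> t") (auto simp: abs_minus_commute)
  with chaining_set_approx[OF f L \<rho> st(1), of n] chaining_set_approx[OF f L \<rho> st(2), of n]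
  have "\<bar>f s - f t\<bar> \<le> L * \<rho>^n + 2 * (L * \<rho>^n / (1 - \<rho>))" by linarith
  then show ?thesis by (simp add: algebra_simps)
qed

lemma chaining_set_bounded:
  assumes f: "f \<in> chaining_set L \<rho>" and L: "0 \<le> L" and \<rho>: "0 < \<rho>" "\<rho> < 1"
    and t: "t \<in> {0..1}"
  shows "\<bar>f t\<bar> \<le> L + L / (1 - \<rho>)"
proof -
  have "\<bar>f (real (nat \<lfloor>2^0 * t\<rfloor>) / 2^0) - f (real 0 / 2^0)\<bar> \<le> L * \<rho>^0"
    by (rule chaining_set_step[OF f]) (use L t in \<open>auto simp: nat_le_iff floor_le_iff\<close>)
  then have "\<bar>f (dyadic_floor 0 t)\<bar> \<le> L"
    using f by (auto simp: dyadic_floor_def chaining_set_def)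
  with chaining_set_approx[OF f L \<rho> t, of 0] show ?thesis by simp
qed

lemma closedin_chaining_set: "closedin (C_topology 1) (chaining_set L \<rho>)"
proof -
  have eq: "chaining_set L \<rho> = {f \<in> topspace (C_topology 1). f 0 \<in> {0}} \<inter>
     (\<Inter>n. \<Inter>k\<in>{..<2^n}. {f \<in> topspace (C_topology 1). \<bar>f (real (Suc k) / 2^n) - f (real k / 2^n)\<bar> \<in> {..L * \<rho>^n}})"
    by (auto simp: chaining_set_def topspace_C_topology)
  have ne: "{..<2^n :: nat} \<noteq> {}" for n :: nat by (simp add: lessThan_empty_iff)
  show ?thesis
    unfolding eq
  proof (intro closedin_Int closedin_INT)
    show "closedin (C_topology 1) {f \<in> topspace (C_topology 1). f 0 \<in> {0}}"
      by (rule closedin_continuous_map_preimage[OF continuous_map_evaluation]) auto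
  next
    fix n k :: nat assume k: "k \<in> {..<2^n}"
    then have "real (Suc k) / 2^n \<in> {0..1}" "real k / 2^n \<in> {0..1}"
      by (intro dyadic_in_unit_interval; simp)+
    then have "continuous_map (C_topology 1) euclideanreal (\<lambda>f. \<bar>f (real (Suc k) / 2^n) - f (real k / 2^n)\<bar>)"
      by (intro continuous_map_real_abs continuous_map_diff continuous_map_evaluation)
    then show "closedin (C_topology 1) {f \<in> topspace (C_topology 1). \<bar>f (real (Suc k) / 2^n) - f (real k / 2^n)\<bar> \<in> {..L * \<rho>^n}}"
      by (rule closedin_continuous_map_preimage) auto
  qed (use ne in auto)
qed

text \<open>
  Equicontinuity (\<open>chaining_set_modulus\<close>) and boundedness give uniformly convergent subsequences by the
  theorem of Arzela and Ascoli.
\<close>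

lemma compactin_chaining_set:
  assumes L: "0 \<le> L" and \<rho>: "0 < \<rho>" "\<rho> < 1"
  shows "compactin (C_topology 1) (chaining_set L \<rho>)"
  unfolding C_topology_1 C1.compactin_sequentially
proof (intro conjI allI impI)
  show sub: "chaining_set L \<rho> \<subseteq> C_space 1" by (auto simp: chaining_set_def)
  fix \<sigma> :: "nat \<Rightarrow> real \<Rightarrow> real" assume "range \<sigma> \<subseteq> chaining_set L \<rho>"
  then have \<sigma>: "\<sigma> n \<in> chaining_set L \<rho>" for n by auto
  have lim: "(\<lambda>n. L * \<rho>^n * (1 + 2 / (1 - \<rho>))) \<longlonglongrightarrow> 0"
    using \<rho> by (auto intro!: tendsto_mult_left_zero tendsto_mult_right_zero LIMSEQ_power_zero)
  obtain g k where g: "continuous_on {0..1} g" and k: "strict_mono (k :: nat \<Rightarrow> nat)"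
    and conv: "\<And>e. 0 < e \<Longrightarrow> \<exists>N. \<forall>n x. n \<ge> N \<and> x \<in> {0..1} \<longrightarrow> norm (\<sigma> (k n) x - g x) < e"
  proof (rule Arzela_Ascoli[of "{0..1::real}" \<sigma> "L + L / (1 - \<rho>)"])
    fix x e :: real assume x: "x \<in> {0..1}" and e: "0 < e"
    obtain n where n: "L * \<rho>^n * (1 + 2 / (1 - \<rho>)) < e"
      using order_tendstoD(2)[OF lim e] by (auto simp: eventually_sequentially)
    show "\<exists>d>0. \<forall>n y. y \<in> {0..1} \<and> norm (x - y) < d \<longrightarrow> norm (\<sigma> n x - \<sigma> n y) < e"
      by (rule exI[of _ "1/2^n"])
        (use x n in \<open>auto intro: le_less_trans[OF chaining_set_modulus[OF \<sigma> L \<rho>]]\<close>)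
  qed (use chaining_set_bounded[OF \<sigma> L \<rho>] in auto)
  define l where "l = restrict g {0..1}"
  have "continuous_on {0..1} l \<longleftrightarrow> continuous_on {0..1} g"
    by (rule continuous_on_cong) (auto simp: l_def)
  then have lC: "l \<in> C_space 1" using g by (auto simp: C_space_def l_def)
  have lm: "limitin C1.mtopology (\<sigma> \<circ> k) l sequentially"
    unfolding C1.limit_metric_sequentially
  proof (intro conjI allI impI lC)
    fix e :: real assume e: "0 < e"
    then obtain N where N: "\<And>n x. n \<ge> N \<Longrightarrow> x \<in> {0..1} \<Longrightarrow> \<bar>\<sigma> (k n) x - g x\<bar> < e/2"
      using conv[of "e/2"] by auto
    have "sup_dist 1 (\<sigma> (k n)) l \<le> e/2" if "n \<ge> N" for n
      using N[OF that] \<sigma>[of "k n"] sub lC by (intro sup_dist_least) (auto simp: l_def less_imp_le)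
    with e have "sup_dist 1 (\<sigma> (k n)) l < e" if "n \<ge> N" for n using that by force
    then show "\<exists>N. \<forall>n\<ge>N. (\<sigma> \<circ> k) n \<in> C_space 1 \<and> sup_dist 1 ((\<sigma> \<circ> k) n) l < e"
      using \<sigma> sub by auto
  qed
  have "range (\<sigma> \<circ> k) \<subseteq> chaining_set L \<rho>" using \<sigma> by auto
  with lm closedin_chaining_set[of L \<rho>] have "l \<in> chaining_set L \<rho>"
    unfolding C_topology_1 C1.metric_closedin_iff_sequentially_closed by blast
  with lm k show "\<exists>l r. l \<in> chaining_set L \<rho> \<and> strict_mono r \<and> limitin C1.mtopology (\<sigma> \<circ> r) l sequentially"
    by blast
qed

text \<open>
  Increments of standard deviation \<open>\<bar>t - s\<bar> powr \<tau>\<close> are compared with the weaker modulus of exponent \<open>\<tau> / 2\<close>.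
  The half that is given up pays for the union bound over all dyadic increments.
\<close>

definition chaining_ratio :: "real \<Rightarrow> real" where
  "chaining_ratio \<tau> = 2 powr (- \<tau> / 2)"

lemma chaining_ratio_bounds: "0 < \<tau> \<Longrightarrow> 0 < chaining_ratio \<tau>" "0 < \<tau> \<Longrightarrow> chaining_ratio \<tau> < 1"
  by (auto simp: chaining_ratio_def powr_less_one)

lemma chaining_ratio_power: "(1 / 2^n) powr (2 * \<tau>) = (chaining_ratio \<tau>^n)^4"
proof -
  have "1 / 2^n = 2 powr (- real n)" by (simp add: powr_minus powr_realpow divide_inverse)
  moreover have "(chaining_ratio \<tau>^n)^4 = 2 powr (- \<tau> / 2 * real n * real 4)"
    unfolding chaining_ratio_def by (simp add: powr_powr flip: powr_realpow)
  ultimately show ?thesis by (simp add: powr_powr mult_ac)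
qed

section \<open>Reproducing kernel Hilbert spaces as Legendre transforms\<close>

text \<open>
  For a covariance \<open>k\<close>, this is the covariance of the combinations of the values at the points of \<open>J\<close>
  with coefficients \<open>c\<close> and \<open>d\<close>.
\<close>

definition kernel_form :: "('x \<Rightarrow> 'x \<Rightarrow> real) \<Rightarrow> 'x set \<Rightarrow> ('x \<Rightarrow> real) \<Rightarrow> ('x \<Rightarrow> real) \<Rightarrow> real" where
  "kernel_form k J c d = (\<Sum>t\<in>J. \<Sum>s\<in>J. c t * d s * k t s)"

text \<open>
  The discriminant criterion, in the form that yields Cauchy--Schwarz inequalities.
\<close>

lemma quadratic_bound_imp_square_le:
  fixes a b d :: real
  assumes "\<And>x. x * a - x\<^sup>2 * b / 2 \<le> d / 2" and b: "0 \<le> b"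
  shows "a\<^sup>2 \<le> b * d"
proof (cases "b = 0")
  case True
  have "a = 0"
  proof (rule ccontr)
    assume "a \<noteq> 0"
    then show False using assms(1)[of "(d / 2 + 1) / a"] True by simp
  qed
  then show ?thesis using True by simp
next
  case False
  then have "a\<^sup>2 / b \<le> d" using assms(1)[of "a / b"] b by (simp add: power2_eq_square field_simps)
  then show ?thesis using False b by (simp add: pos_divide_le_eq mult.commute)
qed

context rkhs
begin

lemma diff_eq: "(\<lambda>x\<in>S. f x - g x) = (\<lambda>x\<in>S. f x + (\<lambda>x\<in>S. (-1) * g x) x)" for f g :: "'x \<Rightarrow> real"
  by (intro restrict_ext) simp

lemma diff_in: "f \<in> H \<Longrightarrow> g \<in> H \<Longrightarrow> (\<lambda>x\<in>S. f x - g x) \<in> H"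
  unfolding diff_eq by (intro add_in scale_in)

lemma ip_diff: "\<lbrakk>f \<in> H; g \<in> H; h \<in> H\<rbrakk> \<Longrightarrow> ip (\<lambda>x\<in>S. f x - g x) h = ip f h - ip g h"
  unfolding diff_eq by (simp only: ip_add scale_in ip_scale)

lemma ip_diff_right: "\<lbrakk>f \<in> H; g \<in> H; h \<in> H\<rbrakk> \<Longrightarrow> ip h (\<lambda>x\<in>S. f x - g x) = ip h f - ip h g"
  by (subst ip_commute) (simp_all add: diff_in ip_diff ip_commute[of h])

lemma ip_add_right: "\<lbrakk>f \<in> H; g \<in> H; h \<in> H\<rbrakk> \<Longrightarrow> ip h (\<lambda>x\<in>S. f x + g x) = ip h f + ip h g"
  by (subst ip_commute) (simp_all add: add_in ip_add ip_commute[of h])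

lemma ip_scale_right: "\<lbrakk>f \<in> H; h \<in> H\<rbrakk> \<Longrightarrow> ip h (\<lambda>x\<in>S. c * f x) = c * ip h f"
  by (subst ip_commute) (simp_all add: scale_in ip_scale ip_commute[of h])

lemma ip_diff_diff:
  "\<lbrakk>f \<in> H; g \<in> H\<rbrakk> \<Longrightarrow> ip (\<lambda>x\<in>S. f x - g x) (\<lambda>x\<in>S. f x - g x) = ip f f - 2 * ip f g + ip g g"
  by (simp add: ip_diff ip_diff_right diff_in ip_commute[of g f])

lemma kernel_sym: "s \<in> S \<Longrightarrow> t \<in> S \<Longrightarrow> k s t = k t s"
  using reproducing[OF kernel_in[of s], of t] reproducing[OF kernel_in[of t], of s]
    ip_commute[OF kernel_in[of s] kernel_in[of t]] by simp

text \<open>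
  The element of \<open>H\<close> that represents the functional taking \<open>f\<close> to the sum of \<open>c t * f t\<close> over \<open>J\<close>.
\<close>

definition comb :: "'x set \<Rightarrow> ('x \<Rightarrow> real) \<Rightarrow> 'x \<Rightarrow> real" where
  "comb J c = (\<lambda>x\<in>S. \<Sum>t\<in>J. c t * k x t)"

lemma comb_insert:
  "finite J \<Longrightarrow> t \<notin> J \<Longrightarrow> comb (insert t J) c = (\<lambda>x\<in>S. (\<lambda>x\<in>S. c t * (\<lambda>x\<in>S. k x t) x) x + comb J c x)"
  unfolding comb_def by (intro restrict_ext) simp

lemma comb_in: "finite J \<Longrightarrow> J \<subseteq> S \<Longrightarrow> comb J c \<in> H"
proof (induction J rule: finite_induct)
  case empty
  show ?case unfolding comb_def sum.empty by (rule zero_in)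
next
  case (insert t J)
  then show ?case unfolding comb_insert[OF insert.hyps] by (intro add_in scale_in kernel_in) auto
qed

lemma ip_comb: "finite J \<Longrightarrow> J \<subseteq> S \<Longrightarrow> f \<in> H \<Longrightarrow> ip f (comb J c) = (\<Sum>t\<in>J. c t * f t)"
proof (induction J rule: finite_induct)
  case empty
  have "ip f (\<lambda>x\<in>S. 0 * f x) = 0 * ip f f" by (rule ip_scale_right) (use empty in auto)
  then show ?case unfolding comb_def sum.empty by (simp only: mult_zero_left)
next
  case (insert t J)
  then have t: "t \<in> S" by auto
  have "ip f (comb (insert t J) c) = c t * ip f (\<lambda>x\<in>S. k x t) + ip f (comb J c)"
    using insert t
    by (subst comb_insert) (auto simp only: ip_add_right scale_in kernel_in comb_in ip_scale_right insert_subset)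
  then show ?case using insert t by (simp add: reproducing)
qed

lemma ip_comb_comb: "finite J \<Longrightarrow> J \<subseteq> S \<Longrightarrow> ip (comb J c) (comb J c) = kernel_form k J c c"
proof -
  assume J: "finite J" "J \<subseteq> S"
  then have "ip (comb J c) (comb J c) = (\<Sum>t\<in>J. c t * (\<Sum>s\<in>J. c s * k t s))"
    by (simp add: ip_comb comb_in) (auto simp: comb_def intro!: sum.cong)
  also have "\<dots> = kernel_form k J c c"
    by (simp add: kernel_form_def sum_distrib_left mult.assoc)
  finally show ?thesis .
qed

text \<open>
  Complete the square: the difference of the two sides is half the squared norm of \<open>h - comb J c\<close>.
\<close>

lemma linear_minus_form_le:
  assumes h: "h \<in> H" and J: "finite J" "J \<subseteq> S"
  shows "(\<Sum>t\<in>J. c t * h t) - kernel_form k J c c / 2 \<le> ip h h / 2"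
proof -
  have "0 \<le> ip (\<lambda>x\<in>S. h x - comb J c x) (\<lambda>x\<in>S. h x - comb J c x)"
    by (intro ip_nonneg diff_in h comb_in J)
  then show ?thesis
    by (simp add: ip_diff_diff h comb_in J ip_comb_comb) (simp add: ip_comb h J)
qed

lemma kernel_nonneg: "s \<in> S \<Longrightarrow> 0 \<le> k s s"
  using ip_nonneg[OF kernel_in[of s]] reproducing[OF kernel_in[of s], of s] by simp

lemma evaluation_bound:
  assumes "h \<in> H" "s \<in> S"
  shows "(h s)\<^sup>2 \<le> k s s * ip h h"
proof (rule quadratic_bound_imp_square_le)
  fix x :: real
  show "x * h s - x\<^sup>2 * k s s / 2 \<le> ip h h / 2"
    using linear_minus_form_le[OF assms(1), of "{s}" "\<lambda>_. x"] assms(2)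
    by (simp add: kernel_form_def power2_eq_square)
qed (use assms kernel_nonneg in auto)

lemma increment_bound:
  assumes h: "h \<in> H" and st: "s \<in> S" "t \<in> S"
  shows "(h t - h s)\<^sup>2 \<le> (k t t - 2 * k t s + k s s) * ip h h"
proof (cases "s = t")
  case False
  have Q: "kernel_form k {s, t} (\<lambda>u. if u = t then x else - x) (\<lambda>u. if u = t then x else - x)
      = x\<^sup>2 * (k t t - 2 * k t s + k s s)" for x
  proof -
    have "k s t = k t s" "t \<noteq> s" by (rule kernel_sym[OF st]) (use False in simp)
    then have "kernel_form k {s, t} (\<lambda>u. if u = t then x else - x) (\<lambda>u. if u = t then x else - x)
        = x * x * k s s - x * x * k t s + (- (x * x * k t s) + x * x * k t t)"
      using False by (simp add: kernel_form_def)
    then show ?thesis by (simp add: power2_eq_square distrib_left left_diff_distrib right_diff_distrib)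
  qed
  show ?thesis
  proof (rule quadratic_bound_imp_square_le)
    fix x :: real
    show "x * (h t - h s) - x\<^sup>2 * (k t t - 2 * k t s + k s s) / 2 \<le> ip h h / 2"
      using linear_minus_form_le[OF h, of "{s, t}" "\<lambda>u. if u = t then x else - x"] st False
      unfolding Q by (simp add: right_diff_distrib)
  next
    have "0 \<le> ip (comb {s, t} (\<lambda>u. if u = t then 1 else - 1)) (comb {s, t} (\<lambda>u. if u = t then 1 else - 1))"
      using st by (intro ip_nonneg comb_in) auto
    then show "0 \<le> k t t - 2 * k t s + k s s"
      unfolding ip_comb_comb[OF _ insert_subsetI[OF st(1) insert_subsetI[OF st(2) empty_subsetI]], simplified] using Q[of 1] by simp
  qed
qed simp

text \<open>
  The graph of the functional that \<open>h\<close> induces on the span of the kernel functions. Different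
  coefficients may describe the same element of the span; working with pairs avoids the question
  whether the value of the functional depends on this choice.
\<close>

definition span_pairs :: "('x \<Rightarrow> real) \<Rightarrow> (('x \<Rightarrow> real) \<times> real) set" where
  "span_pairs h = {(comb J c, \<Sum>t\<in>J. c t * h t) | J c. finite J \<and> J \<subseteq> S}"

lemma span_pairs_add:
  assumes "(g, l) \<in> span_pairs h" "(g', l') \<in> span_pairs h"
  shows "((\<lambda>x\<in>S. g x + g' x), l + l') \<in> span_pairs h"
proof -
  from assms obtain J c J' c' where J: "finite J" "J \<subseteq> S" "finite J'" "J' \<subseteq> S"
    and g: "g = comb J c" "l = (\<Sum>t\<in>J. c t * h t)" "g' = comb J' c'" "l' = (\<Sum>t\<in>J'. c' t * h t)"
    by (auto simp: span_pairs_def)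
  define d where "d t = (if t \<in> J then c t else 0) + (if t \<in> J' then c' t else 0)" for t
  have eq: "(\<Sum>t\<in>J \<union> J'. d t * f t) = (\<Sum>t\<in>J. c t * f t) + (\<Sum>t\<in>J'. c' t * f t)" for f
  proof -
    have "(\<Sum>t\<in>J \<union> J'. d t * f t) = (\<Sum>t\<in>J \<union> J'. if t \<in> J then c t * f t else 0) + (\<Sum>t\<in>J \<union> J'. if t \<in> J' then c' t * f t else 0)"
      unfolding sum.distrib[symmetric] by (intro sum.cong) (auto simp: d_def algebra_simps)
    also have "(\<Sum>t\<in>J \<union> J'. if t \<in> J then c t * f t else 0) = (\<Sum>t\<in>J. c t * f t)"
      using J by (intro sum.mono_neutral_cong_right) auto
    also have "(\<Sum>t\<in>J \<union> J'. if t \<in> J' then c' t * f t else 0) = (\<Sum>t\<in>J'. c' t * f t)"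
      using J by (intro sum.mono_neutral_cong_right) auto
    finally show ?thesis .
  qed
  have "(\<lambda>x\<in>S. g x + g' x) = comb (J \<union> J') d"
    unfolding g comb_def eq by auto
  moreover have "l + l' = (\<Sum>t\<in>J \<union> J'. d t * h t)" by (simp add: eq g)
  ultimately show ?thesis using J unfolding span_pairs_def
    by (intro CollectI exI[of _ "J \<union> J'"] exI[of _ d]) auto
qed

lemma span_pairs_scale:
  assumes "(g, l) \<in> span_pairs h"
  shows "((\<lambda>x\<in>S. a * g x), a * l) \<in> span_pairs h"
proof -
  from assms obtain J c where J: "finite J" "J \<subseteq> S"
    and g: "g = comb J c" "l = (\<Sum>t\<in>J. c t * h t)"
    by (auto simp: span_pairs_def)
  have "(\<lambda>x\<in>S. a * g x) = comb J (\<lambda>t. a * c t)" "a * l = (\<Sum>t\<in>J. a * c t * h t)"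
    by (auto simp: g comb_def sum_distrib_left mult.assoc)
  then show ?thesis using J unfolding span_pairs_def
    by (intro CollectI exI[of _ "J"] exI[of _ "\<lambda>t. a * c t"]) auto
qed

lemma span_pairs_in: "(g, l) \<in> span_pairs h \<Longrightarrow> g \<in> H"
  by (auto simp: span_pairs_def comb_in)

lemma span_pairs_kernel: "s \<in> S \<Longrightarrow> ((\<lambda>x\<in>S. k x s), h s) \<in> span_pairs h"
  unfolding span_pairs_def by (intro CollectI exI[of _ "{s}"] exI[of _ "\<lambda>_. 1"]) (auto simp: comb_def)

text \<open>
  A Riesz representation theorem. Take combinations \<open>g n\<close> that almost attain the supremum \<open>s\<close> of
  \<open>l - ip g g / 2\<close> over the pairs \<open>(g, l)\<close> of \<open>span_pairs h\<close>. By the parallelogram identity, the midpoint of two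
  combinations has the mean of their two values plus an eighth of their squared distance. Hence
  \<open>g n\<close> is a Cauchy sequence, with a limit \<open>f\<close> in \<open>H\<close>. Perturbing \<open>g n\<close> by multiples of a kernel function
  cannot increase the value beyond \<open>s\<close>, and this forces \<open>f\<close> to agree with \<open>h\<close> at every point.
\<close>

theorem bounded_legendre_transform:
  assumes h: "h \<in> extensional S"
    and bound: "\<And>J c. \<lbrakk>finite J; J \<subseteq> S\<rbrakk> \<Longrightarrow> (\<Sum>t\<in>J. c t * h t) - kernel_form k J c c / 2 \<le> A"
  shows "h \<in> H" and "ip h h / 2 \<le> A"
    and "\<And>e. 0 < e \<Longrightarrow> \<exists>J c. finite J \<and> J \<subseteq> S \<and> ip (\<lambda>x\<in>S. h x - comb J c x) (\<lambda>x\<in>S. h x - comb J c x) < e"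
proof -
  define val where "val p = snd p - ip (fst p) (fst p) / 2" for p :: "('x \<Rightarrow> real) \<times> real"
  define s where "s = Sup (val ` span_pairs h)"
  have valA: "val p \<le> A" if "p \<in> span_pairs h" for p
  proof -
    from that obtain J c where J: "finite J" "J \<subseteq> S" and p: "p = (comb J c, \<Sum>t\<in>J. c t * h t)"
      by (auto simp: span_pairs_def)
    show ?thesis unfolding val_def p fst_conv snd_conv ip_comb_comb[OF J] by (rule bound[OF J])
  qed
  then have bdd: "bdd_above (val ` span_pairs h)" by (auto intro!: bdd_aboveI)
  have ne: "val ` span_pairs h \<noteq> {}" by (auto simp: span_pairs_def intro!: exI[of _ "{}"])
  have val_le: "val p \<le> s" if "p \<in> span_pairs h" for p
    unfolding s_def by (intro cSup_upper bdd imageI that)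
  have "\<exists>p\<in>span_pairs h. s - 1 / Suc n < val p" for n
    using less_cSup_iff[OF ne bdd, of "s - 1 / Suc n"] unfolding s_def by auto
  then obtain p where p: "\<And>n. p n \<in> span_pairs h" "\<And>n. s - 1 / Suc n < val (p n)" by metis
  define g where "g n = fst (p n)" for n
  define l where "l n = snd (p n)" for n
  have pgl: "p n = (g n, l n)" for n by (simp add: g_def l_def)
  have gl: "(g n, l n) \<in> span_pairs h" for n using p(1)[of n] by (simp add: pgl)
  have gH: "g n \<in> H" for n using gl span_pairs_in by blast
  have valn: "l n - ip (g n) (g n) / 2 > s - 1 / Suc n" for n using p(2)[of n] by (simp add: val_def pgl)
  have cauchy: "ip (\<lambda>x\<in>S. g m x - g n x) (\<lambda>x\<in>S. g m x - g n x) \<le> 4 * (1 / Suc m + 1 / Suc n)" for m n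
  proof -
    define q where "q = (\<lambda>x\<in>S. 1/2 * (\<lambda>x\<in>S. g m x + g n x) x)"
    have "(q, 1/2 * (l m + l n)) \<in> span_pairs h"
      unfolding q_def by (intro span_pairs_scale span_pairs_add gl)
    from val_le[OF this] have "(l m + l n) / 2 - ip q q / 2 \<le> s" by (simp add: val_def)
    moreover have "ip q q = (ip (g m) (g m) + 2 * ip (g m) (g n) + ip (g n) (g n)) / 4"
      unfolding q_def
      by (simp only: ip_scale ip_scale_right ip_add ip_add_right gH add_in scale_in ip_commute[OF gH[of n] gH[of m]]) (simp add: field_simps)
    ultimately show ?thesis
      using valn[of m] valn[of n] unfolding ip_diff_diff[OF gH gH] by argo
  qed
  have tends: "(\<lambda>n. 1 / real (Suc n)) \<longlonglongrightarrow> 0" by (rule LIMSEQ_Suc[OF lim_1_over_n])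
  have "\<forall>e>0. \<exists>n0. \<forall>m\<ge>n0. \<forall>n\<ge>n0. sqrt (ip (\<lambda>x\<in>S. g m x - g n x) (\<lambda>x\<in>S. g m x - g n x)) < e"
  proof (intro allI impI)
    fix e :: real assume e: "0 < e"
    then obtain n0 where n0: "\<And>n. n \<ge> n0 \<Longrightarrow> 1 / real (Suc n) < e\<^sup>2 / 8"
      using order_tendstoD(2)[OF tends, of "e\<^sup>2 / 8"] by (auto simp: eventually_sequentially)
    show "\<exists>n0. \<forall>m\<ge>n0. \<forall>n\<ge>n0. sqrt (ip (\<lambda>x\<in>S. g m x - g n x) (\<lambda>x\<in>S. g m x - g n x)) < e"
    proof (intro exI[of _ n0] allI impI)
      fix m n assume "n0 \<le> m" "n0 \<le> n"
      then have "ip (\<lambda>x\<in>S. g m x - g n x) (\<lambda>x\<in>S. g m x - g n x) < e\<^sup>2"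
        using cauchy[of m n] n0[of m] n0[of n] by simp
      from real_sqrt_less_mono[OF this]
      show "sqrt (ip (\<lambda>x\<in>S. g m x - g n x) (\<lambda>x\<in>S. g m x - g n x)) < e"
        using e by simp
    qed
  qed
  from complete[OF _ this] gH obtain f where fH: "f \<in> H"
    and lim: "(\<lambda>n. sqrt (ip (\<lambda>x\<in>S. g n x - f x) (\<lambda>x\<in>S. g n x - f x))) \<longlonglongrightarrow> 0" by auto
  have lim2: "(\<lambda>n. ip (\<lambda>x\<in>S. g n x - f x) (\<lambda>x\<in>S. g n x - f x)) \<longlonglongrightarrow> 0"
    using tendsto_power[OF lim, of 2] by (simp add: ip_nonneg diff_in gH fH)
  have pointwise: "(\<lambda>n. g n x) \<longlonglongrightarrow> f x" if x: "x \<in> S" for x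
  proof -
    have "(\<lambda>n. (g n x - f x)\<^sup>2) \<longlonglongrightarrow> 0"
    proof (rule tendsto_sandwich[where f="\<lambda>_. 0"])
      show "(\<lambda>n. k x x * ip (\<lambda>x\<in>S. g n x - f x) (\<lambda>x\<in>S. g n x - f x)) \<longlonglongrightarrow> 0"
        by (rule tendsto_mult_right_zero[OF lim2])
      show "\<forall>\<^sub>F n in sequentially. (g n x - f x)\<^sup>2 \<le> k x x * ip (\<lambda>x\<in>S. g n x - f x) (\<lambda>x\<in>S. g n x - f x)"
        using evaluation_bound[OF diff_in[OF gH fH] x] x by simp
    qed simp_all
    from tendsto_real_sqrt[OF this] have "(\<lambda>n. \<bar>g n x - f x\<bar>) \<longlonglongrightarrow> 0" by simp
    then show ?thesis by (simp add: tendsto_rabs_zero_iff LIM_zero_iff)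
  qed
  have hf: "h x = f x" if x: "x \<in> S" for x
  proof -
    have "y * (h x - f x) - y\<^sup>2 * k x x / 2 \<le> 0 / 2" for y
    proof -
      have "y * (h x - g n x) - y\<^sup>2 * k x x / 2 \<le> 1 / Suc n" for n
      proof -
        have "((\<lambda>z\<in>S. g n z + (\<lambda>z\<in>S. y * (\<lambda>z\<in>S. k z x) z) z), l n + y * h x) \<in> span_pairs h"
          by (intro span_pairs_add span_pairs_scale span_pairs_kernel gl x)
        note le = val_le[OF this, unfolded val_def fst_conv snd_conv]
        have "ip (\<lambda>z\<in>S. g n z + (\<lambda>z\<in>S. y * (\<lambda>z\<in>S. k z x) z) z) (\<lambda>z\<in>S. g n z + (\<lambda>z\<in>S. y * (\<lambda>z\<in>S. k z x) z) z)
            = ip (g n) (g n) + 2 * y * ip (g n) (\<lambda>z\<in>S. k z x) + y * y * ip (\<lambda>z\<in>S. k z x) (\<lambda>z\<in>S. k z x)"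
          by (simp only: ip_scale ip_scale_right ip_add ip_add_right gH add_in scale_in kernel_in x
              ip_commute[OF kernel_in[OF x] gH[of n]]) (simp only: distrib_left distrib_right mult_ac add_ac mult_2)
        note le = le[unfolded this]
        have "l n + y * h x - (ip (g n) (g n) + 2 * y * ip (g n) (\<lambda>z\<in>S. k z x) + y * y * ip (\<lambda>z\<in>S. k z x) (\<lambda>z\<in>S. k z x)) / 2 \<le> s"
          by (rule le)
        then show ?thesis
          using valn[of n] x
          by (simp add: reproducing[OF gH x] reproducing[OF kernel_in[OF x] x] power2_eq_square algebra_simps add_divide_distrib)
      qed
      then have "\<exists>N. \<forall>n\<ge>N. y * (h x - g n x) - y\<^sup>2 * k x x / 2 \<le> 1 / Suc n" by auto
      moreover have "(\<lambda>n. y * (h x - g n x) - y\<^sup>2 * k x x / 2) \<longlonglongrightarrow> y * (h x - f x) - y\<^sup>2 * k x x / 2"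
        by (intro tendsto_intros pointwise x) auto
      ultimately show ?thesis
        using LIMSEQ_le[OF _ tends] unfolding div_0 by (simp only:)
    qed
    from quadratic_bound_imp_square_le[OF this kernel_nonneg[OF x]] show ?thesis by simp
  qed
  then have hf: "h = f"
    using h subset_extensional fH by (intro extensionalityI[of h S f]) auto
  then show hH: "h \<in> H" using fH by simp
  have ip_hg: "ip h (g n) = l n" for n
    using gl[of n] hH by (auto simp: span_pairs_def ip_comb)
  have sym_diff: "ip (\<lambda>x\<in>S. g n x - h x) (\<lambda>x\<in>S. g n x - h x) = ip (\<lambda>x\<in>S. h x - g n x) (\<lambda>x\<in>S. h x - g n x)" for n
    by (simp add: ip_diff_diff gH hH ip_commute[of "g n" h])
  have "ip h h / 2 - ip (\<lambda>x\<in>S. g n x - h x) (\<lambda>x\<in>S. g n x - h x) / 2 \<le> A" for n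
    using valA[OF gl[of n]] ip_hg[of n] by (simp add: sym_diff ip_diff_diff gH hH val_def field_simps)
  moreover have "(\<lambda>n. ip h h / 2 - ip (\<lambda>x\<in>S. g n x - h x) (\<lambda>x\<in>S. g n x - h x) / 2) \<longlonglongrightarrow> ip h h / 2 - 0 / 2"
    using lim2 unfolding hf by (intro tendsto_intros) auto
  ultimately show "ip h h / 2 \<le> A" by (intro LIMSEQ_le_const2[of _ "ip h h / 2" A]) auto
  fix e :: real assume "0 < e"
  then obtain n where n: "ip (\<lambda>x\<in>S. h x - g n x) (\<lambda>x\<in>S. h x - g n x) < e"
    using order_tendstoD(2)[OF lim2, of e] unfolding hf[symmetric] sym_diff by (auto simp: eventually_sequentially)
  show "\<exists>J c. finite J \<and> J \<subseteq> S \<and> ip (\<lambda>x\<in>S. h x - comb J c x) (\<lambda>x\<in>S. h x - comb J c x) < e"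
  proof -
    from gl[of n] obtain J c where "finite J" "J \<subseteq> S" "g n = comb J c" by (auto simp: span_pairs_def)
    with n show ?thesis by (intro exI[of _ J] exI[of _ c]) simp
  qed
qed

text \<open>
  An element of \<open>H\<close> has a bounded Legendre transform, and its maximizing sequence converges to it.
\<close>

lemma comb_dense:
  assumes "h \<in> H" "0 < e"
  shows "\<exists>J c. finite J \<and> J \<subseteq> S \<and> ip (\<lambda>x\<in>S. h x - comb J c x) (\<lambda>x\<in>S. h x - comb J c x) < e"
proof (rule bounded_legendre_transform(3)[where A="ip h h / 2"])
  show "h \<in> extensional S" by (rule subsetD[OF subset_extensional assms(1)])
  show "\<And>J c. \<lbrakk>finite J; J \<subseteq> S\<rbrakk> \<Longrightarrow> (\<Sum>t\<in>J. c t * h t) - kernel_form k J c c / 2 \<le> ip h h / 2"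
    by (rule linear_minus_form_le[OF assms(1)])
qed (rule assms(2))

end

section \<open>The rate function of a kernel with Hoelder increments\<close>

text \<open>
  The quadratic estimate of the mixed term in \<open>g = h - (h - g)\<close>: for large \<open>x\<close> and then small distance of \<open>g\<close>
  to \<open>h\<close>, the squared norm of \<open>g\<close> exceeds that of \<open>h\<close> by as little as desired.
\<close>

lemma (in rkhs) norm_perturbation:
  assumes h: "h \<in> H" and g: "g \<in> H" and x: "0 < x"
  shows "ip g g \<le> ip h h + ip h h / x + (x + 1) * ip (\<lambda>u\<in>S. h u - g u) (\<lambda>u\<in>S. h u - g u)"
proof -
  define d where "d = (\<lambda>u\<in>S. h u - g u)"
  have d: "d \<in> H" unfolding d_def by (intro diff_in h g)
  have dd: "ip d d = ip h h - 2 * ip h g + ip g g" unfolding d_def by (rule ip_diff_diff[OF h g])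
  have hd: "ip h d = ip h h - ip h g" unfolding d_def by (rule ip_diff_right[OF h g h])
  have "0 \<le> ip (\<lambda>u\<in>S. h u + (\<lambda>u\<in>S. x * d u) u) (\<lambda>u\<in>S. h u + (\<lambda>u\<in>S. x * d u) u)"
    by (intro ip_nonneg add_in scale_in h d)
  also have "\<dots> = ip h h + 2 * x * ip h d + x * x * ip d d"
    by (simp only: ip_add ip_add_right ip_scale ip_scale_right h d add_in scale_in ip_commute[OF d h]) (simp add: algebra_simps)
  finally have "0 \<le> (ip h h + 2 * x * ip h d + x * x * ip d d) / x" using x by simp
  also have "\<dots> = ip h h / x + 2 * ip h d + x * ip d d"
    using x by (simp add: add_divide_distrib)
  finally show ?thesis unfolding d_def[symmetric] using dd hd by (simp add: distrib_right)
qed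

text \<open>
  The kernel of a process that starts at 0 and has Hoelder continuous increments in mean square.
\<close>

locale holder_rkhs = rkhs "{0..1}" Rlim H ip for Rlim :: "real \<Rightarrow> real \<Rightarrow> real" and H ip +
  fixes C \<tau> :: real
  assumes C_pos: "0 < C" and \<tau>_pos: "0 < \<tau>"
    and Rlim_increments: "s \<in> {0..1} \<Longrightarrow> t \<in> {0..1} \<Longrightarrow>
      Rlim t t - 2 * Rlim t s + Rlim s s \<le> C * \<bar>t - s\<bar> powr (2 * \<tau>)"
    and Rlim_0_0: "Rlim 0 0 = 0"
begin

lemma H_at_0: "h \<in> H \<Longrightarrow> h 0 = 0"
  using evaluation_bound[of h 0] by (simp add: Rlim_0_0)

lemma Rlim_diag_le: "t \<in> {0..1} \<Longrightarrow> Rlim t t \<le> C"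
proof -
  assume t: "t \<in> {0..1}"
  have "(\<lambda>x\<in>{0..1}. Rlim x t) 0 = 0" by (intro H_at_0 kernel_in t)
  then have "Rlim t 0 = 0" using kernel_sym[of 0 t] t by simp
  with Rlim_increments[of 0 t] t have "Rlim t t \<le> C * \<bar>t\<bar> powr (2 * \<tau>)" by (simp add: Rlim_0_0)
  also have "\<dots> \<le> C * 1" using C_pos \<tau>_pos t by (intro mult_left_mono powr_le1) auto
  finally show ?thesis by simp
qed

lemma H_modulus:
  assumes h: "h \<in> H" and st: "s \<in> {0..1}" "t \<in> {0..1}"
  shows "(h t - h s)\<^sup>2 \<le> C * ip h h * \<bar>t - s\<bar> powr (2 * \<tau>)"
proof -
  have "(h t - h s)\<^sup>2 \<le> (Rlim t t - 2 * Rlim t s + Rlim s s) * ip h h" by (rule increment_bound[OF h st])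
  also have "\<dots> \<le> C * \<bar>t - s\<bar> powr (2 * \<tau>) * ip h h"
    by (intro mult_right_mono Rlim_increments st ip_nonneg h)
  finally show ?thesis by (simp add: mult_ac)
qed

lemma H_subset_C_space: "h \<in> H \<Longrightarrow> h \<in> C_space 1"
proof -
  assume h: "h \<in> H"
  have "(h \<longlongrightarrow> h s) (at s within {0..1})" if s: "s \<in> {0..1}" for s
  proof -
    have "((\<lambda>t. (h t - h s)\<^sup>2) \<longlongrightarrow> 0) (at s within {0..1})"
    proof (rule tendsto_sandwich[where f="\<lambda>_. 0" and h="\<lambda>t. C * ip h h * \<bar>t - s\<bar> powr (2 * \<tau>)"])
      have "((\<lambda>t. \<bar>t - s\<bar>) \<longlongrightarrow> \<bar>s - s\<bar>) (at s within {0..1})" by (intro tendsto_intros)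
      then have "((\<lambda>t. \<bar>t - s\<bar> powr (2 * \<tau>)) \<longlongrightarrow> 0) (at s within {0..1})"
        using \<tau>_pos by (intro tendsto_zero_powrI[where b="2 * \<tau>"]) auto
      then show "((\<lambda>t. C * ip h h * \<bar>t - s\<bar> powr (2 * \<tau>)) \<longlongrightarrow> 0) (at s within {0..1})"
        by (rule tendsto_mult_right_zero)
      show "\<forall>\<^sub>F t in at s within {0..1}. (h t - h s)\<^sup>2 \<le> C * ip h h * \<bar>t - s\<bar> powr (2 * \<tau>)"
        unfolding eventually_at_filter using H_modulus[OF h s] by (intro always_eventually) auto
    qed simp_all
    from tendsto_real_sqrt[OF this] have "((\<lambda>t. \<bar>h t - h s\<bar>) \<longlongrightarrow> 0) (at s within {0..1})" by simp
    then show ?thesis by (simp add: tendsto_rabs_zero_iff LIM_zero_iff)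
  qed
  then show ?thesis using h subset_extensional by (auto simp: C_space_def continuous_on_def)
qed

lemma rate_in_H: "h \<in> H \<Longrightarrow> rkhs_rate H ip h = ereal (ip h h / 2)"
  by (simp add: rkhs_rate_def rkhs_norm_def ip_nonneg)

text \<open>
  The rate is the Legendre transform of half the variance of finite combinations of point
  evaluations. A supremum of continuous functions, it is lower semicontinuous.
\<close>

lemma less_rate_iff:
  assumes "h \<in> C_space 1"
  shows "ereal a < rkhs_rate H ip h \<longleftrightarrow>
    (\<exists>J c. finite J \<and> J \<subseteq> {0..1} \<and> a < (\<Sum>t\<in>J. c t * h t) - kernel_form Rlim J c c / 2)"
proof
  assume less: "ereal a < rkhs_rate H ip h"
  show "\<exists>J c. finite J \<and> J \<subseteq> {0..1} \<and> a < (\<Sum>t\<in>J. c t * h t) - kernel_form Rlim J c c / 2"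
  proof (rule ccontr)
    assume neg: "\<not> ?thesis"
    have b: "(\<Sum>t\<in>J. c t * h t) - kernel_form Rlim J c c / 2 \<le> a" if "finite J" "J \<subseteq> {0..1}" for J c
    proof (rule ccontr)
      assume "\<not> ?thesis"
      then have "a < (\<Sum>t\<in>J. c t * h t) - kernel_form Rlim J c c / 2" by simp
      with that neg show False by blast
    qed
    have ext: "h \<in> extensional {0..1}" using assms by (simp add: C_space_def)
    have "h \<in> H" by (rule bounded_legendre_transform(1)[OF ext b])
    moreover have "ip h h / 2 \<le> a" by (rule bounded_legendre_transform(2)[OF ext b])
    ultimately show False using less by (simp add: rate_in_H)
  qed
next
  assume "\<exists>J c. finite J \<and> J \<subseteq> {0..1} \<and> a < (\<Sum>t\<in>J. c t * h t) - kernel_form Rlim J c c / 2"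
  then obtain J c where J: "finite J" "J \<subseteq> {0..1}" and a: "a < (\<Sum>t\<in>J. c t * h t) - kernel_form Rlim J c c / 2"
    by blast
  show "ereal a < rkhs_rate H ip h"
  proof (cases "h \<in> H")
    case True
    from less_le_trans[OF a linear_minus_form_le[OF True J]] show ?thesis by (simp add: rate_in_H[OF True])
  qed (simp add: rkhs_rate_def)
qed

lemma rate_nonneg: "0 \<le> rkhs_rate H ip h"
  by (simp add: rkhs_rate_def)

lemma rate_function_rkhs: "rate_function (rkhs_rate H ip)"
  unfolding rate_function_def
proof (intro conjI ballI allI)
  fix a :: ereal
  show "openin (C_topology 1) {h \<in> C_space 1. a < rkhs_rate H ip h}"
  proof (cases a)
    case (real r)
    have iff: "r < s - q \<longleftrightarrow> s \<in> {r + q <..}" for s q :: real by auto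
    have top: "topspace (C_topology 1) = C_space 1" by (simp add: topspace_C_topology)
    have "{h \<in> C_space 1. a < rkhs_rate H ip h} = {h \<in> C_space 1. \<exists>J c. finite J \<and> J \<subseteq> {0..1} \<and>
        (\<Sum>t\<in>J. c t * h t) \<in> {r + kernel_form Rlim J c c / 2 <..}}"
      unfolding real by (intro Collect_cong conj_cong refl) (simp only: less_rate_iff iff)
    also have "\<dots> = \<Union>{{h \<in> topspace (C_topology 1). (\<Sum>t\<in>J. c t * h t) \<in> {r + kernel_form Rlim J c c / 2 <..}} | J c.
        finite J \<and> J \<subseteq> {0..1}}"
      unfolding top by blast
    also have "openin (C_topology 1) \<dots>"
    proof (intro openin_Union, clarify)
      fix J :: "real set" and c :: "real \<Rightarrow> real" assume "finite J" "J \<subseteq> {0..1}"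
      from continuous_map_evaluation_sum[OF this] show "openin (C_topology 1) {h \<in> topspace (C_topology 1). (\<Sum>t\<in>J. c t * h t) \<in> {r + kernel_form Rlim J c c / 2 <..}}"
        by (rule openin_continuous_map_preimage) simp
    qed
    finally show ?thesis .
  next
    case MInf
    have "a < rkhs_rate H ip h" for h using rate_nonneg[of h] MInf less_le_trans[of a 0] by simp
    then show ?thesis using openin_topspace[of "C_topology 1"] by (simp add: topspace_C_topology)
  qed simp
qed (rule rate_nonneg)

text \<open>
  Elements of \<open>H\<close> inherit the Hoelder modulus of the kernel, so every level set is a closed subset of a
  compact chaining set.
\<close>

lemma good_rate_function_rkhs: "good_rate_function (rkhs_rate H ip)"
  unfolding good_rate_function_def
proof (intro conjI allI impI rate_function_rkhs)
  fix a :: real assume a: "0 \<le> a"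
  define L where "L = sqrt (2 * a * C)"
  note \<rho> = chaining_ratio_bounds[OF \<tau>_pos]
  have L: "0 \<le> L" using a C_pos by (simp add: L_def)
  have "{h \<in> C_space 1. rkhs_rate H ip h \<le> ereal a} \<subseteq> chaining_set L (chaining_ratio \<tau>)"
  proof
    fix h assume "h \<in> {h \<in> C_space 1. rkhs_rate H ip h \<le> ereal a}"
    then have hC: "h \<in> C_space 1" and le: "rkhs_rate H ip h \<le> ereal a" by auto
    have h: "h \<in> H" using le by (auto simp: rkhs_rate_def split: if_splits)
    have ih: "ip h h \<le> 2 * a" using le by (simp add: rate_in_H[OF h])
    have "\<bar>h (real (Suc k) / 2^n) - h (real k / 2^n)\<bar> \<le> L * chaining_ratio \<tau>^n" if k: "k < 2^n" for k n :: nat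
    proof (rule power2_le_imp_le)
      have grid: "real k / 2^n \<in> {0..1}" "real (Suc k) / 2^n \<in> {0..1}"
        using k by (intro dyadic_in_unit_interval; simp)+
      have d: "\<bar>real (Suc k) / 2^n - real k / 2^n\<bar> = 1 / 2^n" by (simp flip: diff_divide_distrib)
      have "(h (real (Suc k) / 2^n) - h (real k / 2^n))\<^sup>2 \<le> C * ip h h * (chaining_ratio \<tau>^n)^4"
        using H_modulus[OF h grid] unfolding d chaining_ratio_power .
      also have "\<dots> \<le> C * (2 * a) * (chaining_ratio \<tau>^n)\<^sup>2"
      proof (intro mult_mono)
        show "(chaining_ratio \<tau>^n)^4 \<le> (chaining_ratio \<tau>^n)\<^sup>2" using \<rho> by (intro power_decreasing) (auto simp: power_le_one)
      qed (use ih C_pos a ip_nonneg[OF h] \<rho> in auto)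
      also have "\<dots> = (L * chaining_ratio \<tau>^n)\<^sup>2" using a C_pos by (simp add: L_def power_mult_distrib)
      finally show "\<bar>h (real (Suc k) / 2^n) - h (real k / 2^n)\<bar>\<^sup>2 \<le> (L * chaining_ratio \<tau>^n)\<^sup>2" by simp
    qed (use L \<rho> in auto)
    then show "h \<in> chaining_set L (chaining_ratio \<tau>)" using hC H_at_0[OF h] by (auto simp: chaining_set_def)
  qed
  moreover have "closedin (C_topology 1) {h \<in> C_space 1. rkhs_rate H ip h \<le> ereal a}"
  proof -
    have "{h \<in> C_space 1. rkhs_rate H ip h \<le> ereal a} = topspace (C_topology 1) - {h \<in> C_space 1. ereal a < rkhs_rate H ip h}"
      by (auto simp: topspace_C_topology)
    then show ?thesis using rate_function_rkhs unfolding rate_function_def by (simp add: openin_closedin_eq closedin_diff)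
  qed
  ultimately show "compactin (C_topology 1) {h \<in> C_space 1. rkhs_rate H ip h \<le> ereal a}"
    by (rule closed_compactin[OF compactin_chaining_set[OF L \<rho>]])
qed

end

section \<open>Families of small Gaussian processes\<close>

lemma kernel_form_lincomb:
  assumes "\<And>s t. s \<in> J \<Longrightarrow> t \<in> J \<Longrightarrow> k s t = k t s"
  shows "kernel_form k J (\<lambda>t. a * c t + b * d t) (\<lambda>t. a * c t + b * d t)
    = a\<^sup>2 * kernel_form k J c c + 2 * a * b * kernel_form k J d c + b\<^sup>2 * kernel_form k J d d"
proof -
  have sym: "kernel_form k J c d = kernel_form k J d c"
    unfolding kernel_form_def
    by (subst sum.swap) (auto intro!: sum.cong simp: assms)
  have "kernel_form k J (\<lambda>t. a * c t + b * d t) (\<lambda>t. a * c t + b * d t)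
    = a\<^sup>2 * kernel_form k J c c + a * b * kernel_form k J c d + a * b * kernel_form k J d c + b\<^sup>2 * kernel_form k J d d"
    unfolding kernel_form_def sum_distrib_left sum.distrib[symmetric]
    by (intro sum.cong refl) (simp add: power2_eq_square algebra_simps)
  then show ?thesis by (simp add: sym)
qed

lemma kernel_form_scale:
  "kernel_form k J (\<lambda>t. a * c t) (\<lambda>t. a * c t) = a\<^sup>2 * kernel_form k J c c"
  unfolding kernel_form_def sum_distrib_left
  by (intro sum.cong refl) (simp add: power2_eq_square algebra_simps)

lemma tendsto_kernel_form:
  assumes "\<And>s t. s \<in> J \<Longrightarrow> t \<in> J \<Longrightarrow> ((\<lambda>x. k x s t) \<longlongrightarrow> l s t) F"
  shows "((\<lambda>x. kernel_form (k x) J c d) \<longlongrightarrow> kernel_form l J c d) F"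
  unfolding kernel_form_def by (intro tendsto_intros assms)

text \<open>
  The number of dyadic intervals grows exponentially and the Gaussian tails decay double exponentially.
\<close>

lemma summable_double_exponential:
  fixes a q :: real
  assumes "0 < a" "1 < q"
  shows "summable (\<lambda>n. 2^n * exp (- a * q^n))"
proof -
  obtain n0 where "ln 4 / (a * (q - 1)) < q^n0"
    using real_arch_pow[OF assms(2)] by blast
  then have "ln 4 \<le> a * (q - 1) * q^n0"
    using assms by (simp add: pos_divide_less_eq mult.commute)
  also have "a * (q - 1) * q^n0 \<le> a * (q - 1) * q^n" if "n \<ge> n0" for n
    using assms that by (intro mult_left_mono power_increasing) auto
  finally have n0: "ln 4 \<le> a * (q - 1) * q^n" if "n \<ge> n0" for n
    using that .
  show ?thesis
  proof (rule summable_ratio_test[where c="1/2" and N=n0])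
    fix n assume n: "n0 \<le> n"
    have "exp (- a * q^Suc n) = exp (- a * q^n) * exp (- (a * (q - 1) * q^n))"
      by (simp add: algebra_simps flip: exp_add)
    also have "\<dots> \<le> exp (- a * q^n) * exp (- ln 4)"
      using n0[OF n] by (intro mult_left_mono) auto
    also have "exp (- ln 4) = (1/4 :: real)" by (simp add: exp_minus)
    finally have "exp (- a * q^Suc n) \<le> exp (- a * q^n) / 4" by simp
    then show "norm (2^Suc n * exp (- a * q^Suc n)) \<le> 1/2 * norm (2^n * exp (- a * q^n))"
      by (simp add: abs_mult)
  qed simp
qed

text \<open>
  Centered Gaussian processes \<open>Z \<epsilon>\<close> with covariance \<open>(\<gamma> \<epsilon>)\<^sup>2 * R \<epsilon>\<close>. The Gaussian property enters
  through the exponential moments of finite combinations only. The deterministic part \<open>m\<close> converges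
  to 0 uniformly, at an arbitrary speed.
\<close>

locale small_gaussian_family = prob_space N for N :: "'b measure" +
  fixes Z :: "real \<Rightarrow> real \<Rightarrow> 'b \<Rightarrow> real"
    and R :: "real \<Rightarrow> real \<Rightarrow> real \<Rightarrow> real"
    and Rlim :: "real \<Rightarrow> real \<Rightarrow> real"
    and \<gamma> :: "real \<Rightarrow> real" and C \<tau> :: real and m :: "real \<Rightarrow> real \<Rightarrow> real"
  assumes \<gamma>_pos: "0 < \<epsilon> \<Longrightarrow> 0 < \<gamma> \<epsilon>" and \<gamma>_lim: "(\<gamma> \<longlongrightarrow> 0) (at_right 0)"
    and meas: "0 < \<epsilon> \<Longrightarrow> t \<in> {0..1} \<Longrightarrow> Z \<epsilon> t \<in> borel_measurable N"
    and cont: "0 < \<epsilon> \<Longrightarrow> continuous_paths N {0..1} (Z \<epsilon>)"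
    and zero: "0 < \<epsilon> \<Longrightarrow> \<omega> \<in> space N \<Longrightarrow> Z \<epsilon> 0 \<omega> = 0"
    and mgf: "0 < \<epsilon> \<Longrightarrow> finite J \<Longrightarrow> J \<subseteq> {0..1} \<Longrightarrow>
      has_bochner_integral N (\<lambda>\<omega>. exp (\<Sum>t\<in>J. c t * Z \<epsilon> t \<omega>)) (exp ((\<gamma> \<epsilon>)\<^sup>2 * kernel_form (R \<epsilon>) J c c / 2))"
    and R_sym: "0 < \<epsilon> \<Longrightarrow> s \<in> {0..1} \<Longrightarrow> t \<in> {0..1} \<Longrightarrow> R \<epsilon> s t = R \<epsilon> t s"
    and R_lim: "s \<in> {0..1} \<Longrightarrow> t \<in> {0..1} \<Longrightarrow> ((\<lambda>\<epsilon>. R \<epsilon> s t) \<longlongrightarrow> Rlim s t) (at_right 0)"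
    and C_pos: "0 < C" and \<tau>_pos: "0 < \<tau>"
    and R_increments: "0 < \<epsilon> \<Longrightarrow> s \<in> {0..1} \<Longrightarrow> t \<in> {0..1} \<Longrightarrow>
      R \<epsilon> t t - 2 * R \<epsilon> t s + R \<epsilon> s s \<le> C * \<bar>t - s\<bar> powr (2 * \<tau>)"
    and m_cont: "0 < \<epsilon> \<Longrightarrow> continuous_on {0..1} (m \<epsilon>)"
    and m_lim: "uniform_limit {0..1} m (\<lambda>_. 0) (at_right 0)"
begin

definition U :: "real \<Rightarrow> real \<Rightarrow> 'b \<Rightarrow> real" where
  "U \<epsilon> t \<omega> = m \<epsilon> t + Z \<epsilon> t \<omega>"

abbreviation Z_in :: "real \<Rightarrow> (real \<Rightarrow> real) set \<Rightarrow> 'b set" where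
  "Z_in \<epsilon> A \<equiv> {\<omega> \<in> space N. path 1 (Z \<epsilon>) \<omega> \<in> A}"

abbreviation U_in :: "real \<Rightarrow> (real \<Rightarrow> real) set \<Rightarrow> 'b set" where
  "U_in \<epsilon> A \<equiv> {\<omega> \<in> space N. path 1 (U \<epsilon>) \<omega> \<in> A}"

lemma eventually_pos: "\<forall>\<^sub>F \<epsilon> in at_right (0::real). 0 < \<epsilon>"
  by (simp add: eventually_at_right_less)

lemma U_meas: "0 < \<epsilon> \<Longrightarrow> t \<in> {0..1} \<Longrightarrow> U \<epsilon> t \<in> borel_measurable N"
  unfolding U_def[abs_def] using meas[of \<epsilon> t] by measurable

lemma U_cont: "0 < \<epsilon> \<Longrightarrow> continuous_paths N {0..1} (U \<epsilon>)"
  using cont[of \<epsilon>] m_cont[of \<epsilon>] unfolding continuous_paths_def U_def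
  by (auto intro!: continuous_intros)

lemma path_Z_in: "0 < \<epsilon> \<Longrightarrow> \<omega> \<in> space N \<Longrightarrow> path 1 (Z \<epsilon>) \<omega> \<in> C_space 1"
  using cont[of \<epsilon>] by (intro path_in_C_space) (auto simp: continuous_paths_def)

lemma path_U_in: "0 < \<epsilon> \<Longrightarrow> \<omega> \<in> space N \<Longrightarrow> path 1 (U \<epsilon>) \<omega> \<in> C_space 1"
  using U_cont[of \<epsilon>] by (intro path_in_C_space) (auto simp: continuous_paths_def)

lemmas Z_open = path_open_event[OF meas cont] and Z_closed = path_closed_event[OF meas cont]
  and U_open = path_open_event[OF U_meas U_cont] and U_closed = path_closed_event[OF U_meas U_cont]

lemma lincomb_measurable:
  "0 < \<epsilon> \<Longrightarrow> J \<subseteq> {0..1} \<Longrightarrow> (\<lambda>\<omega>. \<Sum>t\<in>J. c t * Z \<epsilon> t \<omega>) \<in> borel_measurable N"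
  by (intro borel_measurable_sum borel_measurable_times borel_measurable_const meas) auto

text \<open>
  The exponential Markov inequality; the scale of the exponent is contained in \<open>c\<close>.
\<close>

lemma chernoff:
  assumes \<epsilon>: "0 < \<epsilon>" and J: "finite J" "J \<subseteq> {0..1}"
  shows "prob {\<omega> \<in> space N. x \<le> (\<Sum>t\<in>J. c t * Z \<epsilon> t \<omega>)} \<le> exp ((\<gamma> \<epsilon>)\<^sup>2 * kernel_form (R \<epsilon>) J c c / 2 - x)"
proof -
  note [measurable] = lincomb_measurable[OF \<epsilon> J(2)]
  note i = mgf[OF \<epsilon> J, of c]
  have "prob {\<omega> \<in> space N. x \<le> (\<Sum>t\<in>J. c t * Z \<epsilon> t \<omega>)} = prob {\<omega> \<in> space N. exp x \<le> exp (\<Sum>t\<in>J. c t * Z \<epsilon> t \<omega>)}"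
    by simp
  also have "\<dots> \<le> (\<integral>\<omega>. exp (\<Sum>t\<in>J. c t * Z \<epsilon> t \<omega>) \<partial>N) / exp x"
    using i by (intro integral_Markov_inequality_measure[where A="{}"]) (auto simp: has_bochner_integral_iff)
  also have "\<dots> = exp ((\<gamma> \<epsilon>)\<^sup>2 * kernel_form (R \<epsilon>) J c c / 2 - x)"
    using i by (simp add: has_bochner_integral_iff exp_diff)
  finally show ?thesis .
qed

text \<open>
  The same inequality for the coefficients \<open>c / (\<gamma> \<epsilon>)\<^sup>2\<close>, which are the right ones at speed \<open>(\<gamma> \<epsilon>)\<^sup>2\<close>.
\<close>

lemma chernoff_speed:
  assumes \<epsilon>: "0 < \<epsilon>" and J: "finite J" "J \<subseteq> {0..1}"
  shows "prob {\<omega> \<in> space N. x \<le> (\<Sum>t\<in>J. c t * Z \<epsilon> t \<omega>)}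
    \<le> exp (- (x - kernel_form (R \<epsilon>) J c c / 2) / (\<gamma> \<epsilon>)\<^sup>2)"
proof -
  define g where "g = (\<gamma> \<epsilon>)\<^sup>2"
  have g: "0 < g" using \<gamma>_pos[OF \<epsilon>] by (simp add: g_def)
  have "prob {\<omega> \<in> space N. x \<le> (\<Sum>t\<in>J. c t * Z \<epsilon> t \<omega>)} = prob {\<omega> \<in> space N. x / g \<le> (\<Sum>t\<in>J. (1 / g * c t) * Z \<epsilon> t \<omega>)}"
    unfolding mult.assoc sum_distrib_left[symmetric] using g by (simp add: divide_le_cancel)
  also have "\<dots> \<le> exp (g * kernel_form (R \<epsilon>) J (\<lambda>t. 1 / g * c t) (\<lambda>t. 1 / g * c t) / 2 - x / g)"
    unfolding g_def by (rule chernoff[OF \<epsilon> J])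
  also have "\<dots> = exp (- (x - kernel_form (R \<epsilon>) J c c / 2) / g)"
    unfolding kernel_form_scale using g by (simp add: power2_eq_square field_simps)
  finally show ?thesis unfolding g_def .
qed

lemma increment_tail:
  assumes \<epsilon>: "0 < \<epsilon>" and st: "s \<in> {0..1}" "t \<in> {0..1}" "s \<noteq> t" and x: "0 < x"
    and v: "R \<epsilon> t t - 2 * R \<epsilon> t s + R \<epsilon> s s \<le> v" "0 < v"
  shows "prob {\<omega> \<in> space N. x \<le> \<bar>Z \<epsilon> t \<omega> - Z \<epsilon> s \<omega>\<bar>} \<le> 2 * exp (- (x\<^sup>2 / (2 * (\<gamma> \<epsilon>)\<^sup>2 * v)))"
proof -
  note [measurable] = meas[OF \<epsilon> st(1)] meas[OF \<epsilon> st(2)]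
  define g where "g = (\<gamma> \<epsilon>)\<^sup>2"
  have g: "0 < g" using \<gamma>_pos[OF \<epsilon>] by (simp add: g_def)
  have one: "prob {\<omega> \<in> space N. x \<le> Z \<epsilon> t \<omega> - Z \<epsilon> s \<omega>} \<le> exp (- (x\<^sup>2 / (2 * g * v)))"
    if st: "s \<in> {0..1}" "t \<in> {0..1}" "s \<noteq> t" and v: "R \<epsilon> t t - 2 * R \<epsilon> t s + R \<epsilon> s s \<le> v" "0 < v" for s t
  proof -
    \<comment> \<open>this multiplier minimizes the exponent of the exponential Markov inequality\<close>
    define \<theta> where "\<theta> = x / (g * v)"
    have \<theta>: "0 < \<theta>" using x g v by (simp add: \<theta>_def)
    define c where "c u = (if u = t then \<theta> else - \<theta>)" for u
    have Q: "kernel_form (R \<epsilon>) {s, t} c c = \<theta>\<^sup>2 * (R \<epsilon> t t - 2 * R \<epsilon> t s + R \<epsilon> s s)"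
      using st(3) R_sym[OF \<epsilon> st(1,2)] by (simp add: kernel_form_def c_def power2_eq_square algebra_simps)
    have "prob {\<omega> \<in> space N. x \<le> Z \<epsilon> t \<omega> - Z \<epsilon> s \<omega>}
        = prob {\<omega> \<in> space N. \<theta> * x \<le> (\<Sum>u\<in>{s, t}. c u * Z \<epsilon> u \<omega>)}"
    proof -
      have "(\<Sum>u\<in>{s, t}. c u * Z \<epsilon> u \<omega>) = \<theta> * (Z \<epsilon> t \<omega> - Z \<epsilon> s \<omega>)" for \<omega>
        using st(3) by (simp add: c_def algebra_simps)
      then show ?thesis using \<theta> by simp
    qed
    also have "\<dots> \<le> exp (g * kernel_form (R \<epsilon>) {s, t} c c / 2 - \<theta> * x)"
      unfolding g_def by (rule chernoff[OF \<epsilon>]) (use st in auto)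
    also have "\<dots> \<le> exp (g * (\<theta>\<^sup>2 * v) / 2 - \<theta> * x)"
      unfolding Q exp_le_cancel_iff using v g by (intro diff_right_mono divide_right_mono mult_left_mono) auto
    also have "g * (\<theta>\<^sup>2 * v) / 2 - \<theta> * x = - (x\<^sup>2 / (2 * g * v))"
      using g v by (simp add: \<theta>_def power2_eq_square field_simps)
    finally show ?thesis .
  qed
  have "prob {\<omega> \<in> space N. x \<le> \<bar>Z \<epsilon> t \<omega> - Z \<epsilon> s \<omega>\<bar>}
      \<le> prob ({\<omega> \<in> space N. x \<le> Z \<epsilon> t \<omega> - Z \<epsilon> s \<omega>} \<union> {\<omega> \<in> space N. x \<le> Z \<epsilon> s \<omega> - Z \<epsilon> t \<omega>})"
    by (intro finite_measure_mono) auto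
  also have "\<dots> \<le> prob {\<omega> \<in> space N. x \<le> Z \<epsilon> t \<omega> - Z \<epsilon> s \<omega>} + prob {\<omega> \<in> space N. x \<le> Z \<epsilon> s \<omega> - Z \<epsilon> t \<omega>}"
    by (intro measure_Un_le) auto
  also have "\<dots> \<le> exp (- (x\<^sup>2 / (2 * g * v))) + exp (- (x\<^sup>2 / (2 * g * v)))"
    using st v R_sym[OF \<epsilon> st(1,2)] by (intro add_mono one) auto
  finally show ?thesis by (simp add: g_def)
qed

abbreviation \<rho> :: real where "\<rho> \<equiv> chaining_ratio \<tau>"

lemmas \<rho> = chaining_ratio_bounds[OF \<tau>_pos]

definition chaining_constant :: real where
  "chaining_constant = (\<Sum>n. 2 * (2^n * exp (- (1 / (4 * C)) * (1 / \<rho>\<^sup>2)^n)))"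

lemma chaining_summable: "summable (\<lambda>n. 2 * (2^n * exp (- (1 / (4 * C)) * (1 / \<rho>\<^sup>2)^n)))"
  using C_pos \<rho> by (intro summable_mult summable_double_exponential) (auto simp: power_less_one_iff)

text \<open>
  Outside the chaining set some dyadic increment of level \<open>n\<close> exceeds \<open>L * \<rho>^n\<close>, while its variance is at
  most \<open>(\<gamma> \<epsilon>)\<^sup>2 * C * \<rho>^(4 * n)\<close>. The exponent \<open>x * y / (2 * C)\<close>, where \<open>x = (L / \<gamma> \<epsilon>)\<^sup>2\<close> and \<open>y = (1 / \<rho>\<^sup>2)^n\<close>
  are at least 1, is bounded from below by \<open>(x + y) / (4 * C)\<close>: the first part gives the asserted decay and
  the second part a series that sums to a constant.
\<close>

lemma exponential_tightness:
  assumes \<epsilon>: "0 < \<epsilon>" and L: "\<gamma> \<epsilon> \<le> L"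
  shows "prob (space N - Z_in \<epsilon> (chaining_set L \<rho>))
    \<le> chaining_constant * exp (- (L\<^sup>2 / (4 * C)) / (\<gamma> \<epsilon>)\<^sup>2)"
proof -
  define g where "g = (\<gamma> \<epsilon>)\<^sup>2"
  have g: "0 < g" using \<gamma>_pos[OF \<epsilon>] by (simp add: g_def)
  have Lpos: "0 < L" using \<gamma>_pos[OF \<epsilon>] L by simp
  have Lg: "1 \<le> L\<^sup>2 / g" using L \<gamma>_pos[OF \<epsilon>] g by (simp add: g_def power_mono)
  have grid: "real k / 2^n \<in> {0..1}" "real (Suc k) / 2^n \<in> {0..1}" if "k < 2^n" for k n :: nat
    using that by (intro dyadic_in_unit_interval; simp)+
  define B where "B n k = {\<omega> \<in> space N. L * \<rho>^n \<le> \<bar>Z \<epsilon> (real (Suc k) / 2^n) \<omega> - Z \<epsilon> (real k / 2^n) \<omega>\<bar>}" for n k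
  have B_sets: "B n k \<in> sets N" if "k < 2^n" for n k
    unfolding B_def using meas[OF \<epsilon> grid(1)[OF that]] meas[OF \<epsilon> grid(2)[OF that]] by measurable
  have B_prob: "prob (B n k) \<le> 2 * exp (- (L\<^sup>2 / (4 * C)) / g) * exp (- (1 / (4 * C)) * (1 / \<rho>\<^sup>2)^n)" if k: "k < 2^n" for n k
  proof -
    have "prob (B n k) \<le> 2 * exp (- ((L * \<rho>^n)\<^sup>2 / (2 * (\<gamma> \<epsilon>)\<^sup>2 * (C * (\<rho>^n)^4))))"
      unfolding B_def
    proof (rule increment_tail[OF \<epsilon> grid[OF k]])
      have "\<bar>real (Suc k) / 2^n - real k / 2^n\<bar> = 1 / 2^n"
        by (simp flip: diff_divide_distrib)
      then show "R \<epsilon> (real (Suc k) / 2^n) (real (Suc k) / 2^n) - 2 * R \<epsilon> (real (Suc k) / 2^n) (real k / 2^n) + R \<epsilon> (real k / 2^n) (real k / 2^n)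
        \<le> C * (\<rho>^n)^4"
        using R_increments[OF \<epsilon> grid[OF k]] by (simp only: chaining_ratio_power)
    qed (use Lpos \<rho> C_pos in auto)
    also have "(L * \<rho>^n)\<^sup>2 / (2 * (\<gamma> \<epsilon>)\<^sup>2 * (C * (\<rho>^n)^4)) = (L\<^sup>2 / g) * (1 / \<rho>\<^sup>2)^n / (2 * C)"
      using \<rho> C_pos g unfolding g_def
      by (simp add: power_mult_distrib field_simps flip: power_mult power_add)
    also have "- ((L\<^sup>2 / g) * (1 / \<rho>\<^sup>2)^n / (2 * C)) \<le> - (L\<^sup>2 / (4 * C)) / g + - (1 / (4 * C)) * (1 / \<rho>\<^sup>2)^n"
    proof -
      define u w where "u = L\<^sup>2 / g" and "w = (1 / \<rho>\<^sup>2)^n"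
      have "1 \<le> w" unfolding w_def using \<rho> by (intro one_le_power) (auto simp: power_le_one)
      moreover have "1 \<le> u" using Lg by (simp add: u_def)
      ultimately have "u * 1 \<le> u * w" "1 * w \<le> u * w"
        by (auto intro!: mult_left_mono mult_right_mono)
      then have "u + w \<le> 2 * (u * w)" by linarith
      then have "(u + w) / (4 * C) \<le> 2 * (u * w) / (4 * C)" using C_pos by (intro divide_right_mono) auto
      moreover have "- (L\<^sup>2 / (4 * C)) / g = - (u / (4 * C))" by (simp add: u_def mult.commute)
      ultimately show ?thesis by (simp add: u_def[symmetric] w_def[symmetric] add_divide_distrib)
    qed
    finally show ?thesis by (simp only: exp_add mult.assoc) simp
  qed
  define A where "A n = (\<Union>k\<in>{..<2^n}. B n k)" for n :: nat
  have A_sets: "A n \<in> sets N" for n unfolding A_def using B_sets by auto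
  have A_prob: "prob (A n) \<le> exp (- (L\<^sup>2 / (4 * C)) / g) * (2 * (2^n * exp (- (1 / (4 * C)) * (1 / \<rho>\<^sup>2)^n)))" for n
  proof -
    have "prob (A n) \<le> (\<Sum>k<2^n. prob (B n k))"
      unfolding A_def by (intro finite_measure_subadditive_finite) (use B_sets in auto)
    also have "\<dots> \<le> (\<Sum>k<2^n::nat. 2 * exp (- (L\<^sup>2 / (4 * C)) / g) * exp (- (1 / (4 * C)) * (1 / \<rho>\<^sup>2)^n))"
      by (intro sum_mono B_prob) auto
    finally show ?thesis by (simp add: mult_ac)
  qed
  have summ: "summable (\<lambda>n. exp (- (L\<^sup>2 / (4 * C)) / g) * (2 * (2^n * exp (- (1 / (4 * C)) * (1 / \<rho>\<^sup>2)^n))))"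
    by (intro summable_mult chaining_summable)
  have summA: "summable (\<lambda>n. prob (A n))"
    by (rule summable_comparison_test'[OF summ]) (use A_prob in auto)
  have "(space N - Z_in \<epsilon> (chaining_set L \<rho>)) \<subseteq> (\<Union>n. A n)"
  proof
    fix \<omega> assume w: "\<omega> \<in> (space N - Z_in \<epsilon> (chaining_set L \<rho>))"
    have "path 1 (Z \<epsilon>) \<omega> 0 = 0" using zero[OF \<epsilon>] w by (auto simp: path_def)
    with w path_Z_in[OF \<epsilon>, of \<omega>] obtain n k where nk: "k < 2^n"
      "\<not> \<bar>path 1 (Z \<epsilon>) \<omega> (real (Suc k) / 2^n) - path 1 (Z \<epsilon>) \<omega> (real k / 2^n)\<bar> \<le> L * \<rho>^n"
      unfolding chaining_set_def by blast
    then have "\<omega> \<in> B n k" using w grid[OF nk(1)] unfolding B_def by (auto simp: path_def)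
    with nk show "\<omega> \<in> (\<Union>n. A n)" unfolding A_def by blast
  qed
  then have "prob (space N - Z_in \<epsilon> (chaining_set L \<rho>)) \<le> prob (\<Union>n. A n)"
    using A_sets by (intro finite_measure_mono) auto
  also have "\<dots> \<le> (\<Sum>n. prob (A n))"
    using A_sets summA by (intro finite_measure_subadditive_countably) auto
  also have "\<dots> \<le> (\<Sum>n. exp (- (L\<^sup>2 / (4 * C)) / g) * (2 * (2^n * exp (- (1 / (4 * C)) * (1 / \<rho>\<^sup>2)^n))))"
    by (intro suminf_le A_prob summA summ)
  also have "\<dots> = chaining_constant * exp (- (L\<^sup>2 / (4 * C)) / g)"
    unfolding chaining_constant_def by (subst suminf_mult[OF chaining_summable]) (simp add: mult.commute)
  finally show ?thesis by (simp add: g_def)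
qed

lemma large_chaining_level:
  obtains L where "0 < L" "b \<le> L\<^sup>2 / (4 * C)"
proof
  define L where "L = 1 + sqrt (4 * C * \<bar>b\<bar>)"
  show "0 < L" using C_pos by (simp add: L_def add_pos_nonneg)
  have "(sqrt (4 * C * \<bar>b\<bar>))\<^sup>2 \<le> L\<^sup>2" using C_pos by (intro power_mono) (auto simp: L_def)
  then have "4 * C * \<bar>b\<bar> \<le> L\<^sup>2" using C_pos by simp
  then have "\<bar>b\<bar> \<le> L\<^sup>2 / (4 * C)" using C_pos by (simp add: pos_le_divide_eq mult.commute)
  then show "b \<le> L\<^sup>2 / (4 * C)" by linarith
qed

end

section \<open>The large deviation upper bound\<close>

context small_gaussian_family
begin

text \<open>
  Exponential decay at rate \<open>b\<close>, up to a constant factor; the factor makes the notion stable under finite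
  sums and is lost on the logarithmic scale.
\<close>

definition exp_small :: "real \<Rightarrow> (real \<Rightarrow> real) \<Rightarrow> bool" where
  "exp_small b p \<longleftrightarrow> (\<exists>\<kappa>. \<forall>\<^sub>F \<epsilon> in at_right 0. p \<epsilon> \<le> \<kappa> * exp (- b / (\<gamma> \<epsilon>)\<^sup>2))"

lemma exp_small_add: "exp_small b p \<Longrightarrow> exp_small b q \<Longrightarrow> exp_small b (\<lambda>\<epsilon>. p \<epsilon> + q \<epsilon>)"
proof -
  assume "exp_small b p" "exp_small b q"
  then obtain \<kappa> \<kappa>' where "\<forall>\<^sub>F \<epsilon> in at_right 0. p \<epsilon> \<le> \<kappa> * exp (- b / (\<gamma> \<epsilon>)\<^sup>2)"
    "\<forall>\<^sub>F \<epsilon> in at_right 0. q \<epsilon> \<le> \<kappa>' * exp (- b / (\<gamma> \<epsilon>)\<^sup>2)"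
    unfolding exp_small_def by blast
  then have "\<forall>\<^sub>F \<epsilon> in at_right 0. p \<epsilon> + q \<epsilon> \<le> (\<kappa> + \<kappa>') * exp (- b / (\<gamma> \<epsilon>)\<^sup>2)"
    by eventually_elim (simp add: distrib_right)
  then show ?thesis unfolding exp_small_def by blast
qed

lemma exp_small_sum: "finite F \<Longrightarrow> (\<And>i. i \<in> F \<Longrightarrow> exp_small b (p i)) \<Longrightarrow> exp_small b (\<lambda>\<epsilon>. \<Sum>i\<in>F. p i \<epsilon>)"
proof (induction F rule: finite_induct)
  case empty
  show ?case unfolding exp_small_def by (intro exI[of _ 1] always_eventually) simp
qed (simp add: exp_small_add)

lemma exp_small_mono: "exp_small b q \<Longrightarrow> \<forall>\<^sub>F \<epsilon> in at_right 0. p \<epsilon> \<le> q \<epsilon> \<Longrightarrow> exp_small b p"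
proof -
  assume "exp_small b q" and le: "\<forall>\<^sub>F \<epsilon> in at_right 0. p \<epsilon> \<le> q \<epsilon>"
  then obtain \<kappa> where "\<forall>\<^sub>F \<epsilon> in at_right 0. q \<epsilon> \<le> \<kappa> * exp (- b / (\<gamma> \<epsilon>)\<^sup>2)"
    unfolding exp_small_def by blast
  with le have "\<forall>\<^sub>F \<epsilon> in at_right 0. p \<epsilon> \<le> \<kappa> * exp (- b / (\<gamma> \<epsilon>)\<^sup>2)"
    by eventually_elim (rule order_trans)
  then show ?thesis unfolding exp_small_def by blast
qed

lemma exp_small_halfspace:
  assumes J: "finite J" "J \<subseteq> {0..1}" and x: "b < x - kernel_form Rlim J c c / 2"
  shows "exp_small b (\<lambda>\<epsilon>. prob {\<omega> \<in> space N. x \<le> (\<Sum>t\<in>J. c t * Z \<epsilon> t \<omega>)})"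
proof -
  have "((\<lambda>\<epsilon>. x - kernel_form (R \<epsilon>) J c c / 2) \<longlongrightarrow> x - kernel_form Rlim J c c / 2) (at_right 0)"
    by (intro tendsto_intros tendsto_kernel_form R_lim) (use J in auto)
  from order_tendstoD(1)[OF this x]
  have "\<forall>\<^sub>F \<epsilon> in at_right 0. prob {\<omega> \<in> space N. x \<le> (\<Sum>t\<in>J. c t * Z \<epsilon> t \<omega>)} \<le> 1 * exp (- b / (\<gamma> \<epsilon>)\<^sup>2)"
    using eventually_pos
  proof eventually_elim
    case (elim \<epsilon>)
    have "prob {\<omega> \<in> space N. x \<le> (\<Sum>t\<in>J. c t * Z \<epsilon> t \<omega>)} \<le> exp (- (x - kernel_form (R \<epsilon>) J c c / 2) / (\<gamma> \<epsilon>)\<^sup>2)"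
      by (rule chernoff_speed[OF elim(2) J])
    also have "\<dots> \<le> exp (- b / (\<gamma> \<epsilon>)\<^sup>2)"
      using elim(1) unfolding exp_le_cancel_iff by (intro divide_right_mono) auto
    finally show ?case by simp
  qed
  then show ?thesis unfolding exp_small_def by blast
qed

text \<open>
  A point of \<open>\<Gamma>\<close> lies in an open half-space of small probability. Around any other point, paths of \<open>Z \<epsilon>\<close>
  in a small ball keep \<open>U \<epsilon>\<close> out of \<open>\<Gamma>\<close> once \<open>m \<epsilon>\<close> is small. The event refers to both processes so
  that the compact set to be covered can be chosen for \<open>Z \<epsilon>\<close>, without regard to \<open>m \<epsilon>\<close>.
\<close>

lemma upper_bound_local:
  assumes \<Gamma>: "closedin (C_topology 1) \<Gamma>" and h: "h \<in> C_space 1"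
    and b: "h \<in> \<Gamma> \<Longrightarrow> \<exists>J c. finite J \<and> J \<subseteq> {0..1} \<and> b < (\<Sum>t\<in>J. c t * h t) - kernel_form Rlim J c c / 2"
  shows "\<exists>V. openin (C_topology 1) V \<and> h \<in> V \<and>
    exp_small b (\<lambda>\<epsilon>. prob (Z_in \<epsilon> V \<inter> U_in \<epsilon> \<Gamma>))"
proof (cases "h \<in> \<Gamma>")
  case True
  then obtain J c where J: "finite J" "J \<subseteq> {0..1}" and bJ: "b < (\<Sum>t\<in>J. c t * h t) - kernel_form Rlim J c c / 2"
    using b by auto
  then obtain x where x: "b < x - kernel_form Rlim J c c / 2" "x < (\<Sum>t\<in>J. c t * h t)"
    using dense[of "b + kernel_form Rlim J c c / 2" "\<Sum>t\<in>J. c t * h t"] by (auto simp: algebra_simps)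
  define V where "V = {f \<in> topspace (C_topology 1). (\<Sum>t\<in>J. c t * f t) \<in> {x<..}}"
  have V: "openin (C_topology 1) V"
    unfolding V_def by (rule openin_continuous_map_preimage[OF continuous_map_evaluation_sum[OF J]]) simp
  have hV: "h \<in> V" using h x by (simp add: V_def topspace_C_topology)
  have "exp_small b (\<lambda>\<epsilon>. prob (Z_in \<epsilon> V \<inter> U_in \<epsilon> \<Gamma>))"
  proof (rule exp_small_mono[OF exp_small_halfspace[OF J x(1)]])
    show "\<forall>\<^sub>F \<epsilon> in at_right 0. prob (Z_in \<epsilon> V \<inter> U_in \<epsilon> \<Gamma>)
        \<le> prob {\<omega> \<in> space N. x \<le> (\<Sum>t\<in>J. c t * Z \<epsilon> t \<omega>)}"
      using eventually_pos
    proof eventually_elim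
      case (elim \<epsilon>)
      have "(\<Sum>t\<in>J. c t * path 1 (Z \<epsilon>) \<omega> t) = (\<Sum>t\<in>J. c t * Z \<epsilon> t \<omega>)" for \<omega>
        using J by (intro sum.cong) (auto simp: path_def)
      then show ?case
        using lincomb_measurable[OF elim J(2), of c]
        by (intro finite_measure_mono) (auto simp: V_def)
    qed
  qed
  with V hV show ?thesis by blast
next
  case False
  with h \<Gamma> obtain r where r: "0 < r" "disjnt \<Gamma> (C1.mball h r)"
    unfolding C_topology_1 C1.closedin_metric by blast
  have "\<forall>\<^sub>F \<epsilon> in at_right 0. prob (Z_in \<epsilon> (C1.mball h (r/2)) \<inter> U_in \<epsilon> \<Gamma>) \<le> 1 * exp (- b / (\<gamma> \<epsilon>)\<^sup>2)"
    using eventually_pos uniform_limitD[OF m_lim, of "r/3", OF divide_pos_pos[OF r(1) zero_less_numeral]]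
  proof eventually_elim
    case (elim \<epsilon>)
    have "path 1 (U \<epsilon>) \<omega> \<notin> \<Gamma>" if w: "\<omega> \<in> space N" "path 1 (Z \<epsilon>) \<omega> \<in> C1.mball h (r/2)" for \<omega>
    proof
      assume \<Gamma>: "path 1 (U \<epsilon>) \<omega> \<in> \<Gamma>"
      have "sup_dist 1 (path 1 (Z \<epsilon>) \<omega>) (path 1 (U \<epsilon>) \<omega>) \<le> r/3"
        using elim w by (intro sup_dist_least path_Z_in path_U_in) (auto simp: path_def U_def less_imp_le)
      then have "sup_dist 1 h (path 1 (U \<epsilon>) \<omega>) < r"
        using C1.triangle[OF h path_Z_in[OF elim(1) w(1)] path_U_in[OF elim(1) w(1)]] w r by simp
      then show False using r(2) \<Gamma> h path_U_in[OF elim(1) w(1)] by (auto simp: disjnt_iff)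
    qed
    then have "(Z_in \<epsilon> (C1.mball h (r/2)) \<inter> U_in \<epsilon> \<Gamma>) = {}" by blast
    then show ?case by (simp only: measure_empty) simp
  qed
  then have "exp_small b (\<lambda>\<epsilon>. prob (Z_in \<epsilon> (C1.mball h (r/2)) \<inter> U_in \<epsilon> \<Gamma>))"
    unfolding exp_small_def by blast
  moreover have "openin (C_topology 1) (C1.mball h (r/2))" "h \<in> C1.mball h (r/2)"
    using h r by (auto simp: C_topology_1)
  ultimately show ?thesis by blast
qed

text \<open>
  Cover a compact chaining set of negligible complement by finitely many of the local neighbourhoods.
\<close>

lemma upper_bound:
  assumes \<Gamma>: "closedin (C_topology 1) \<Gamma>"
    and b: "\<And>h. h \<in> \<Gamma> \<Longrightarrow> \<exists>J c. finite J \<and> J \<subseteq> {0..1} \<and> b < (\<Sum>t\<in>J. c t * h t) - kernel_form Rlim J c c / 2"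
  shows "exp_small b (\<lambda>\<epsilon>. prob (U_in \<epsilon> \<Gamma>))"
proof -
  obtain L where L: "0 < L" "b \<le> L\<^sup>2 / (4 * C)" by (rule large_chaining_level)
  define K where "K = chaining_set L \<rho>"
  have K: "compactin (C_topology 1) K" unfolding K_def using L \<rho> by (intro compactin_chaining_set) auto
  have KC: "K \<subseteq> C_space 1" by (auto simp: K_def chaining_set_def)
  have "\<forall>h\<in>K. \<exists>V. openin (C_topology 1) V \<and> h \<in> V \<and>
    exp_small b (\<lambda>\<epsilon>. prob (Z_in \<epsilon> V \<inter> U_in \<epsilon> \<Gamma>))"
    using upper_bound_local[OF \<Gamma> _ b] KC by blast
  from bchoice[OF this] obtain V where V': "\<forall>h\<in>K. openin (C_topology 1) (V h) \<and> h \<in> V h \<and>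
    exp_small b (\<lambda>\<epsilon>. prob (Z_in \<epsilon> (V h) \<inter> U_in \<epsilon> \<Gamma>))"
    by (rule exE)
  then have V: "\<And>h. h \<in> K \<Longrightarrow> openin (C_topology 1) (V h)" "\<And>h. h \<in> K \<Longrightarrow> h \<in> V h"
    "\<And>h. h \<in> K \<Longrightarrow> exp_small b (\<lambda>\<epsilon>. prob (Z_in \<epsilon> (V h) \<inter> U_in \<epsilon> \<Gamma>))"
    by blast+
  have "\<exists>\<F>. finite \<F> \<and> \<F> \<subseteq> V ` K \<and> K \<subseteq> \<Union>\<F>"
  proof -
    have "\<forall>W\<in>V ` K. openin (C_topology 1) W" "K \<subseteq> \<Union>(V ` K)" using V by auto
    then show ?thesis using K unfolding compactin_def by blast
  qed
  then obtain \<F> where \<F>: "finite \<F>" "\<F> \<subseteq> V ` K" "K \<subseteq> \<Union>\<F>" by blast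
  from finite_subset_image[OF \<F>(1,2)] obtain F where "F \<subseteq> K" "finite F" "\<F> = V ` F" by blast
  with \<F>(3) have F: "finite F" "F \<subseteq> K" "K \<subseteq> (\<Union>h\<in>F. V h)" by auto
  have tight: "exp_small b (\<lambda>\<epsilon>. prob (space N - Z_in \<epsilon> K))"
  proof -
    have "\<forall>\<^sub>F \<epsilon> in at_right 0. prob (space N - Z_in \<epsilon> K) \<le> max 0 chaining_constant * exp (- b / (\<gamma> \<epsilon>)\<^sup>2)"
      using eventually_pos order_tendstoD(2)[OF \<gamma>_lim L(1)]
    proof eventually_elim
      case (elim \<epsilon>)
      have "prob (space N - Z_in \<epsilon> K) \<le> chaining_constant * exp (- (L\<^sup>2 / (4 * C)) / (\<gamma> \<epsilon>)\<^sup>2)"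
        unfolding K_def using elim by (intro exponential_tightness) auto
      also have "\<dots> \<le> max 0 chaining_constant * exp (- b / (\<gamma> \<epsilon>)\<^sup>2)"
      proof (intro mult_mono)
        show "exp (- (L\<^sup>2 / (4 * C)) / (\<gamma> \<epsilon>)\<^sup>2) \<le> exp (- b / (\<gamma> \<epsilon>)\<^sup>2)"
          unfolding exp_le_cancel_iff using L by (intro divide_right_mono) auto
      qed auto
      finally show ?case .
    qed
    then show ?thesis unfolding exp_small_def by blast
  qed
  have "exp_small b (\<lambda>\<epsilon>. \<Sum>h\<in>F. prob (Z_in \<epsilon> (V h) \<inter> U_in \<epsilon> \<Gamma>))"
    using F V by (intro exp_small_sum) auto
  from exp_small_add[OF tight this] show ?thesis
  proof (rule exp_small_mono)
    show "\<forall>\<^sub>F \<epsilon> in at_right 0. prob (U_in \<epsilon> \<Gamma>) \<le> prob (space N - Z_in \<epsilon> K) +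
        (\<Sum>h\<in>F. prob (Z_in \<epsilon> (V h) \<inter> U_in \<epsilon> \<Gamma>))"
      using eventually_pos
    proof eventually_elim
      case (elim \<epsilon>)
      have V_sets: "(Z_in \<epsilon> (V h) \<inter> U_in \<epsilon> \<Gamma>) \<in> sets N" if "h \<in> F" for h
        using that F by (intro sets.Int Z_open U_closed elim V \<Gamma>) auto
      have K_sets: "space N - Z_in \<epsilon> K \<in> sets N"
        unfolding K_def by (intro sets.compl_sets Z_closed elim closedin_chaining_set)
      have "prob (U_in \<epsilon> \<Gamma>) \<le> prob ((space N - Z_in \<epsilon> K) \<union>
        (\<Union>h\<in>F. (Z_in \<epsilon> (V h) \<inter> U_in \<epsilon> \<Gamma>)))"
        using F V_sets K_sets by (intro finite_measure_mono sets.Un sets.finite_UN) auto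
      also have "\<dots> \<le> prob (space N - Z_in \<epsilon> K) +
        prob (\<Union>h\<in>F. (Z_in \<epsilon> (V h) \<inter> U_in \<epsilon> \<Gamma>))"
        using F V_sets K_sets by (intro measure_Un_le sets.finite_UN) auto
      also have "prob (\<Union>h\<in>F. (Z_in \<epsilon> (V h) \<inter> U_in \<epsilon> \<Gamma>))
        \<le> (\<Sum>h\<in>F. prob (Z_in \<epsilon> (V h) \<inter> U_in \<epsilon> \<Gamma>))"
        using F V_sets by (intro finite_measure_subadditive_finite) auto
      finally show ?case by simp
    qed
  qed
qed

section \<open>The large deviation lower bound\<close>

text \<open>
  Under the probability measure with density \<open>D\<close>, the combination with coefficients \<open>d\<close> is Gaussian with mean
  \<open>kernel_form (R \<epsilon>) J d c\<close> and variance \<open>(\<gamma> \<epsilon>)\<^sup>2 * kernel_form (R \<epsilon>) J d d\<close>. The function \<open>E\<close> is the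
  integrand of the exponential Markov inequality, with multiplier \<open>1 / \<gamma> \<epsilon>\<close>, for the event that this
  combination exceeds its mean by \<open>\<delta>\<close>.
\<close>

lemma tilted_tail:
  fixes c d :: "real \<Rightarrow> real"
  assumes \<epsilon>: "0 < \<epsilon>" and J: "finite J" "J \<subseteq> {0..1}"
  defines "D \<equiv> \<lambda>\<omega>. exp (((\<Sum>t\<in>J. c t * Z \<epsilon> t \<omega>) - kernel_form (R \<epsilon>) J c c / 2) / (\<gamma> \<epsilon>)\<^sup>2)"
  shows "has_bochner_integral N D 1"
    and "\<exists>E. has_bochner_integral N E (exp (kernel_form (R \<epsilon>) J d d / 2 - \<delta> / \<gamma> \<epsilon>)) \<and>
      (\<forall>\<omega>. 0 \<le> E \<omega> \<and> ((\<Sum>t\<in>J. d t * Z \<epsilon> t \<omega>) \<ge> kernel_form (R \<epsilon>) J d c + \<delta> \<longrightarrow> D \<omega> \<le> E \<omega>))"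
proof -
  define g where "g = \<gamma> \<epsilon>"
  have g: "0 < g" using \<gamma>_pos[OF \<epsilon>] by (simp add: g_def)
  define Q where "Q = kernel_form (R \<epsilon>) J c c"
  have sym: "R \<epsilon> s t = R \<epsilon> t s" if "s \<in> J" "t \<in> J" for s t
    using that J by (intro R_sym[OF \<epsilon>]) auto
  have gen: "has_bochner_integral N (\<lambda>\<omega>. exp (((\<Sum>t\<in>J. c t * Z \<epsilon> t \<omega>) - Q / 2) / g\<^sup>2) *
      exp (\<theta> * ((\<Sum>t\<in>J. d t * Z \<epsilon> t \<omega>) - kernel_form (R \<epsilon>) J d c - \<delta>)))
      (exp (g\<^sup>2 * \<theta>\<^sup>2 * kernel_form (R \<epsilon>) J d d / 2 - \<theta> * \<delta>))" for \<theta>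
  proof -
    have "has_bochner_integral N (\<lambda>\<omega>. exp (\<Sum>t\<in>J. (1 / g\<^sup>2 * c t + \<theta> * d t) * Z \<epsilon> t \<omega>) *
        exp (- Q / 2 / g\<^sup>2 - \<theta> * (kernel_form (R \<epsilon>) J d c + \<delta>)))
      (exp (g\<^sup>2 * ((1 / g\<^sup>2)\<^sup>2 * Q + 2 * (1 / g\<^sup>2) * \<theta> * kernel_form (R \<epsilon>) J d c + \<theta>\<^sup>2 * kernel_form (R \<epsilon>) J d d) / 2) *
        exp (- Q / 2 / g\<^sup>2 - \<theta> * (kernel_form (R \<epsilon>) J d c + \<delta>)))"
    proof -
      have form: "kernel_form (R \<epsilon>) J (\<lambda>t. 1 / g\<^sup>2 * c t + \<theta> * d t) (\<lambda>t. 1 / g\<^sup>2 * c t + \<theta> * d t)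
        = (1 / g\<^sup>2)\<^sup>2 * Q + 2 * (1 / g\<^sup>2) * \<theta> * kernel_form (R \<epsilon>) J d c + \<theta>\<^sup>2 * kernel_form (R \<epsilon>) J d d"
        unfolding Q_def by (rule kernel_form_lincomb) (rule sym)
      show ?thesis
        by (rule has_bochner_integral_mult_left)
          (rule mgf[OF \<epsilon> J, of "\<lambda>t. 1 / g\<^sup>2 * c t + \<theta> * d t", unfolded form, folded g_def])
    qed
    moreover have "exp (\<Sum>t\<in>J. (1 / g\<^sup>2 * c t + \<theta> * d t) * Z \<epsilon> t \<omega>) *
        exp (- Q / 2 / g\<^sup>2 - \<theta> * (kernel_form (R \<epsilon>) J d c + \<delta>))
      = exp (((\<Sum>t\<in>J. c t * Z \<epsilon> t \<omega>) - Q / 2) / g\<^sup>2) *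
      exp (\<theta> * ((\<Sum>t\<in>J. d t * Z \<epsilon> t \<omega>) - kernel_form (R \<epsilon>) J d c - \<delta>))" for \<omega>
    proof -
      have "(\<Sum>t\<in>J. (1 / g\<^sup>2 * c t + \<theta> * d t) * Z \<epsilon> t \<omega>) = 1 / g\<^sup>2 * (\<Sum>t\<in>J. c t * Z \<epsilon> t \<omega>) + \<theta> * (\<Sum>t\<in>J. d t * Z \<epsilon> t \<omega>)"
        by (simp only: distrib_right sum.distrib mult.assoc sum_distrib_left)
      then show ?thesis by (simp only: exp_add[symmetric]) (simp add: diff_divide_distrib algebra_simps)
    qed
    moreover have "exp (g\<^sup>2 * ((1 / g\<^sup>2)\<^sup>2 * Q + 2 * (1 / g\<^sup>2) * \<theta> * kernel_form (R \<epsilon>) J d c + \<theta>\<^sup>2 * kernel_form (R \<epsilon>) J d d) / 2) *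
        exp (- Q / 2 / g\<^sup>2 - \<theta> * (kernel_form (R \<epsilon>) J d c + \<delta>))
      = exp (g\<^sup>2 * \<theta>\<^sup>2 * kernel_form (R \<epsilon>) J d d / 2 - \<theta> * \<delta>)"
      unfolding exp_add[symmetric] using g by (simp add: power2_eq_square field_simps)
    ultimately show ?thesis by simp
  qed
  show "has_bochner_integral N D 1"
    using gen[of 0] by (simp add: D_def Q_def g_def)
  show "\<exists>E. has_bochner_integral N E (exp (kernel_form (R \<epsilon>) J d d / 2 - \<delta> / \<gamma> \<epsilon>)) \<and>
      (\<forall>\<omega>. 0 \<le> E \<omega> \<and> ((\<Sum>t\<in>J. d t * Z \<epsilon> t \<omega>) \<ge> kernel_form (R \<epsilon>) J d c + \<delta> \<longrightarrow> D \<omega> \<le> E \<omega>))"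
  proof (intro exI conjI allI impI)
    show "has_bochner_integral N (\<lambda>\<omega>. D \<omega> * exp (1 / g * ((\<Sum>t\<in>J. d t * Z \<epsilon> t \<omega>) - kernel_form (R \<epsilon>) J d c - \<delta>)))
      (exp (kernel_form (R \<epsilon>) J d d / 2 - \<delta> / \<gamma> \<epsilon>))"
      using gen[of "1 / g"] g by (simp add: D_def Q_def g_def power_divide)
  next
    fix \<omega> assume "(\<Sum>t\<in>J. d t * Z \<epsilon> t \<omega>) \<ge> kernel_form (R \<epsilon>) J d c + \<delta>"
    then have "1 \<le> exp (1 / g * ((\<Sum>t\<in>J. d t * Z \<epsilon> t \<omega>) - kernel_form (R \<epsilon>) J d c - \<delta>))"
      using g by simp
    then show "D \<omega> \<le> D \<omega> * exp (1 / g * ((\<Sum>t\<in>J. d t * Z \<epsilon> t \<omega>) - kernel_form (R \<epsilon>) J d c - \<delta>))"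
      using mult_left_mono[of 1 _ "D \<omega>"] by (simp add: D_def)
  qed (simp add: D_def)
qed

lemma speed_diverges: "filterlim (\<lambda>\<epsilon>. 1 / \<gamma> \<epsilon>) at_top (at_right 0)"
proof -
  have "filterlim \<gamma> (at_right 0) (at_right 0)"
    using \<gamma>_lim eventually_mono[OF eventually_pos \<gamma>_pos] by (intro filterlim_at_withinI) auto
  from filterlim_compose[OF filterlim_inverse_at_top_right this] show ?thesis by (simp add: inverse_eq_divide)
qed

lemma exp_speed_tendsto_0:
  assumes "0 < \<delta>" "(q \<longlongrightarrow> l) (at_right 0)"
  shows "((\<lambda>\<epsilon>. exp (q \<epsilon> - \<delta> / \<gamma> \<epsilon>)) \<longlongrightarrow> 0) (at_right 0)"
proof -
  have "filterlim (\<lambda>\<epsilon>. - q \<epsilon> + \<delta> * (1 / \<gamma> \<epsilon>)) at_top (at_right 0)"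
    by (intro filterlim_tendsto_add_at_top[OF tendsto_minus[OF assms(2)]]
        filterlim_tendsto_pos_mult_at_top[OF tendsto_const assms(1)] speed_diverges)
  from filterlim_compose[OF exp_at_bot filterlim_compose[OF filterlim_uminus_at_bot_at_top this]]
  show ?thesis by simp
qed

text \<open>
  The tilting density has integral 1. It puts a vanishing mass on the events that a value of
  \<open>Z \<epsilon>\<close> on \<open>J\<close> is far from its tilted mean or that the tilting functional is far above its own. On the remaining
  event, the density is at most the exponential of \<open>(kernel_form Rlim J c c / 2 + \<delta>) / (\<gamma> \<epsilon>)\<^sup>2\<close>, so this
  event must have at least the asserted probability.
\<close>

lemma lower_bound_finite:
  assumes J: "finite J" "J \<subseteq> {0..1}" and \<delta>: "0 < \<delta>"
  shows "\<forall>\<^sub>F \<epsilon> in at_right 0. 1/2 * exp (- (kernel_form Rlim J c c / 2 + \<delta>) / (\<gamma> \<epsilon>)\<^sup>2)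
    \<le> prob {\<omega> \<in> space N. \<forall>t\<in>J. \<bar>Z \<epsilon> t \<omega> - (\<Sum>s\<in>J. c s * Rlim t s)\<bar> < \<delta>}"
proof -
  define e where "e t s = (if s = t then 1 else 0 :: real)" for t s :: real
  \<comment> \<open>the functionals to be controlled: both signs of each evaluation, and the tilting functional\<close>
  define \<D> where "\<D> = insert c (e ` J \<union> (\<lambda>t s. - e t s) ` J)"
  have \<D>: "finite \<D>" using J by (simp add: \<D>_def)
  have e_sum: "(\<Sum>s\<in>J. e t s * f s) = f t" if "t \<in> J" for t f
  proof -
    have "(\<Sum>s\<in>J. e t s * f s) = (\<Sum>s\<in>J. if s = t then f s else 0)" by (intro sum.cong) (auto simp: e_def)
    then show ?thesis using J that by simp
  qed
  have e_form: "kernel_form k J (e t) c = (\<Sum>s\<in>J. c s * k t s)" if "t \<in> J" for t k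
    using e_sum[OF that, of "\<lambda>t. \<Sum>s\<in>J. c s * k t s"]
    by (simp add: kernel_form_def sum_distrib_left mult.assoc)
  have neg: "kernel_form k J (\<lambda>s. - d s) c = - kernel_form k J d c" for k d
    by (simp add: kernel_form_def sum_negf)
  have Rl: "((\<lambda>\<epsilon>. kernel_form (R \<epsilon>) J a b) \<longlongrightarrow> kernel_form Rlim J a b) (at_right 0)" for a b
    by (intro tendsto_kernel_form R_lim) (use J in auto)
  have "((\<lambda>\<epsilon>. \<Sum>d\<in>\<D>. exp (kernel_form (R \<epsilon>) J d d / 2 - (\<delta>/2) / \<gamma> \<epsilon>)) \<longlongrightarrow> (\<Sum>d\<in>\<D>. 0)) (at_right 0)"
  proof (intro tendsto_sum exp_speed_tendsto_0)
    show "((\<lambda>\<epsilon>. kernel_form (R \<epsilon>) J d d / 2) \<longlongrightarrow> kernel_form Rlim J d d / 2) (at_right 0)" for d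
      by (intro tendsto_intros Rl) simp
  qed (use \<delta> in simp)
  then have ev1: "\<forall>\<^sub>F \<epsilon> in at_right 0. (\<Sum>d\<in>\<D>. exp (kernel_form (R \<epsilon>) J d d / 2 - (\<delta>/2) / \<gamma> \<epsilon>)) < 1/2"
    by (intro order_tendstoD(2)) auto
  have ev2: "\<forall>\<^sub>F \<epsilon> in at_right 0. \<forall>t\<in>J. \<bar>kernel_form (R \<epsilon>) J (e t) c - kernel_form Rlim J (e t) c\<bar> < \<delta>/2"
    unfolding eventually_ball_finite_distrib[OF J(1)]
    using \<delta> by (intro ballI tendstoD[OF Rl, of "\<delta>/2", unfolded dist_real_def]) auto
  have ev3: "\<forall>\<^sub>F \<epsilon> in at_right 0. \<bar>kernel_form (R \<epsilon>) J c c - kernel_form Rlim J c c\<bar> < \<delta>"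
    by (rule tendstoD[OF Rl \<delta>, unfolded dist_real_def])
  show ?thesis
    using ev1 ev2 ev3 eventually_pos
  proof eventually_elim
    case (elim \<epsilon>)
    note \<epsilon> = \<open>0 < \<epsilon>\<close>
    define A where "A = {\<omega> \<in> space N. \<forall>t\<in>J. \<bar>Z \<epsilon> t \<omega> - (\<Sum>s\<in>J. c s * Rlim t s)\<bar> < \<delta>}"
    have A: "A \<in> sets N"
      unfolding A_def using J meas[OF \<epsilon>]
      by (intro sets.sets_Collect_finite_All borel_measurable_less borel_measurable_abs borel_measurable_diff) auto
    define D where "D \<omega> = exp (((\<Sum>t\<in>J. c t * Z \<epsilon> t \<omega>) - kernel_form (R \<epsilon>) J c c / 2) / (\<gamma> \<epsilon>)\<^sup>2)" for \<omega>
    have D: "has_bochner_integral N D 1"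
      unfolding D_def[abs_def] by (rule tilted_tail(1)[OF \<epsilon> J])
    have "\<forall>d. \<exists>E. has_bochner_integral N E (exp (kernel_form (R \<epsilon>) J d d / 2 - (\<delta>/2) / \<gamma> \<epsilon>)) \<and>
      (\<forall>\<omega>. 0 \<le> E \<omega> \<and> ((\<Sum>t\<in>J. d t * Z \<epsilon> t \<omega>) \<ge> kernel_form (R \<epsilon>) J d c + \<delta>/2 \<longrightarrow> D \<omega> \<le> E \<omega>))"
      unfolding D_def by (intro allI tilted_tail(2)[OF \<epsilon> J])
    from choice[OF this] obtain E where "\<forall>d. has_bochner_integral N (E d) (exp (kernel_form (R \<epsilon>) J d d / 2 - (\<delta>/2) / \<gamma> \<epsilon>)) \<and>
      (\<forall>\<omega>. 0 \<le> E d \<omega> \<and> ((\<Sum>t\<in>J. d t * Z \<epsilon> t \<omega>) \<ge> kernel_form (R \<epsilon>) J d c + \<delta>/2 \<longrightarrow> D \<omega> \<le> E d \<omega>))"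
      by (rule exE)
    then have E: "\<And>d. has_bochner_integral N (E d) (exp (kernel_form (R \<epsilon>) J d d / 2 - (\<delta>/2) / \<gamma> \<epsilon>))"
      "\<And>d \<omega>. 0 \<le> E d \<omega>"
      "\<And>d \<omega>. (\<Sum>t\<in>J. d t * Z \<epsilon> t \<omega>) \<ge> kernel_form (R \<epsilon>) J d c + \<delta>/2 \<Longrightarrow> D \<omega> \<le> E d \<omega>"
      by blast+
    define x where "x = exp ((kernel_form Rlim J c c / 2 + \<delta>) / (\<gamma> \<epsilon>)\<^sup>2)"
    have bound: "D \<omega> \<le> x * indicator A \<omega> + (\<Sum>d\<in>\<D>. E d \<omega>)" if w: "\<omega> \<in> space N" for \<omega>
    proof (cases "\<exists>d\<in>\<D>. (\<Sum>t\<in>J. d t * Z \<epsilon> t \<omega>) \<ge> kernel_form (R \<epsilon>) J d c + \<delta>/2")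
      case True
      then obtain d where d: "d \<in> \<D>" "D \<omega> \<le> E d \<omega>" using E(3) by blast
      have "E d \<omega> \<le> (\<Sum>d\<in>\<D>. E d \<omega>)" using d \<D> E(2) by (intro member_le_sum) auto
      moreover have "0 \<le> x * indicator A \<omega>" by (simp add: x_def)
      ultimately show ?thesis using d by linarith
    next
      case False
      then have F: "(\<Sum>t\<in>J. d t * Z \<epsilon> t \<omega>) < kernel_form (R \<epsilon>) J d c + \<delta>/2" if "d \<in> \<D>" for d
        using that by (meson not_le)
      have "\<bar>Z \<epsilon> t \<omega> - (\<Sum>s\<in>J. c s * Rlim t s)\<bar> < \<delta>" if t: "t \<in> J" for t
      proof -
        have 1: "Z \<epsilon> t \<omega> < kernel_form (R \<epsilon>) J (e t) c + \<delta>/2"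
          using F[of "e t"] t unfolding e_sum[OF t] by (auto simp: \<D>_def)
        have "- (\<Sum>s\<in>J. e t s * Z \<epsilon> s \<omega>) < - kernel_form (R \<epsilon>) J (e t) c + \<delta>/2"
          using F[of "\<lambda>s. - e t s"] t unfolding neg by (auto simp: \<D>_def sum_negf)
        then have 2: "- Z \<epsilon> t \<omega> < - kernel_form (R \<epsilon>) J (e t) c + \<delta>/2" unfolding e_sum[OF t] .
        have 3: "\<bar>kernel_form (R \<epsilon>) J (e t) c - kernel_form Rlim J (e t) c\<bar> < \<delta>/2" using elim(2) t by blast
        show ?thesis unfolding e_form[OF t, symmetric] using 1 2 3 by linarith
      qed
      then have "\<omega> \<in> A" using w by (simp add: A_def)
      moreover have "D \<omega> \<le> x"
      proof -
        have "(\<Sum>t\<in>J. c t * Z \<epsilon> t \<omega>) < kernel_form (R \<epsilon>) J c c + \<delta>/2" by (rule F) (simp add: \<D>_def)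
        then have "(\<Sum>t\<in>J. c t * Z \<epsilon> t \<omega>) - kernel_form (R \<epsilon>) J c c / 2 \<le> kernel_form Rlim J c c / 2 + \<delta>"
          using elim(3) by linarith
        then show ?thesis unfolding D_def x_def exp_le_cancel_iff by (intro divide_right_mono) auto
      qed
      moreover have "0 \<le> (\<Sum>d\<in>\<D>. E d \<omega>)" using E(2) by (intro sum_nonneg) auto
      ultimately show ?thesis by simp
    qed
    have i: "has_bochner_integral N (\<lambda>\<omega>. x * indicator A \<omega> + (\<Sum>d\<in>\<D>. E d \<omega>))
      (x * prob A + (\<Sum>d\<in>\<D>. exp (kernel_form (R \<epsilon>) J d d / 2 - (\<delta>/2) / \<gamma> \<epsilon>)))"
      using A by (intro has_bochner_integral_add has_bochner_integral_sum E has_bochner_integral_mult_right has_bochner_integral_real_indicator)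
        (auto simp: less_top[symmetric])
    have "1 \<le> x * prob A + (\<Sum>d\<in>\<D>. exp (kernel_form (R \<epsilon>) J d d / 2 - (\<delta>/2) / \<gamma> \<epsilon>))"
      using integral_mono[of N D "\<lambda>\<omega>. x * indicator A \<omega> + (\<Sum>d\<in>\<D>. E d \<omega>)"] D i bound
      by (simp add: has_bochner_integral_iff)
    with elim(1) have "1/2 \<le> x * prob A" by linarith
    then have "1/2 / x \<le> prob A" by (simp add: x_def pos_divide_le_eq mult.commute)
    moreover have "1/2 * exp (- (kernel_form Rlim J c c / 2 + \<delta>) / (\<gamma> \<epsilon>)\<^sup>2) = 1/2 / x"
      unfolding x_def minus_divide_left[symmetric] exp_minus by (rule divide_inverse[symmetric])
    ultimately show ?case unfolding A_def by simp
  qed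
qed

text \<open>
  Control at the dyadic times of a fine level is control of the uniform distance, except on the
  complement of a chaining set. The level \<open>L\<close> of this set is chosen so large that the complement is
  negligible compared with the lower bound at finitely many times.
\<close>

lemma lower_bound_ball:
  assumes J: "finite J" "J \<subseteq> {0..1}" and \<eta>: "0 < \<eta>" and r: "0 < r"
    and g: "g \<in> C_space 1" "\<And>t. t \<in> {0..1} \<Longrightarrow> g t = (\<Sum>s\<in>J. c s * Rlim t s)"
  shows "\<forall>\<^sub>F \<epsilon> in at_right 0. 1/4 * exp (- (kernel_form Rlim J c c / 2 + \<eta>) / (\<gamma> \<epsilon>)\<^sup>2)
    \<le> prob (U_in \<epsilon> (C1.mball g r))"
proof -
  define \<delta> where "\<delta> = min \<eta> (r/8)"
  have \<delta>: "0 < \<delta>" "\<delta> \<le> \<eta>" "\<delta> \<le> r/8" using \<eta> r by (auto simp: \<delta>_def)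
  define q where "q = kernel_form Rlim J c c / 2 + \<delta>"
  obtain L where L: "0 < L" "q + 1 \<le> L\<^sup>2 / (4 * C)" by (rule large_chaining_level)
  have gc: "uniformly_continuous_on {0..1} g"
    using g by (intro compact_uniformly_continuous) (auto simp: C_space_def)
  then obtain d where d: "0 < d" "\<And>s t. s \<in> {0..1} \<Longrightarrow> t \<in> {0..1} \<Longrightarrow> \<bar>s - t\<bar> < d \<Longrightarrow> \<bar>g s - g t\<bar> < r/8"
  proof -
    have "0 < r/8" using r by simp
    with gc obtain d where "0 < d" "\<forall>s\<in>{0..1}. \<forall>t\<in>{0..1}. dist t s < d \<longrightarrow> dist (g t) (g s) < r/8"
      unfolding uniformly_continuous_on_def by blast
    then show ?thesis by (intro that[of d]) (auto simp: dist_real_def)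
  qed
  have lim1: "(\<lambda>n. (1/2::real)^n) \<longlonglongrightarrow> 0" by (rule LIMSEQ_power_zero) simp
  have lim2: "(\<lambda>n. L * \<rho>^n / (1 - \<rho>)) \<longlonglongrightarrow> 0"
    using \<rho> by (auto intro!: tendsto_divide_zero tendsto_mult_right_zero LIMSEQ_power_zero)
  have "\<forall>\<^sub>F n in sequentially. (1/2::real)^n < d \<and> L * \<rho>^n / (1 - \<rho>) < r/8"
    using order_tendstoD(2)[OF lim1 d(1)] order_tendstoD(2)[OF lim2, of "r/8"] r by (intro eventually_conj) auto
  then obtain n where n: "(1/2::real)^n < d" "L * \<rho>^n / (1 - \<rho>) < r/8"
    by (auto simp: eventually_sequentially)
  define G where "G = (\<lambda>k. real k / 2^n) ` {..2^n}"
  define J' where "J' = J \<union> G"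
  have G: "finite G" "G \<subseteq> {0..1}"
  proof -
    show "finite G" by (simp add: G_def)
    show "G \<subseteq> {0..1}" unfolding G_def using dyadic_in_unit_interval by blast
  qed
  have J': "finite J'" "J' \<subseteq> {0..1}" using J G by (auto simp: J'_def)
  define c' where "c' s = (if s \<in> J then c s else 0)" for s
  have c'_sum: "(\<Sum>s\<in>J'. c' s * f s) = (\<Sum>s\<in>J. c s * f s)" for f
  proof -
    have "(\<Sum>s\<in>J'. c' s * f s) = (\<Sum>s\<in>J. c' s * f s)"
      using J' by (intro sum.mono_neutral_right) (auto simp: J'_def c'_def)
    then show ?thesis by (simp add: c'_def)
  qed
  have form: "kernel_form Rlim J' c' c' = kernel_form Rlim J c c"
  proof -
    have "kernel_form Rlim J' c' c' = (\<Sum>t\<in>J'. c' t * (\<Sum>s\<in>J'. c' s * Rlim t s))"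
      by (simp add: kernel_form_def sum_distrib_left mult.assoc)
    also have "\<dots> = (\<Sum>t\<in>J. c t * (\<Sum>s\<in>J. c s * Rlim t s))" unfolding c'_sum ..
    finally show ?thesis by (simp add: kernel_form_def sum_distrib_left mult.assoc)
  qed
  have ev1: "\<forall>\<^sub>F \<epsilon> in at_right 0. 1/2 * exp (- q / (\<gamma> \<epsilon>)\<^sup>2)
    \<le> prob {\<omega> \<in> space N. \<forall>t\<in>J'. \<bar>Z \<epsilon> t \<omega> - (\<Sum>s\<in>J. c s * Rlim t s)\<bar> < \<delta>}"
    using lower_bound_finite[OF J' \<delta>(1), of c'] unfolding c'_sum form q_def .
  have "((\<lambda>\<epsilon>. chaining_constant * exp (0 - 1 / \<gamma> \<epsilon>)) \<longlongrightarrow> chaining_constant * 0) (at_right 0)"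
    by (intro tendsto_mult_left exp_speed_tendsto_0[of 1 "\<lambda>_. 0" 0]) auto
  then have ev2: "\<forall>\<^sub>F \<epsilon> in at_right 0. chaining_constant * exp (0 - 1 / \<gamma> \<epsilon>) < 1/4"
    by (intro order_tendstoD(2)) auto
  show ?thesis
    using ev1 ev2 eventually_pos order_tendstoD(2)[OF \<gamma>_lim L(1)] order_tendstoD(2)[OF \<gamma>_lim zero_less_one]
      uniform_limitD[OF m_lim, of "r/8", OF divide_pos_pos[OF r zero_less_numeral]]
  proof eventually_elim
    case (elim \<epsilon>)
    note \<epsilon> = \<open>0 < \<epsilon>\<close>
    have g0: "0 < \<gamma> \<epsilon>" by (rule \<gamma>_pos[OF \<epsilon>])
    define A where "A = {\<omega> \<in> space N. \<forall>t\<in>J'. \<bar>Z \<epsilon> t \<omega> - (\<Sum>s\<in>J. c s * Rlim t s)\<bar> < \<delta>}"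
    define T where "T = (space N - Z_in \<epsilon> (chaining_set L \<rho>))"
    define V where "V = U_in \<epsilon> (C1.mball g r)"
    have T_sets: "T \<in> sets N"
      unfolding T_def by (intro sets.compl_sets Z_closed \<epsilon> closedin_chaining_set)
    have "openin (C_topology 1) (C1.mball g r)" unfolding C_topology_1 by (rule C1.openin_mball)
    then have V_sets: "V \<in> sets N" unfolding V_def by (intro U_open \<epsilon>)
    have "A \<subseteq> V \<union> T"
    proof
      fix \<omega> assume w: "\<omega> \<in> A"
      then have ws: "\<omega> \<in> space N" by (simp add: A_def)
      show "\<omega> \<in> V \<union> T"
      proof (cases "\<omega> \<in> T")
        case False
        then have ch: "path 1 (Z \<epsilon>) \<omega> \<in> chaining_set L \<rho>" using ws by (simp add: T_def)
        have "\<bar>g t - path 1 (U \<epsilon>) \<omega> t\<bar> \<le> r/2" if t: "t \<in> {0..1}" for t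
        proof -
          define u where "u = dyadic_floor n t"
          have u: "u \<in> {0..1}" unfolding u_def by (rule dyadic_floor_in[OF t])
          have uJ: "u \<in> J'"
            unfolding u_def J'_def G_def dyadic_floor_def by (intro UnI2 imageI) (use t dyadic_floor_le[of t n] in simp)
          have "\<bar>path 1 (Z \<epsilon>) \<omega> t - path 1 (Z \<epsilon>) \<omega> u\<bar> \<le> L * \<rho>^n / (1 - \<rho>)"
            unfolding u_def using L \<rho> t by (intro chaining_set_approx[OF ch]) auto
          then have "\<bar>Z \<epsilon> t \<omega> - Z \<epsilon> u \<omega>\<bar> \<le> L * \<rho>^n / (1 - \<rho>)"
            using t u by (simp only: path_def restrict_apply if_True)
          then have 1: "\<bar>Z \<epsilon> t \<omega> - Z \<epsilon> u \<omega>\<bar> < r/8" using n(2) by (rule le_less_trans)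
          have 2: "\<bar>Z \<epsilon> u \<omega> - g u\<bar> < r/8" using w uJ g(2)[OF u] \<delta> by (force simp: A_def)
          have "\<bar>u - t\<bar> < d" using dyadic_floor_bounds[of t n] t n(1) by (auto simp: u_def power_one_over)
          then have 3: "\<bar>g u - g t\<bar> < r/8" by (intro d u t)
          have 4: "\<bar>m \<epsilon> t\<bar> < r/8" using elim(6) t by simp
          have "path 1 (U \<epsilon>) \<omega> t = m \<epsilon> t + Z \<epsilon> t \<omega>" using t by (simp add: path_def U_def)
          then show ?thesis using 1 2 3 4 by linarith
        qed
        then have "sup_dist 1 g (path 1 (U \<epsilon>) \<omega>) \<le> r/2"
          by (intro sup_dist_least g path_U_in \<epsilon> ws) auto
        then have "\<omega> \<in> V" using r g path_U_in[OF \<epsilon> ws] ws by (simp add: V_def)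
        then show ?thesis by simp
      qed simp
    qed
    then have "prob A \<le> prob V + prob T"
      using finite_measure_mono[of A "V \<union> T"] measure_Un_le[of V N T] V_sets T_sets by auto
    moreover have "prob T \<le> 1/4 * exp (- q / (\<gamma> \<epsilon>)\<^sup>2)"
    proof -
      have g1: "1 / \<gamma> \<epsilon> \<le> 1 / (\<gamma> \<epsilon>)\<^sup>2"
        using g0 elim(5) by (simp add: power2_eq_square divide_simps)
      have "prob T \<le> chaining_constant * exp (- (L\<^sup>2 / (4 * C)) / (\<gamma> \<epsilon>)\<^sup>2)"
        unfolding T_def using elim by (intro exponential_tightness) auto
      also have "\<dots> \<le> chaining_constant * (exp (- q / (\<gamma> \<epsilon>)\<^sup>2) * exp (0 - 1 / \<gamma> \<epsilon>))"
      proof (intro mult_left_mono)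
        have "- (L\<^sup>2 / (4 * C)) / (\<gamma> \<epsilon>)\<^sup>2 \<le> - (q + 1) / (\<gamma> \<epsilon>)\<^sup>2"
          using L by (intro divide_right_mono) auto
        also have "\<dots> \<le> - q / (\<gamma> \<epsilon>)\<^sup>2 + (0 - 1 / \<gamma> \<epsilon>)"
          using g1 by (simp add: add_divide_distrib diff_divide_distrib)
        finally show "exp (- (L\<^sup>2 / (4 * C)) / (\<gamma> \<epsilon>)\<^sup>2) \<le> exp (- q / (\<gamma> \<epsilon>)\<^sup>2) * exp (0 - 1 / \<gamma> \<epsilon>)"
          unfolding exp_add[symmetric] by simp
        show "0 \<le> chaining_constant"
          unfolding chaining_constant_def by (intro suminf_nonneg chaining_summable) simp
      qed
      also have "\<dots> = exp (- q / (\<gamma> \<epsilon>)\<^sup>2) * (chaining_constant * exp (0 - 1 / \<gamma> \<epsilon>))" by (simp only: mult_ac)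
      also have "\<dots> \<le> exp (- q / (\<gamma> \<epsilon>)\<^sup>2) * (1/4)" using elim(2) by (intro mult_left_mono) auto
      finally show ?thesis by simp
    qed
    moreover have "1/2 * exp (- q / (\<gamma> \<epsilon>)\<^sup>2) \<le> prob A" using elim(1) by (simp add: A_def)
    ultimately have "1/4 * exp (- q / (\<gamma> \<epsilon>)\<^sup>2) \<le> prob V" by linarith
    moreover have "exp (- (kernel_form Rlim J c c / 2 + \<eta>) / (\<gamma> \<epsilon>)\<^sup>2) \<le> exp (- q / (\<gamma> \<epsilon>)\<^sup>2)"
      unfolding exp_le_cancel_iff q_def using \<delta> by (intro divide_right_mono) auto
    ultimately show ?case unfolding V_def by linarith
  qed
qed

end

section \<open>The large deviation principle for small Gaussian families\<close>

locale small_gaussian_rkhs =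
  small_gaussian_family N Z R Rlim \<gamma> C \<tau> m + holder_rkhs Rlim H ip C \<tau>
  for N :: "'b measure" and Z R Rlim \<gamma> C \<tau> m H ip
begin

lemma speed_limit: "((\<lambda>\<epsilon>. ereal ((\<gamma> \<epsilon>)\<^sup>2 * l - b)) \<longlongrightarrow> - ereal b) (at_right 0)"
proof -
  have "((\<lambda>\<epsilon>. (\<gamma> \<epsilon>)\<^sup>2 * l - b) \<longlongrightarrow> 0\<^sup>2 * l - b) (at_right 0)"
    by (intro tendsto_intros \<gamma>_lim)
  then show ?thesis by simp
qed

lemma Limsup_exp_small:
  assumes small: "exp_small b p" and p: "\<And>\<epsilon>. 0 \<le> p \<epsilon>"
  shows "Limsup (at_right 0) (\<lambda>\<epsilon>. ereal ((\<gamma> \<epsilon>)\<^sup>2) * log_prob (p \<epsilon>)) \<le> - ereal b"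
proof -
  from small obtain \<kappa> where \<kappa>: "\<forall>\<^sub>F \<epsilon> in at_right 0. p \<epsilon> \<le> \<kappa> * exp (- b / (\<gamma> \<epsilon>)\<^sup>2)"
    unfolding exp_small_def by blast
  define l where "l = ln (max 1 \<kappa>)"
  have "\<forall>\<^sub>F \<epsilon> in at_right 0. ereal ((\<gamma> \<epsilon>)\<^sup>2) * log_prob (p \<epsilon>) \<le> ereal ((\<gamma> \<epsilon>)\<^sup>2 * l - b)"
    using \<kappa> eventually_pos
  proof eventually_elim
    case (elim \<epsilon>)
    have g: "0 < (\<gamma> \<epsilon>)\<^sup>2" using \<gamma>_pos[OF elim(2)] by simp
    show ?case
    proof (cases "p \<epsilon> = 0")
      case False
      then have pos: "0 < p \<epsilon>" using p[of \<epsilon>] by simp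
      have "p \<epsilon> \<le> max 1 \<kappa> * exp (- b / (\<gamma> \<epsilon>)\<^sup>2)"
        by (rule order_trans[OF elim(1)]) (intro mult_right_mono, auto)
      then have "ln (p \<epsilon>) \<le> ln (max 1 \<kappa> * exp (- b / (\<gamma> \<epsilon>)\<^sup>2))" using pos by (subst ln_le_cancel_iff) auto
      also have "\<dots> = l + - b / (\<gamma> \<epsilon>)\<^sup>2" unfolding l_def by (subst ln_mult_pos) auto
      finally have "(\<gamma> \<epsilon>)\<^sup>2 * ln (p \<epsilon>) \<le> (\<gamma> \<epsilon>)\<^sup>2 * (l + - b / (\<gamma> \<epsilon>)\<^sup>2)" using g by (intro mult_left_mono) auto
      also have "\<dots> = (\<gamma> \<epsilon>)\<^sup>2 * l - b" using g by (simp add: right_diff_distrib)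
      finally show ?thesis using False by (simp add: log_prob_def)
    qed (use g in \<open>simp add: log_prob_def\<close>)
  qed
  then have "Limsup (at_right 0) (\<lambda>\<epsilon>. ereal ((\<gamma> \<epsilon>)\<^sup>2) * log_prob (p \<epsilon>)) \<le> Limsup (at_right 0) (\<lambda>\<epsilon>. ereal ((\<gamma> \<epsilon>)\<^sup>2 * l - b))"
    by (rule Limsup_mono)
  also have "\<dots> = - ereal b" by (intro lim_imp_Limsup speed_limit) simp
  finally show ?thesis .
qed

lemma Liminf_exp_large:
  assumes large: "\<forall>\<^sub>F \<epsilon> in at_right 0. \<kappa> * exp (- b / (\<gamma> \<epsilon>)\<^sup>2) \<le> p \<epsilon>" and \<kappa>: "0 < \<kappa>"
  shows "- ereal b \<le> Liminf (at_right 0) (\<lambda>\<epsilon>. ereal ((\<gamma> \<epsilon>)\<^sup>2) * log_prob (p \<epsilon>))"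
proof -
  have "\<forall>\<^sub>F \<epsilon> in at_right 0. ereal ((\<gamma> \<epsilon>)\<^sup>2 * ln \<kappa> - b) \<le> ereal ((\<gamma> \<epsilon>)\<^sup>2) * log_prob (p \<epsilon>)"
    using large eventually_pos
  proof eventually_elim
    case (elim \<epsilon>)
    have g: "0 < (\<gamma> \<epsilon>)\<^sup>2" using \<gamma>_pos[OF elim(2)] by simp
    have pos: "0 < p \<epsilon>" by (rule less_le_trans[OF _ elim(1)]) (use \<kappa> in simp)
    have "(\<gamma> \<epsilon>)\<^sup>2 * ln \<kappa> - b = (\<gamma> \<epsilon>)\<^sup>2 * (ln \<kappa> + - b / (\<gamma> \<epsilon>)\<^sup>2)" using g by (simp add: right_diff_distrib)
    also have "ln \<kappa> + - b / (\<gamma> \<epsilon>)\<^sup>2 = ln (\<kappa> * exp (- b / (\<gamma> \<epsilon>)\<^sup>2))" using \<kappa> by (subst ln_mult_pos) auto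
    also have "(\<gamma> \<epsilon>)\<^sup>2 * ln (\<kappa> * exp (- b / (\<gamma> \<epsilon>)\<^sup>2)) \<le> (\<gamma> \<epsilon>)\<^sup>2 * ln (p \<epsilon>)"
      using elim(1) \<kappa> pos g by (intro mult_left_mono) (auto simp: ln_le_cancel_iff)
    finally show ?case using pos by (simp add: log_prob_def)
  qed
  then have "Liminf (at_right 0) (\<lambda>\<epsilon>. ereal ((\<gamma> \<epsilon>)\<^sup>2 * ln \<kappa> - b)) \<le> Liminf (at_right 0) (\<lambda>\<epsilon>. ereal ((\<gamma> \<epsilon>)\<^sup>2) * log_prob (p \<epsilon>))"
    by (rule Liminf_mono)
  moreover have "Liminf (at_right 0) (\<lambda>\<epsilon>. ereal ((\<gamma> \<epsilon>)\<^sup>2 * ln \<kappa> - b)) = - ereal b" by (intro lim_imp_Liminf speed_limit) simp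
  ultimately show ?thesis by simp
qed

text \<open>
  Approximate \<open>h\<close> in \<open>H\<close>, hence uniformly, by a combination of kernel functions. The perturbation estimate keeps the rate
  of the approximation below the rate of \<open>h\<close> plus \<open>e\<close>.
\<close>

lemma lower_bound_open:
  assumes \<Theta>: "openin (C_topology 1) \<Theta>" and h: "h \<in> \<Theta>" "h \<in> H" and e: "0 < e"
  shows "\<forall>\<^sub>F \<epsilon> in at_right 0. 1/4 * exp (- (ip h h / 2 + e) / (\<gamma> \<epsilon>)\<^sup>2) \<le> prob (U_in \<epsilon> \<Theta>)"
proof -
  from \<Theta> h obtain r where r: "0 < r" "C1.mball h r \<subseteq> \<Theta>"
    unfolding C_topology_1 C1.openin_mtopology by blast
  define x where "x = 1 + 2 * ip h h / e"
  have x: "0 < x" "ip h h / x \<le> e / 2"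
  proof -
    show x: "0 < x" using ip_nonneg[OF h(2)] e by (simp add: x_def add_pos_nonneg)
    have "ip h h \<le> e / 2 * x" using e by (simp add: x_def field_simps)
    then show "ip h h / x \<le> e / 2" using x by (simp add: pos_divide_le_eq)
  qed
  define \<eta> where "\<eta> = min (e / 2 / (x + 1)) ((r / 4)\<^sup>2 / C)"
  have \<eta>: "0 < \<eta>" using e x r C_pos by (simp add: \<eta>_def)
  from comb_dense[OF h(2) \<eta>] obtain J c where J: "finite J" "J \<subseteq> {0..1}"
    and close: "ip (\<lambda>x\<in>{0..1}. h x - comb J c x) (\<lambda>x\<in>{0..1}. h x - comb J c x) < \<eta>" by blast
  define g where "g = comb J c"
  have g: "g \<in> H" unfolding g_def by (rule comb_in[OF J])
  define D where "D = ip (\<lambda>x\<in>{0..1}. h x - g x) (\<lambda>x\<in>{0..1}. h x - g x)"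
  have D: "D < \<eta>" "0 \<le> D" using close by (simp_all add: D_def g_def[symmetric] ip_nonneg diff_in h g)
  have "\<bar>h t - g t\<bar> \<le> r / 4" if t: "t \<in> {0..1}" for t
  proof (rule power2_le_imp_le)
    have "(h t - g t)\<^sup>2 \<le> Rlim t t * D"
      using evaluation_bound[OF diff_in[OF h(2) g] t] t by (simp add: D_def)
    also have "\<dots> \<le> C * ((r / 4)\<^sup>2 / C)"
      using D Rlim_diag_le[OF t] C_pos by (intro mult_mono) (auto simp: \<eta>_def)
    finally show "\<bar>h t - g t\<bar>\<^sup>2 \<le> (r / 4)\<^sup>2" using C_pos by simp
  qed (use r in auto)
  then have hg: "sup_dist 1 h g \<le> r / 4" by (intro sup_dist_least H_subset_C_space h g) auto
  have ball: "C1.mball g (r / 2) \<subseteq> \<Theta>"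
  proof (rule order_trans[OF C1.mball_subset r(2)])
    show "sup_dist 1 g h + r / 2 \<le> r" using hg r C1.commute[of g h] by simp
  qed (rule H_subset_C_space[OF h(2)])
  have form: "kernel_form Rlim J c c / 2 + e / 4 \<le> ip h h / 2 + e"
  proof -
    have "kernel_form Rlim J c c = ip g g" unfolding g_def by (rule ip_comb_comb[OF J, symmetric])
    also have "\<dots> \<le> ip h h + ip h h / x + (x + 1) * D"
      unfolding D_def by (rule norm_perturbation[OF h(2) g x(1)])
    also have "(x + 1) * D \<le> (x + 1) * (e / 2 / (x + 1))"
      using D x by (intro mult_left_mono) (auto simp: \<eta>_def)
    also have "\<dots> = e / 2"
      using x by (subst times_divide_eq_right) (rule nonzero_mult_div_cancel_left, simp)
    finally show ?thesis using x(2) e by linarith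
  qed
  have "\<forall>\<^sub>F \<epsilon> in at_right 0. 1/4 * exp (- (kernel_form Rlim J c c / 2 + e / 4) / (\<gamma> \<epsilon>)\<^sup>2)
    \<le> prob (U_in \<epsilon> (C1.mball g (r / 2)))"
    using e r by (intro lower_bound_ball[OF J] H_subset_C_space g) (auto simp: g_def comb_def)
  then show ?thesis
    using eventually_pos
  proof eventually_elim
    case (elim \<epsilon>)
    have "exp (- (ip h h / 2 + e) / (\<gamma> \<epsilon>)\<^sup>2) \<le> exp (- (kernel_form Rlim J c c / 2 + e / 4) / (\<gamma> \<epsilon>)\<^sup>2)"
      unfolding exp_le_cancel_iff using form by (intro divide_right_mono) auto
    also have "1/4 * exp (- (kernel_form Rlim J c c / 2 + e / 4) / (\<gamma> \<epsilon>)\<^sup>2) \<le> prob (U_in \<epsilon> (C1.mball g (r / 2)))"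
      by (rule elim(1))
    also have "\<dots> \<le> prob (U_in \<epsilon> \<Theta>)"
      using ball U_open[OF elim(2) _ elim(2) \<Theta>] by (intro finite_measure_mono) auto
    finally show ?case by simp
  qed
qed

theorem gaussian_LDP: "satisfies_LDP N U (\<lambda>\<epsilon>. (\<gamma> \<epsilon>)\<^sup>2) (rkhs_rate H ip)"
  unfolding satisfies_LDP_def
proof (intro conjI allI impI)
  show "prob_space N" by (rule prob_space_axioms)
  show "path 1 (U \<epsilon>) \<in> measurable N (C_borel 1)" if "0 < \<epsilon>" for \<epsilon>
    by (intro path_measurable U_meas U_cont that)
  show "rate_function (rkhs_rate H ip)" by (rule rate_function_rkhs)
  show "0 < (\<gamma> \<epsilon>)\<^sup>2" if "0 < \<epsilon>" for \<epsilon> using \<gamma>_pos[OF that] by simp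
  show "((\<lambda>\<epsilon>. (\<gamma> \<epsilon>)\<^sup>2) \<longlongrightarrow> 0) (at_right 0)"
    using tendsto_power[OF \<gamma>_lim, of 2] by simp
next
  fix \<Theta> assume \<Theta>: "openin (C_topology 1) \<Theta>"
  define L where "L = Liminf (at_right 0) (\<lambda>\<epsilon>. ereal ((\<gamma> \<epsilon>)\<^sup>2) * log_prob (prob (U_in \<epsilon> \<Theta>)))"
  have "- rkhs_rate H ip h \<le> L" if h: "h \<in> \<Theta>" for h
  proof (cases "h \<in> H")
    case True
    show ?thesis
    proof (rule ccontr)
      assume "\<not> ?thesis"
      then have "L < ereal (- (ip h h / 2))" by (simp add: rate_in_H[OF True])
      then obtain z where z: "L < ereal z" "ereal z < ereal (- (ip h h / 2))"
        using ereal_dense2 by blast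
      define e where "e = - (ip h h / 2) - z"
      have e: "0 < e" using z by (simp add: e_def)
      have "- ereal (ip h h / 2 + e) \<le> L"
        unfolding L_def by (rule Liminf_exp_large[OF lower_bound_open[OF \<Theta> h True e]]) simp
      then have "ereal z \<le> L" by (simp add: e_def)
      with z show False by simp
    qed
  qed (simp add: rkhs_rate_def)
  then have "- L \<le> (INF h\<in>\<Theta>. rkhs_rate H ip h)"
    by (intro INF_greatest) (simp add: ereal_uminus_le_reorder)
  then show "- (INF h\<in>\<Theta>. rkhs_rate H ip h) \<le> L" by (simp add: ereal_uminus_le_reorder)
next
  fix \<Gamma> assume \<Gamma>: "closedin (C_topology 1) \<Gamma>"
  define L where "L = Limsup (at_right 0) (\<lambda>\<epsilon>. ereal ((\<gamma> \<epsilon>)\<^sup>2) * log_prob (prob (U_in \<epsilon> \<Gamma>)))"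
  show "L \<le> - (INF h\<in>\<Gamma>. rkhs_rate H ip h)"
  proof (rule ccontr)
    assume "\<not> ?thesis"
    then have "- L < (INF h\<in>\<Gamma>. rkhs_rate H ip h)" by (simp add: ereal_uminus_less_reorder not_le)
    then obtain b where b: "- L < ereal b" "ereal b < (INF h\<in>\<Gamma>. rkhs_rate H ip h)"
      using ereal_dense2 by blast
    have ex: "\<exists>J c. finite J \<and> J \<subseteq> {0..1} \<and> b < (\<Sum>t\<in>J. c t * h t) - kernel_form Rlim J c c / 2" if h: "h \<in> \<Gamma>" for h
    proof -
      have "ereal b < rkhs_rate H ip h" using b(2) INF_lower[OF h, of "rkhs_rate H ip"] by (rule less_le_trans)
      moreover have "h \<in> C_space 1" using closedin_subset[OF \<Gamma>] h by (auto simp: topspace_C_topology)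
      ultimately show ?thesis by (simp only: less_rate_iff)
    qed
    have "L \<le> - ereal b" unfolding L_def by (rule Limsup_exp_small[OF upper_bound[OF \<Gamma> ex]]) simp_all
    then have "- (- ereal b) \<le> - L" by (simp only: ereal_minus_le_minus)
    with b(1) show False by simp
  qed
qed

end

section \<open>Products of square integrable functions\<close>

lemma square_integrable_mult:
  fixes f g :: "'a \<Rightarrow> real"
  assumes [measurable]: "f \<in> borel_measurable M" "g \<in> borel_measurable M"
    and "integrable M (\<lambda>x. (f x)\<^sup>2)" "integrable M (\<lambda>x. (g x)\<^sup>2)"
  shows "integrable M (\<lambda>x. f x * g x)"
proof (rule Bochner_Integration.integrable_bound)
  show "integrable M (\<lambda>x. (f x)\<^sup>2 + (g x)\<^sup>2)" using assms by simp
  have "\<bar>a * b\<bar> \<le> a\<^sup>2 + b\<^sup>2" for a b :: real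
  proof -
    have "2 * \<bar>a * b\<bar> \<le> a\<^sup>2 + b\<^sup>2"
      using sum_squares_bound[of "\<bar>a\<bar>" "\<bar>b\<bar>"] by (simp add: abs_mult mult.assoc)
    moreover have "0 \<le> \<bar>a * b\<bar>" by simp
    ultimately show ?thesis by linarith
  qed
  then show "AE x in M. norm (f x * g x) \<le> norm ((f x)\<^sup>2 + (g x)\<^sup>2)" by simp
qed simp

lemma L2_cauchy_schwarz:
  fixes f g :: "'a \<Rightarrow> real"
  assumes [measurable]: "f \<in> borel_measurable M" "g \<in> borel_measurable M"
    and f2: "integrable M (\<lambda>x. (f x)\<^sup>2)" and g2: "integrable M (\<lambda>x. (g x)\<^sup>2)"
  shows "(\<integral>x. f x * g x \<partial>M)\<^sup>2 \<le> (\<integral>x. (f x)\<^sup>2 \<partial>M) * (\<integral>x. (g x)\<^sup>2 \<partial>M)"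
proof -
  have fg: "integrable M (\<lambda>x. f x * g x)" by (rule square_integrable_mult) (use assms in auto)
  define a b c where "a = (\<integral>x. (f x)\<^sup>2 \<partial>M)" and "b = (\<integral>x. f x * g x \<partial>M)" and "c = (\<integral>x. (g x)\<^sup>2 \<partial>M)"
  have q: "0 \<le> y\<^sup>2 * a + 2 * y * b + c" for y
  proof -
    have "0 \<le> (\<integral>x. (y * f x + g x)\<^sup>2 \<partial>M)" by simp
    also have "\<dots> = (\<integral>x. y\<^sup>2 * (f x)\<^sup>2 + 2 * y * (f x * g x) + (g x)\<^sup>2 \<partial>M)"
      by (intro Bochner_Integration.integral_cong refl) (simp add: power2_eq_square algebra_simps)
    also have "\<dots> = y\<^sup>2 * a + 2 * y * b + c"
      using f2 g2 fg by (simp add: a_def b_def c_def)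
    finally show ?thesis .
  qed
  have "b\<^sup>2 \<le> a * c"
  proof (cases "a = 0")
    case True
    have "b = 0"
    proof (rule ccontr)
      assume "b \<noteq> 0"
      then have "2 * (- (c + 1) / (2 * b)) * b = - (c + 1)" by simp
      then show False using q[of "- (c + 1) / (2 * b)"] unfolding True by linarith
    qed
    then show ?thesis using True by simp
  next
    case False
    moreover have "0 \<le> a" by (simp add: a_def)
    ultimately have a: "0 < a" by simp
    have "0 \<le> (- b / a)\<^sup>2 * a + 2 * (- b / a) * b + c" by (rule q)
    also have "\<dots> = c - b\<^sup>2 / a" using a by (simp add: power2_eq_square field_simps)
    finally show ?thesis using a by (simp add: pos_divide_le_eq mult.commute)
  qed
  then show ?thesis by (simp add: a_def b_def c_def)
qed

text \<open>
  Continuity of the inner product; the error is split into three terms bounded by the Cauchy--Schwarz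
  inequality.
\<close>

lemma L2_product_tendsto:
  fixes f g :: "nat \<Rightarrow> 'a \<Rightarrow> real"
  assumes [measurable]: "\<And>k. f k \<in> borel_measurable M" "\<And>k. g k \<in> borel_measurable M" "F \<in> borel_measurable M" "G \<in> borel_measurable M"
    and f2: "\<And>k. integrable M (\<lambda>x. (f k x)\<^sup>2)" and g2: "\<And>k. integrable M (\<lambda>x. (g k x)\<^sup>2)"
    and F2: "integrable M (\<lambda>x. (F x)\<^sup>2)" and G2: "integrable M (\<lambda>x. (G x)\<^sup>2)"
    and f: "(\<lambda>k. \<integral>x. (f k x - F x)\<^sup>2 \<partial>M) \<longlonglongrightarrow> 0" and g: "(\<lambda>k. \<integral>x. (g k x - G x)\<^sup>2 \<partial>M) \<longlonglongrightarrow> 0"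
  shows "(\<lambda>k. \<integral>x. f k x * g k x \<partial>M) \<longlonglongrightarrow> (\<integral>x. F x * G x \<partial>M)"
proof -
  have diff2: "integrable M (\<lambda>x. (u x - v x)\<^sup>2)"
    if [measurable]: "u \<in> borel_measurable M" "v \<in> borel_measurable M"
      and "integrable M (\<lambda>x. (u x)\<^sup>2)" "integrable M (\<lambda>x. (v x)\<^sup>2)" for u v :: "'a \<Rightarrow> real"
    using square_integrable_mult[of u M v] that by (simp add: power2_diff mult.assoc)
  define a b where "a k = (\<integral>x. (f k x - F x)\<^sup>2 \<partial>M)" and "b k = (\<integral>x. (g k x - G x)\<^sup>2 \<partial>M)" for k
  define nF nG where "nF = (\<integral>x. (F x)\<^sup>2 \<partial>M)" and "nG = (\<integral>x. (G x)\<^sup>2 \<partial>M)"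
  have cs: "\<bar>\<integral>x. u x * v x \<partial>M\<bar> \<le> sqrt ((\<integral>x. (u x)\<^sup>2 \<partial>M) * (\<integral>x. (v x)\<^sup>2 \<partial>M))"
    if "u \<in> borel_measurable M" "v \<in> borel_measurable M"
      and "integrable M (\<lambda>x. (u x)\<^sup>2)" "integrable M (\<lambda>x. (v x)\<^sup>2)" for u v :: "'a \<Rightarrow> real"
    using real_sqrt_le_mono[OF L2_cauchy_schwarz[OF that]] by simp
  have bound: "\<bar>(\<integral>x. f k x * g k x \<partial>M) - (\<integral>x. F x * G x \<partial>M)\<bar> \<le> sqrt (a k * b k) + sqrt (a k * nG) + sqrt (nF * b k)" for k
  proof -
    have fF: "integrable M (\<lambda>x. (f k x - F x)\<^sup>2)" by (intro diff2 f2 F2) auto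
    have gG: "integrable M (\<lambda>x. (g k x - G x)\<^sup>2)" by (intro diff2 g2 G2) auto
    have i1: "integrable M (\<lambda>x. (f k x - F x) * (g k x - G x))" by (intro square_integrable_mult fF gG) auto
    have i2: "integrable M (\<lambda>x. (f k x - F x) * G x)" by (intro square_integrable_mult fF G2) auto
    have i3: "integrable M (\<lambda>x. F x * (g k x - G x))" by (intro square_integrable_mult F2 gG) auto
    have i4: "integrable M (\<lambda>x. F x * G x)" by (intro square_integrable_mult F2 G2) auto
    have "(\<integral>x. f k x * g k x \<partial>M) = (\<integral>x. (f k x - F x) * (g k x - G x) + (f k x - F x) * G x + F x * (g k x - G x) + F x * G x \<partial>M)"
      by (intro Bochner_Integration.integral_cong refl) (simp add: algebra_simps)
    also have "\<dots> = (\<integral>x. (f k x - F x) * (g k x - G x) \<partial>M) + (\<integral>x. (f k x - F x) * G x \<partial>M) + (\<integral>x. F x * (g k x - G x) \<partial>M) + (\<integral>x. F x * G x \<partial>M)"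
      by (simp only: Bochner_Integration.integral_add Bochner_Integration.integrable_add i1 i2 i3 i4)
    finally have eq: "(\<integral>x. f k x * g k x \<partial>M) - (\<integral>x. F x * G x \<partial>M) = (\<integral>x. (f k x - F x) * (g k x - G x) \<partial>M) + (\<integral>x. (f k x - F x) * G x \<partial>M) + (\<integral>x. F x * (g k x - G x) \<partial>M)"
      by simp
    have "\<bar>\<integral>x. (f k x - F x) * (g k x - G x) \<partial>M\<bar> \<le> sqrt (a k * b k)" unfolding a_def b_def by (intro cs fF gG) auto
    moreover have "\<bar>\<integral>x. (f k x - F x) * G x \<partial>M\<bar> \<le> sqrt (a k * nG)" unfolding a_def nG_def by (intro cs fF G2) auto
    moreover have "\<bar>\<integral>x. F x * (g k x - G x) \<partial>M\<bar> \<le> sqrt (nF * b k)" unfolding b_def nF_def by (intro cs F2 gG) auto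
    ultimately show ?thesis unfolding eq by linarith
  qed
  have "(\<lambda>k. sqrt (a k * b k) + sqrt (a k * nG) + sqrt (nF * b k)) \<longlonglongrightarrow> sqrt (0 * 0) + sqrt (0 * nG) + sqrt (nF * 0)"
    using f g unfolding a_def b_def by (intro tendsto_intros)
  then have lim: "(\<lambda>k. sqrt (a k * b k) + sqrt (a k * nG) + sqrt (nF * b k)) \<longlonglongrightarrow> 0" by simp
  have "\<forall>\<^sub>F k in sequentially. norm ((\<integral>x. f k x * g k x \<partial>M) - (\<integral>x. F x * G x \<partial>M)) \<le> sqrt (a k * b k) + sqrt (a k * nG) + sqrt (nF * b k)"
    unfolding real_norm_def by (intro always_eventually allI bound)
  from Lim_null_comparison[OF this lim]
  have "(\<lambda>k. (\<integral>x. f k x * g k x \<partial>M) - (\<integral>x. F x * G x \<partial>M)) \<longlonglongrightarrow> 0" .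
  then show ?thesis by (rule LIM_zero_cancel)
qed

section \<open>Exponential moments of Gaussian processes\<close>

text \<open>
  Completing the square: an exponential factor shifts the mean of a normal density.
\<close>

lemma exp_times_normal_density:
  assumes "0 < \<sigma>"
  shows "normal_density \<mu> \<sigma> x * exp x = exp (\<mu> + \<sigma>\<^sup>2 / 2) * normal_density (\<mu> + \<sigma>\<^sup>2) \<sigma> x"
proof -
  have "- (x - \<mu>)\<^sup>2 / (2 * \<sigma>\<^sup>2) + x = \<mu> + \<sigma>\<^sup>2 / 2 + - (x - (\<mu> + \<sigma>\<^sup>2))\<^sup>2 / (2 * \<sigma>\<^sup>2)"
    using assms by (simp add: power2_eq_square field_simps)
  then have "exp (- (x - \<mu>)\<^sup>2 / (2 * \<sigma>\<^sup>2)) * exp x = exp (\<mu> + \<sigma>\<^sup>2 / 2) * exp (- (x - (\<mu> + \<sigma>\<^sup>2))\<^sup>2 / (2 * \<sigma>\<^sup>2))"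
    unfolding exp_add[symmetric] by simp
  then show ?thesis unfolding normal_density_def by (simp add: mult_ac)
qed

context prob_space
begin

lemma gaussian_rv_moments:
  assumes "gaussian_rv M L"
  shows "integrable M L" "integrable M (\<lambda>\<omega>. (L \<omega>)\<^sup>2)"
    and "has_bochner_integral M (\<lambda>\<omega>. exp (L \<omega>)) (exp (expectation L + variance L / 2))"
proof -
  have [measurable]: "L \<in> borel_measurable M" using assms by (simp add: gaussian_rv_def)
  have "integrable M L \<and> integrable M (\<lambda>\<omega>. (L \<omega>)\<^sup>2) \<and>
    has_bochner_integral M (\<lambda>\<omega>. exp (L \<omega>)) (exp (expectation L + variance L / 2))"
    using assms unfolding gaussian_rv_def
  proof (elim conjE disjE exE)
    fix \<mu> assume AE: "AE \<omega> in M. L \<omega> = \<mu>"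
    have E: "expectation L = \<mu>"
      using integral_cong_AE[of L M "\<lambda>_. \<mu>"] AE by (simp add: prob_space)
    have "variance L = expectation (\<lambda>_. 0)" unfolding E by (rule integral_cong_AE) (use AE in auto)
    then have V: "variance L = 0" by simp
    have "integrable M L" by (subst integrable_cong_AE[where g="\<lambda>_. \<mu>"]) (use AE in auto)
    moreover have "integrable M (\<lambda>\<omega>. (L \<omega>)\<^sup>2)" by (subst integrable_cong_AE[where g="\<lambda>_. \<mu>\<^sup>2"]) (use AE in auto)
    moreover have "integrable M (\<lambda>\<omega>. exp (L \<omega>))" by (subst integrable_cong_AE[where g="\<lambda>_. exp \<mu>"]) (use AE in auto)
    moreover have "expectation (\<lambda>\<omega>. exp (L \<omega>)) = expectation (\<lambda>_. exp \<mu>)" by (rule integral_cong_AE) (use AE in auto)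
    ultimately show ?thesis by (simp add: has_bochner_integral_iff V[unfolded E] E prob_space)
  next
    fix \<mu> \<sigma> :: real assume \<sigma>: "0 < \<sigma>" and D: "distributed M lborel L (\<lambda>x. ennreal (normal_density \<mu> \<sigma> x))"
    have E: "expectation L = \<mu>" by (rule normal_distributed_expectation[OF \<sigma> D])
    have V: "variance L = \<sigma>\<^sup>2" by (rule normal_distributed_variance[OF \<sigma> D])
    note int = distributed_integrable[OF D, simplified] and eq = distributed_integral[OF D, simplified]
    have "integrable lborel (\<lambda>x. normal_density \<mu> \<sigma> x * x)" by (rule integrable_normal_moment_nz_1[OF \<sigma>])
    then have i1: "integrable M L" using int[of "\<lambda>x. x"] by simp
    have "integrable lborel (\<lambda>x. normal_density \<mu> \<sigma> x * x\<^sup>2)"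
    proof -
      have "normal_density \<mu> \<sigma> x * x\<^sup>2 = normal_density \<mu> \<sigma> x * (x - \<mu>)^2 + 2 * \<mu> * (normal_density \<mu> \<sigma> x * x) - \<mu>\<^sup>2 * normal_density \<mu> \<sigma> x" for x
        by (simp add: power2_eq_square algebra_simps)
      then show ?thesis
        using integrable_normal_moment[OF \<sigma>, of \<mu> 2] integrable_normal_moment_nz_1[OF \<sigma>, of \<mu>] \<sigma> by simp
    qed
    then have i2: "integrable M (\<lambda>\<omega>. (L \<omega>)\<^sup>2)" using int[of "\<lambda>x. x\<^sup>2"] by simp
    have "integrable lborel (\<lambda>x. normal_density \<mu> \<sigma> x * exp x)"
      unfolding exp_times_normal_density[OF \<sigma>] using \<sigma> by simp
    then have i3: "integrable M (\<lambda>\<omega>. exp (L \<omega>))" using int[of exp] by simp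
    have "expectation (\<lambda>\<omega>. exp (L \<omega>)) = (\<integral>x. normal_density \<mu> \<sigma> x * exp x \<partial>lborel)" using eq[of exp] by simp
    also have "\<dots> = exp (\<mu> + \<sigma>\<^sup>2 / 2)"
      unfolding exp_times_normal_density[OF \<sigma>] using \<sigma> by simp
    finally show ?thesis using i1 i2 i3 by (simp add: has_bochner_integral_iff E V[unfolded E])
  qed
  then show "integrable M L" "integrable M (\<lambda>\<omega>. (L \<omega>)\<^sup>2)"
    "has_bochner_integral M (\<lambda>\<omega>. exp (L \<omega>)) (exp (expectation L + variance L / 2))" by blast+
qed

end

text \<open>
  Coefficients of coinciding times are collected; the indices \<open>i\<close> need not have different times \<open>p i\<close>.
\<close>

lemma gaussian_process_lincomb:
  assumes X: "gaussian_process M I X" and A: "finite A" and p: "p ` A \<subseteq> I"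
  shows "gaussian_rv M (\<lambda>\<omega>. \<Sum>i\<in>A. c i * X (p i) \<omega>)"
proof -
  have "(\<Sum>i\<in>A. c i * X (p i) \<omega>) = (\<Sum>u\<in>p ` A. (\<Sum>i\<in>{i \<in> A. p i = u}. c i) * X u \<omega>)" for \<omega>
    unfolding sum.image_gen[OF A, of "\<lambda>i. c i * X (p i) \<omega>" p] sum_distrib_right
    by (intro sum.cong refl) auto
  moreover have "gaussian_rv M (\<lambda>\<omega>. \<Sum>u\<in>p ` A. (\<Sum>i\<in>{i \<in> A. p i = u}. c i) * X u \<omega>)"
  proof -
    have "finite (p ` A) \<and> p ` A \<subseteq> I" using A p by simp
    then show ?thesis
      using X[unfolded gaussian_process_def, THEN conjunct2, rule_format, of "p ` A" "\<lambda>u. \<Sum>i\<in>{i \<in> A. p i = u}. c i"] by simp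
  qed
  ultimately show ?thesis by (simp only:)
qed

text \<open>
  A centered combination of increments is Gaussian, so that its exponential moment is determined by its
  variance, and the variance by the covariance function.
\<close>

theorem gaussian_process_increment_mgf:
  fixes X :: "real \<Rightarrow> 'a \<Rightarrow> real" and p :: "real \<Rightarrow> real"
  assumes X: "gaussian_process M I X" and mean: "\<And>t. t \<in> I \<Longrightarrow> (\<integral>\<omega>. X t \<omega> \<partial>M) = \<mu> t"
    and cov: "\<And>s t. s \<in> I \<Longrightarrow> t \<in> I \<Longrightarrow> covariance M (X s) (X t) = k s t"
    and J: "finite J" "p ` J \<subseteq> I" and b: "b \<in> I"
  defines "Y \<equiv> \<lambda>t \<omega>. (X (p t) \<omega> - X b \<omega>) - (\<mu> (p t) - \<mu> b)"
  shows "has_bochner_integral M (\<lambda>\<omega>. exp (\<Sum>t\<in>J. c t * Y t \<omega>))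
    (exp ((\<Sum>t\<in>J. \<Sum>s\<in>J. c t * c s * (k (p t) (p s) - k (p t) b - k b (p s) + k b b)) / 2))"
proof -
  interpret prob_space M using X by (simp add: gaussian_process_def)
  have one: "gaussian_rv M (X t)" if "t \<in> I" for t
    using gaussian_process_lincomb[OF X, of "{0::nat}" "\<lambda>_. t" "\<lambda>_. 1"] that by simp
  have [measurable]: "X t \<in> borel_measurable M" if "t \<in> I" for t using one[OF that] by (simp add: gaussian_rv_def)
  note int = gaussian_rv_moments(1)[OF one] and int2 = gaussian_rv_moments(2)[OF one]
  define V where "V t \<omega> = X t \<omega> - \<mu> t" for t \<omega>
  have V_meas: "V t \<in> borel_measurable M" if "t \<in> I" for t
    unfolding V_def[abs_def] using that by measurable
  have V0: "expectation (V t) = 0" and Vi: "integrable M (V t)" if "t \<in> I" for t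
    using that int[OF that] mean[OF that] by (simp_all add: V_def[abs_def] prob_space)
  have V2: "integrable M (\<lambda>\<omega>. (V t \<omega>)\<^sup>2)" if "t \<in> I" for t
    using int[OF that] int2[OF that] by (simp add: V_def[abs_def] power2_diff)
  have VV: "integrable M (\<lambda>\<omega>. V s \<omega> * V t \<omega>)" if "s \<in> I" "t \<in> I" for s t
    by (intro square_integrable_mult V_meas V2 that)
  have VVk: "expectation (\<lambda>\<omega>. V s \<omega> * V t \<omega>) = k s t" if "s \<in> I" "t \<in> I" for s t
    using cov[OF that] mean[OF that(1)] mean[OF that(2)] by (simp add: covariance_def V_def)
  have Y: "Y t \<omega> = V (p t) \<omega> - V b \<omega>" for t \<omega> by (simp add: Y_def V_def)
  have pI: "p t \<in> I" if "t \<in> J" for t using J that by auto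
  have YY: "has_bochner_integral M (\<lambda>\<omega>. Y t \<omega> * Y s \<omega>) (k (p t) (p s) - k (p t) b - k b (p s) + k b b)"
    if "t \<in> J" "s \<in> J" for s t
  proof -
    have "has_bochner_integral M (\<lambda>\<omega>. V (p t) \<omega> * V (p s) \<omega> - V (p t) \<omega> * V b \<omega> - V b \<omega> * V (p s) \<omega> + V b \<omega> * V b \<omega>)
      (k (p t) (p s) - k (p t) b - k b (p s) + k b b)"
      by (intro has_bochner_integral_add has_bochner_integral_diff)
        (auto simp: has_bochner_integral_iff VV VVk pI that b)
    then show ?thesis by (simp add: Y algebra_simps)
  qed
  define L where "L \<omega> = (\<Sum>t\<in>J. c t * (X (p t) \<omega> - X b \<omega>))" for \<omega>
  define \<nu> where "\<nu> = (\<Sum>t\<in>J. c t * (\<mu> (p t) - \<mu> b))"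
  have LY: "L \<omega> - \<nu> = (\<Sum>t\<in>J. c t * Y t \<omega>)" for \<omega>
    unfolding L_def \<nu>_def Y_def sum_subtractf[symmetric] by (intro sum.cong refl) (simp only: right_diff_distrib)
  have L: "gaussian_rv M L"
  proof -
    \<comment> \<open>each increment contributes two terms, at its endpoint and at the common base point\<close>
    have "gaussian_rv M (\<lambda>\<omega>. \<Sum>i\<in>J \<times> (UNIV :: bool set). (if snd i then c (fst i) else - c (fst i)) * X (if snd i then p (fst i) else b) \<omega>)"
      by (rule gaussian_process_lincomb[OF X]) (use J b in auto)
    moreover have "(\<Sum>i\<in>J \<times> (UNIV :: bool set). (if snd i then c (fst i) else - c (fst i)) * X (if snd i then p (fst i) else b) \<omega>) = L \<omega>" for \<omega>
      unfolding sum.cartesian_product' L_def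
      by (intro sum.cong refl) (simp add: UNIV_bool algebra_simps)
    ultimately show ?thesis by simp
  qed
  have E: "expectation L = \<nu>"
    unfolding L_def \<nu>_def using int pI b mean J by (simp add: Bochner_Integration.integral_sum)
  have "has_bochner_integral M (\<lambda>\<omega>. \<Sum>t\<in>J. \<Sum>s\<in>J. c t * c s * (Y t \<omega> * Y s \<omega>))
    (\<Sum>t\<in>J. \<Sum>s\<in>J. c t * c s * (k (p t) (p s) - k (p t) b - k b (p s) + k b b))"
    by (intro has_bochner_integral_sum has_bochner_integral_mult_right YY)
  moreover have "(\<Sum>t\<in>J. \<Sum>s\<in>J. c t * c s * (Y t \<omega> * Y s \<omega>)) = (L \<omega> - expectation L)\<^sup>2" for \<omega>
    unfolding E LY by (simp add: power2_eq_square sum_product mult_ac)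
  ultimately have Var: "variance L = (\<Sum>t\<in>J. \<Sum>s\<in>J. c t * c s * (k (p t) (p s) - k (p t) b - k b (p s) + k b b))"
    by (simp add: has_bochner_integral_iff)
  have "has_bochner_integral M (\<lambda>\<omega>. exp (L \<omega>) * exp (- \<nu>)) (exp (\<nu> + variance L / 2) * exp (- \<nu>))"
    using gaussian_rv_moments(3)[OF L] unfolding E by (rule has_bochner_integral_mult_left)
  moreover have "exp (L \<omega>) * exp (- \<nu>) = exp (\<Sum>t\<in>J. c t * Y t \<omega>)" for \<omega>
    unfolding LY[symmetric] exp_add[symmetric] by simp
  moreover have "exp (\<nu> + variance L / 2) * exp (- \<nu>) = exp (variance L / 2)"
    unfolding exp_add[symmetric] by simp
  ultimately show ?thesis unfolding Var by simp
qed

section \<open>The Wiener isometry\<close>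

context
  fixes M :: "'a measure" and B :: "real \<Rightarrow> 'a \<Rightarrow> real"
  assumes BM: "brownian_motion M B"
begin

interpretation prob_space M using BM by (simp add: brownian_motion_def)

lemma bm_measurable: "0 \<le> t \<Longrightarrow> B t \<in> borel_measurable M"
  using BM by (simp add: brownian_motion_def)

lemma bm_0: "AE \<omega> in M. B 0 \<omega> = 0"
  using BM by (simp add: brownian_motion_def)

lemma bm_increment_square:
  assumes "0 \<le> s" "s < t"
  shows "has_bochner_integral M (\<lambda>\<omega>. (B t \<omega> - B s \<omega>)\<^sup>2) (t - s)"
proof -
  define \<sigma> where "\<sigma> = sqrt (t - s)"
  have \<sigma>: "0 < \<sigma>" "\<sigma>\<^sup>2 = t - s" using assms by (simp_all add: \<sigma>_def)
  have D: "distributed M lborel (\<lambda>\<omega>. B t \<omega> - B s \<omega>) (\<lambda>x. ennreal (normal_density 0 \<sigma> x))"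
    using BM assms by (simp add: brownian_motion_def \<sigma>_def)
  have "integrable lborel (\<lambda>x. normal_density 0 \<sigma> x * x\<^sup>2)"
    using integrable_normal_moment[OF \<sigma>(1), of 0 2] by simp
  then have "integrable M (\<lambda>\<omega>. (B t \<omega> - B s \<omega>)\<^sup>2)"
    using distributed_integrable[OF D, of "\<lambda>x. x\<^sup>2"] by simp
  moreover have "expectation (\<lambda>\<omega>. (B t \<omega> - B s \<omega>)\<^sup>2) = t - s"
    using normal_distributed_variance[OF \<sigma>(1) D] normal_distributed_expectation[OF \<sigma>(1) D] \<sigma>(2) by simp
  ultimately show ?thesis by (simp add: has_bochner_integral_iff)
qed

lemma bm_square:
  assumes t: "0 \<le> t"
  shows "has_bochner_integral M (\<lambda>\<omega>. (B t \<omega>)\<^sup>2) t"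
proof (cases "t = 0")
  case True
  have "has_bochner_integral M (\<lambda>\<omega>. (B 0 \<omega>)\<^sup>2) (0::real) \<longleftrightarrow> has_bochner_integral M (\<lambda>\<omega>. 0 :: real) 0"
    by (rule has_bochner_integral_cong_AE) (use bm_0 bm_measurable[of 0] in \<open>auto\<close>)
  then show ?thesis using True by (simp add: has_bochner_integral_zero)
next
  case False
  have "has_bochner_integral M (\<lambda>\<omega>. (B t \<omega>)\<^sup>2) t \<longleftrightarrow> has_bochner_integral M (\<lambda>\<omega>. (B t \<omega> - B 0 \<omega>)\<^sup>2) t"
    by (rule has_bochner_integral_cong_AE) (use bm_0 bm_measurable[of 0] bm_measurable[OF t] in \<open>auto\<close>)
  then show ?thesis using bm_increment_square[of 0 t] False t by simp
qed

text \<open>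
  Polarization: the second moments of increments determine the covariance.
\<close>

lemma bm_covariance:
  assumes "0 \<le> s" "0 \<le> t"
  shows "has_bochner_integral M (\<lambda>\<omega>. B s \<omega> * B t \<omega>) (min s t)"
proof -
  have *: "has_bochner_integral M (\<lambda>\<omega>. B s \<omega> * B t \<omega>) s" if "0 \<le> s" "s < t" for s t
  proof -
    have "has_bochner_integral M (\<lambda>\<omega>. ((B s \<omega>)\<^sup>2 + (B t \<omega>)\<^sup>2 - (B t \<omega> - B s \<omega>)\<^sup>2) / 2) ((s + t - (t - s)) / 2)"
      by (intro has_bochner_integral_divide_zero has_bochner_integral_diff has_bochner_integral_add bm_square bm_increment_square)
        (use that in auto)
    moreover have "((B s \<omega>)\<^sup>2 + (B t \<omega>)\<^sup>2 - (B t \<omega> - B s \<omega>)\<^sup>2) / 2 = B s \<omega> * B t \<omega>" for \<omega>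
      by (simp add: power2_diff)
    ultimately show ?thesis by simp
  qed
  consider "s < t" | "s = t" | "t < s" by linarith
  then show ?thesis
  proof cases
    case 1 then show ?thesis using *[of s t] assms by simp
  next
    case 2 then show ?thesis using bm_square[OF assms(1)] by (simp add: power2_eq_square)
  next
    case 3 then show ?thesis using *[of t s] assms by (simp add: mult.commute)
  qed
qed

lemma indicator_product_integral:
  fixes a b c d T :: real
  assumes "0 \<le> a" "a \<le> b" "b \<le> T" "0 \<le> c" "c \<le> d" "d \<le> T"
  shows "has_bochner_integral lebesgue (\<lambda>u. indicator {0..T} u * (indicator {a<..b} u * indicator {c<..d} u) :: real)
    (min b d - min a d - min b c + min a c)"
proof -
  have "(\<lambda>u. indicator {0..T} u * (indicator {a<..b} u * indicator {c<..d} u) :: real) = indicator {max a c<..min b d}"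
    using assms by (auto simp: fun_eq_iff indicator_def)
  moreover have "measure lebesgue {max a c<..min b d} = min b d - min a d - min b c + min a c"
    using assms by (cases "max a c \<le> min b d") (auto simp: min_def max_def split: if_splits)
  moreover have "emeasure lebesgue {max a c<..min b d} < \<infinity>"
    by (cases "max a c \<le> min b d") auto
  ultimately show ?thesis
    using has_bochner_integral_real_indicator[of "{max a c<..min b d}" lebesgue] by simp
qed

text \<open>
  Both sides are bilinear and reduce to the inner product of two intervals, which is the
  covariance of the two increments.
\<close>

lemma step_isometry:
  assumes p: "0 \<le> p 0" "\<And>i. i < n \<Longrightarrow> p i \<le> p (Suc i)" "p n \<le> T"
    and q: "0 \<le> q 0" "\<And>i. i < m \<Longrightarrow> q i \<le> q (Suc i)" "q m \<le> T"
  shows "has_bochner_integral lebesgue (\<lambda>u. indicator {0..T} u * (step_fun n p c u * step_fun m q d u))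
      (expectation (\<lambda>\<omega>. step_integral B n p c \<omega> * step_integral B m q d \<omega>))"
    and "integrable M (\<lambda>\<omega>. step_integral B n p c \<omega> * step_integral B m q d \<omega>)"
proof -
  have mono: "0 \<le> r i \<and> r i \<le> r (Suc i) \<and> r (Suc i) \<le> T"
    if r: "0 \<le> r 0" "\<And>i. i < k \<Longrightarrow> r i \<le> r (Suc i)" "r k \<le> T" and i: "i < k" for r :: "nat \<Rightarrow> real" and k i
  proof -
    have le: "r a \<le> r b" if "a \<le> b" "b \<le> k" for a b
      using that
    proof (induction b rule: dec_induct)
      case (step b)
      then show ?case using r(2)[of b] by simp
    qed simp
    show ?thesis using le[of 0 i] le[of i "Suc i"] le[of "Suc i" k] r i by auto
  qed
  define e where "e i j = min (p (Suc i)) (q (Suc j)) - min (p i) (q (Suc j)) - min (p (Suc i)) (q j) + min (p i) (q j)" for i j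
  have "has_bochner_integral lebesgue (\<lambda>u. \<Sum>i<n. \<Sum>j<m. c i * d j * (indicator {0..T} u * (indicator {p i<..p (Suc i)} u * indicator {q j<..q (Suc j)} u)))
    (\<Sum>i<n. \<Sum>j<m. c i * d j * e i j)"
    unfolding e_def
    by (intro has_bochner_integral_sum has_bochner_integral_mult_right indicator_product_integral)
      (use mono[of p n] mono[of q m] p q in auto)
  moreover have "(\<Sum>i<n. \<Sum>j<m. c i * d j * (indicator {0..T} u * (indicator {p i<..p (Suc i)} u * indicator {q j<..q (Suc j)} u)))
    = indicator {0..T} u * (step_fun n p c u * step_fun m q d u)" for u
    unfolding step_fun_def sum_product unfolding sum_distrib_left by (intro sum.cong refl) (simp only: mult_ac)
  ultimately have L: "has_bochner_integral lebesgue (\<lambda>u. indicator {0..T} u * (step_fun n p c u * step_fun m q d u)) (\<Sum>i<n. \<Sum>j<m. c i * d j * e i j)"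
    by simp
  have inc: "has_bochner_integral M (\<lambda>\<omega>. (B (p (Suc i)) \<omega> - B (p i) \<omega>) * (B (q (Suc j)) \<omega> - B (q j) \<omega>)) (e i j)"
    if "i < n" "j < m" for i j
  proof -
    have nn: "0 \<le> p i" "0 \<le> p (Suc i)" "0 \<le> q j" "0 \<le> q (Suc j)"
    proof -
      have "0 \<le> p i \<and> p i \<le> p (Suc i) \<and> p (Suc i) \<le> T" by (rule mono[of p n]) (use p that in auto)
      moreover have "0 \<le> q j \<and> q j \<le> q (Suc j) \<and> q (Suc j) \<le> T" by (rule mono[of q m]) (use q that in auto)
      ultimately show "0 \<le> p i" "0 \<le> p (Suc i)" "0 \<le> q j" "0 \<le> q (Suc j)" by linarith+
    qed
    have "has_bochner_integral M (\<lambda>\<omega>. B (p (Suc i)) \<omega> * B (q (Suc j)) \<omega> - B (p i) \<omega> * B (q (Suc j)) \<omega> - B (p (Suc i)) \<omega> * B (q j) \<omega> + B (p i) \<omega> * B (q j) \<omega>) (e i j)"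
      unfolding e_def by (intro has_bochner_integral_add has_bochner_integral_diff bm_covariance nn)
    then show ?thesis by (simp add: algebra_simps)
  qed
  have "has_bochner_integral M (\<lambda>\<omega>. \<Sum>i<n. \<Sum>j<m. c i * d j * ((B (p (Suc i)) \<omega> - B (p i) \<omega>) * (B (q (Suc j)) \<omega> - B (q j) \<omega>)))
    (\<Sum>i<n. \<Sum>j<m. c i * d j * e i j)"
    by (intro has_bochner_integral_sum has_bochner_integral_mult_right inc) auto
  moreover have "(\<Sum>i<n. \<Sum>j<m. c i * d j * ((B (p (Suc i)) \<omega> - B (p i) \<omega>) * (B (q (Suc j)) \<omega> - B (q j) \<omega>)))
    = step_integral B n p c \<omega> * step_integral B m q d \<omega>" for \<omega>
    unfolding step_integral_def sum_product by (intro sum.cong refl) (simp only: mult_ac)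
  ultimately have R: "has_bochner_integral M (\<lambda>\<omega>. step_integral B n p c \<omega> * step_integral B m q d \<omega>) (\<Sum>i<n. \<Sum>j<m. c i * d j * e i j)"
    by simp
  show "has_bochner_integral lebesgue (\<lambda>u. indicator {0..T} u * (step_fun n p c u * step_fun m q d u))
      (expectation (\<lambda>\<omega>. step_integral B n p c \<omega> * step_integral B m q d \<omega>))"
    using L R by (simp add: has_bochner_integral_iff)
  show "integrable M (\<lambda>\<omega>. step_integral B n p c \<omega> * step_integral B m q d \<omega>)"
    using R by (simp add: has_bochner_integral_iff)
qed

lemma step_integral_measurable:
  assumes "0 \<le> p 0" "\<And>i. i < n \<Longrightarrow> p i \<le> p (Suc i)"
  shows "step_integral B n p c \<in> borel_measurable M"
proof -
  have nn: "0 \<le> p i" if "i \<le> n" for i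
    using that
  proof (induction i)
    case (Suc i)
    then show ?case using assms(2)[of i] by simp
  qed (use assms in simp)
  show ?thesis
    unfolding step_integral_def[abs_def]
    by (intro borel_measurable_sum borel_measurable_times borel_measurable_const borel_measurable_diff bm_measurable nn) auto
qed

end

text \<open>
  Pass to the limit in the isometry for step functions, by continuity of both inner products.
\<close>

theorem wiener_isometry:
  assumes BM: "brownian_motion M B"
    and X: "is_wiener_integral M B T f X" and Y: "is_wiener_integral M B T g Y"
  shows "(\<integral>\<omega>. X \<omega> * Y \<omega> \<partial>M) = (LINT u:{0..T}|lebesgue. f u * g u)"
proof -
  interpret prob_space M using BM by (simp add: brownian_motion_def)
  have Xm: "X \<in> borel_measurable M" and X2: "integrable M (\<lambda>\<omega>. (X \<omega>)\<^sup>2)"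
    and Ym: "Y \<in> borel_measurable M" and Y2: "integrable M (\<lambda>\<omega>. (Y \<omega>)\<^sup>2)"
    using X Y by (auto simp: is_wiener_integral_def)
  from X obtain n p c where
    p: "\<And>k. 0 \<le> p k 0" "\<And>k i. i < n k \<Longrightarrow> p k i \<le> p k (Suc i)" "\<And>k. p k (n k) \<le> T"
    and f: "(\<lambda>k. LINT u:{0..T}|lebesgue. (step_fun (n k) (p k) (c k) u - f u)\<^sup>2) \<longlonglongrightarrow> 0"
    and fX: "(\<lambda>k. \<integral>\<omega>. (step_integral B (n k) (p k) (c k) \<omega> - X \<omega>)\<^sup>2 \<partial>M) \<longlonglongrightarrow> 0"
    unfolding is_wiener_integral_def by blast
  from Y obtain m q d where
    q: "\<And>k. 0 \<le> q k 0" "\<And>k i. i < m k \<Longrightarrow> q k i \<le> q k (Suc i)" "\<And>k. q k (m k) \<le> T"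
    and g: "(\<lambda>k. LINT u:{0..T}|lebesgue. (step_fun (m k) (q k) (d k) u - g u)\<^sup>2) \<longlonglongrightarrow> 0"
    and gY: "(\<lambda>k. \<integral>\<omega>. (step_integral B (m k) (q k) (d k) \<omega> - Y \<omega>)\<^sup>2 \<partial>M) \<longlonglongrightarrow> 0"
    unfolding is_wiener_integral_def by blast
  have iso: "has_bochner_integral lebesgue (\<lambda>u. indicator {0..T} u * (step_fun (n k) (p k) (c k) u * step_fun (m k) (q k) (d k) u))
      (expectation (\<lambda>\<omega>. step_integral B (n k) (p k) (c k) \<omega> * step_integral B (m k) (q k) (d k) \<omega>))" for k
    by (rule step_isometry(1)[OF BM]) (use p q in auto)
  have isop: "integrable lebesgue (\<lambda>u. indicator {0..T} u * (step_fun (n k) (p k) (c k) u)\<^sup>2)"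
    "integrable M (\<lambda>\<omega>. (step_integral B (n k) (p k) (c k) \<omega>)\<^sup>2)" for k
    using step_isometry[OF BM p(1)[of k] _ p(3) p(1)[of k] _ p(3), of "c k" "c k"] p(2)[of _ k]
    by (auto simp: has_bochner_integral_iff power2_eq_square)
  have isoq: "integrable lebesgue (\<lambda>u. indicator {0..T} u * (step_fun (m k) (q k) (d k) u)\<^sup>2)"
    "integrable M (\<lambda>\<omega>. (step_integral B (m k) (q k) (d k) \<omega>)\<^sup>2)" for k
    using step_isometry[OF BM q(1)[of k] _ q(3) q(1)[of k] _ q(3), of "d k" "d k"] q(2)[of _ k]
    by (auto simp: has_bochner_integral_iff power2_eq_square)
  have Xs: "step_integral B (n k) (p k) (c k) \<in> borel_measurable M" for k
    by (rule step_integral_measurable[OF BM]) (use p in auto)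
  have Ys: "step_integral B (m k) (q k) (d k) \<in> borel_measurable M" for k
    by (rule step_integral_measurable[OF BM]) (use q in auto)
  have ind2: "(indicator {0..T} u * x :: real)\<^sup>2 = indicator {0..T} u * x\<^sup>2" for u x
    by (simp add: indicator_def)
  have "(\<lambda>k. \<integral>\<omega>. step_integral B (n k) (p k) (c k) \<omega> * step_integral B (m k) (q k) (d k) \<omega> \<partial>M) \<longlonglongrightarrow> (\<integral>\<omega>. X \<omega> * Y \<omega> \<partial>M)"
    by (rule L2_product_tendsto[OF Xs Ys Xm Ym isop(2) isoq(2) X2 Y2 fX gY])
  moreover have "(\<lambda>k. \<integral>u. (indicator {0..T} u * step_fun (n k) (p k) (c k) u) * (indicator {0..T} u * step_fun (m k) (q k) (d k) u) \<partial>lebesgue)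
    \<longlonglongrightarrow> (\<integral>u. (indicator {0..T} u * f u) * (indicator {0..T} u * g u) \<partial>lebesgue)"
  proof (rule L2_product_tendsto)
    have sm: "(\<lambda>u. indicator {0..T} u * step_fun n p c u) \<in> borel_measurable lebesgue" for n p c
      unfolding step_fun_def[abs_def]
      by (intro measurable_completion borel_measurable_times borel_measurable_sum borel_measurable_indicator
          borel_measurable_const) auto
    show "(\<lambda>u. indicator {0..T} u * step_fun (n k) (p k) (c k) u) \<in> borel_measurable lebesgue"
      "(\<lambda>u. indicator {0..T} u * step_fun (m k) (q k) (d k) u) \<in> borel_measurable lebesgue" for k by (rule sm)+
    show "(\<lambda>u. indicator {0..T} u * f u) \<in> borel_measurable lebesgue" "(\<lambda>u. indicator {0..T} u * g u) \<in> borel_measurable lebesgue"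
      "integrable lebesgue (\<lambda>u. (indicator {0..T} u * f u)\<^sup>2)" "integrable lebesgue (\<lambda>u. (indicator {0..T} u * g u)\<^sup>2)"
      using X Y by (simp_all add: is_wiener_integral_def square_integrable_def set_borel_measurable_def set_integrable_def ind2)
    show "integrable lebesgue (\<lambda>u. (indicator {0..T} u * step_fun (n k) (p k) (c k) u)\<^sup>2)"
      "integrable lebesgue (\<lambda>u. (indicator {0..T} u * step_fun (m k) (q k) (d k) u)\<^sup>2)" for k
      unfolding ind2 by (rule isop(1) isoq(1))+
    show "(\<lambda>k. \<integral>u. (indicator {0..T} u * step_fun (n k) (p k) (c k) u - indicator {0..T} u * f u)\<^sup>2 \<partial>lebesgue) \<longlonglongrightarrow> 0"
      "(\<lambda>k. \<integral>u. (indicator {0..T} u * step_fun (m k) (q k) (d k) u - indicator {0..T} u * g u)\<^sup>2 \<partial>lebesgue) \<longlonglongrightarrow> 0"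
      using f g by (simp_all only: set_lebesgue_integral_def right_diff_distrib[symmetric] ind2 real_scaleR_def)
  qed
  moreover have "(\<integral>u. (indicator {0..T} u * step_fun (n k) (p k) (c k) u) * (indicator {0..T} u * step_fun (m k) (q k) (d k) u) \<partial>lebesgue)
    = (\<integral>\<omega>. step_integral B (n k) (p k) (c k) \<omega> * step_integral B (m k) (q k) (d k) \<omega> \<partial>M)" for k
  proof -
    have "(indicator {0..T} u * x) * (indicator {0..T} u * y) = indicator {0..T} u * (x * y)" for u x y :: real
      by (cases "u \<in> {0..T}") auto
    then show ?thesis using iso[of k] by (simp only: has_bochner_integral_iff)
  qed
  ultimately have "(\<integral>\<omega>. X \<omega> * Y \<omega> \<partial>M) = (\<integral>u. (indicator {0..T} u * f u) * (indicator {0..T} u * g u) \<partial>lebesgue)"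
    by (simp only: LIMSEQ_unique)
  also have "\<dots> = (LINT u:{0..T}|lebesgue. f u * g u)"
    unfolding set_lebesgue_integral_def by (intro Bochner_Integration.integral_cong refl) (simp add: indicator_def)
  finally show ?thesis .
qed

section \<open>The covariance of the conditioned process after the observation time\<close>

text \<open>
  On an interval of finite length, uniform convergence of square integrable functions is convergence in
  mean square. It also transfers measurability and square integrability to the limits.
\<close>

lemma uniform_limit_product_integral:
  fixes f g :: "real \<Rightarrow> real \<Rightarrow> real" and F G :: "real \<Rightarrow> real"
  assumes f: "\<And>\<epsilon>. 0 < \<epsilon> \<Longrightarrow> square_integrable {0..1} (f \<epsilon>)" and g: "\<And>\<epsilon>. 0 < \<epsilon> \<Longrightarrow> square_integrable {0..1} (g \<epsilon>)"
    and fF: "uniform_limit {0..1} f F (at_right 0)" and gG: "uniform_limit {0..1} g G (at_right 0)"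
  shows "((\<lambda>\<epsilon>. LINT x:{0..1}|lebesgue. f \<epsilon> x * g \<epsilon> x) \<longlongrightarrow> (LINT x:{0..1}|lebesgue. F x * G x)) (at_right 0)"
  unfolding tendsto_at_iff_sequentially
proof (intro allI impI)
  fix e :: "nat \<Rightarrow> real" assume e: "\<forall>i. e i \<in> {0<..} - {0}" "e \<longlonglongrightarrow> 0"
  define i where "i x = (indicator {0..1} x :: real)" for x :: real
  have e_lim: "filterlim e (at_right 0) sequentially"
  proof -
    have "e k \<in> {0<..} \<and> e k \<noteq> 0" for k using e(1)[rule_format, of k] by blast
    then show ?thesis unfolding filterlim_at using e(2) by simp
  qed
  have ii: "i x * (i x * y) = i x * y" "(i x * y)\<^sup>2 = i x * y\<^sup>2" for x y
    by (auto simp: i_def indicator_def)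
  have i_int: "integrable lebesgue i" unfolding i_def[abs_def] by (simp add: integrable_indicator_iff)
  have key: "(\<lambda>x. i x * F x) \<in> borel_measurable lebesgue \<and> integrable lebesgue (\<lambda>x. (i x * F x)\<^sup>2) \<and>
      (\<lambda>k. \<integral>x. (i x * f (e k) x - i x * F x)\<^sup>2 \<partial>lebesgue) \<longlonglongrightarrow> 0"
    if f: "\<And>\<epsilon>. 0 < \<epsilon> \<Longrightarrow> square_integrable {0..1} (f \<epsilon>)" and fF: "uniform_limit {0..1} f F (at_right 0)"
    for f and F :: "real \<Rightarrow> real"
  proof -
    have fm: "(\<lambda>x. i x * f (e k) x) \<in> borel_measurable lebesgue" and f2: "integrable lebesgue (\<lambda>x. (i x * f (e k) x)\<^sup>2)" for k
      using f[of "e k"] e(1) by (simp_all add: ii square_integrable_def set_borel_measurable_def set_integrable_def i_def[symmetric])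
    have unif: "\<forall>\<^sub>F k in sequentially. \<forall>x\<in>{0..1}. dist (f (e k) x) (F x) < d" if "0 < d" for d
      using e_lim uniform_limitD[OF fF that] by (rule eventually_compose_filterlim[rotated])
    have Fm: "(\<lambda>x. i x * F x) \<in> borel_measurable lebesgue"
    proof (rule borel_measurable_LIMSEQ_real[OF _ fm])
      fix x
      show "(\<lambda>k. i x * f (e k) x) \<longlonglongrightarrow> i x * F x"
      proof (cases "x \<in> {0..1}")
        case True
        have "(\<lambda>k. f (e k) x) \<longlonglongrightarrow> F x"
        proof (rule tendstoI)
          fix d :: real assume "0 < d"
          from unif[OF this] show "\<forall>\<^sub>F k in sequentially. dist (f (e k) x) (F x) < d"
            by eventually_elim (use True in blast)
        qed
        then show ?thesis by (intro tendsto_intros)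
      qed (simp add: i_def)
    qed
    have sq: "(i x * f (e k) x - i x * F x)\<^sup>2 \<le> d\<^sup>2 * i x"
      if "0 < d" "\<forall>x\<in>{0..1}. dist (f (e k) x) (F x) < d" for k d x
    proof (cases "x \<in> {0..1}")
      case True
      then have "\<bar>f (e k) x - F x\<bar> \<le> d" using that by (auto simp: dist_real_def less_imp_le)
      then have "\<bar>f (e k) x - F x\<bar>\<^sup>2 \<le> d\<^sup>2" by (rule power_mono) simp
      then show ?thesis using True by (simp add: i_def)
    qed (simp add: i_def)
    have F2: "integrable lebesgue (\<lambda>x. (i x * F x)\<^sup>2)"
    proof -
      from unif[of 1] obtain k where k: "\<forall>x\<in>{0..1}. dist (f (e k) x) (F x) < 1"
        by (auto simp: eventually_sequentially)
      show ?thesis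
      proof (rule Bochner_Integration.integrable_bound)
        show "integrable lebesgue (\<lambda>x. 2 * (i x * f (e k) x)\<^sup>2 + 2 * i x)"
          using f2[of k] i_int by simp
        have "(i x * F x)\<^sup>2 \<le> 2 * (i x * f (e k) x)\<^sup>2 + 2 * i x" for x
        proof -
          define p q where "p = i x * f (e k) x" and "q = i x * F x"
          have "(p - q)\<^sup>2 \<le> i x" using sq[OF _ k, of x] by (simp add: p_def q_def)
          moreover have "0 \<le> (2 * p - q)\<^sup>2" by simp
          moreover have "(2 * p - q)\<^sup>2 = 2 * p\<^sup>2 + 2 * (p - q)\<^sup>2 - q\<^sup>2" by (simp add: power2_eq_square algebra_simps)
          ultimately show ?thesis unfolding p_def[symmetric] q_def[symmetric] by linarith
        qed
        then show "AE x in lebesgue. norm ((i x * F x)\<^sup>2) \<le> norm (2 * (i x * f (e k) x)\<^sup>2 + 2 * i x)"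
          by (intro AE_I2) (simp add: abs_le_iff order_trans[OF _ abs_ge_self])
      qed (use Fm in measurable)
    qed
    have "(\<lambda>k. \<integral>x. (i x * f (e k) x - i x * F x)\<^sup>2 \<partial>lebesgue) \<longlonglongrightarrow> 0"
    proof (rule tendstoI)
      fix r :: real assume r: "0 < r"
      define d where "d = sqrt (r / 2)"
      have d: "0 < d" "d\<^sup>2 = r / 2" using r by (simp_all add: d_def)
      from unif[OF d(1)] show "\<forall>\<^sub>F k in sequentially. dist (\<integral>x. (i x * f (e k) x - i x * F x)\<^sup>2 \<partial>lebesgue) 0 < r"
      proof eventually_elim
        case (elim k)
        have "(\<integral>x. (i x * f (e k) x - i x * F x)\<^sup>2 \<partial>lebesgue) \<le> (\<integral>x. d\<^sup>2 * i x \<partial>lebesgue)"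
        proof (rule integral_mono_AE')
          show "integrable lebesgue (\<lambda>x. d\<^sup>2 * i x)" using i_int by simp
          show "AE x in lebesgue. (i x * f (e k) x - i x * F x)\<^sup>2 \<le> d\<^sup>2 * i x" using sq[OF d(1) elim] by simp
          show "AE x in lebesgue. 0 \<le> d\<^sup>2 * i x" by (simp add: i_def)
        qed
        also have "\<dots> = d\<^sup>2" by (simp add: i_def[abs_def])
        also have "\<dots> < r" using d r by simp
        finally show ?case by (simp add: dist_real_def)
      qed
    qed
    with Fm F2 show ?thesis by blast
  qed
  note F = key[OF f fF] and G = key[OF g gG]
  have fm: "(\<lambda>x. i x * f (e k) x) \<in> borel_measurable lebesgue" and f2: "integrable lebesgue (\<lambda>x. (i x * f (e k) x)\<^sup>2)" for k
    using f[of "e k"] e(1) by (simp_all add: ii square_integrable_def set_borel_measurable_def set_integrable_def i_def[symmetric])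
  have gm: "(\<lambda>x. i x * g (e k) x) \<in> borel_measurable lebesgue" and g2: "integrable lebesgue (\<lambda>x. (i x * g (e k) x)\<^sup>2)" for k
    using g[of "e k"] e(1) by (simp_all add: ii square_integrable_def set_borel_measurable_def set_integrable_def i_def[symmetric])
  have "(\<lambda>k. \<integral>x. (i x * f (e k) x) * (i x * g (e k) x) \<partial>lebesgue) \<longlonglongrightarrow> (\<integral>x. (i x * F x) * (i x * G x) \<partial>lebesgue)"
    by (rule L2_product_tendsto[OF fm gm _ _ f2 g2]) (use F G in blast)+
  moreover have "(i x * y) * (i x * z) = i x *\<^sub>R (y * z)" for x y z by (simp add: i_def indicator_def)
  ultimately show "((\<lambda>\<epsilon>. LINT x:{0..1}|lebesgue. f \<epsilon> x * g \<epsilon> x) \<circ> e) \<longlonglongrightarrow> (LINT x:{0..1}|lebesgue. F x * G x)"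
    unfolding o_def set_lebesgue_integral_def i_def[symmetric] by (simp only:)
qed

text \<open>
  The left endpoint is a null set.
\<close>

lemma half_open_unit_integral:
  assumes "set_borel_measurable lebesgue {0..1} h"
  shows "(LINT x:{0<..1}|lebesgue. h x) = (LINT x:{0..1}|lebesgue. h (x::real) :: real)"
  unfolding set_lebesgue_integral_def
proof (rule integral_cong_AE)
  show m: "(\<lambda>x. indicator {0..1} x *\<^sub>R h x) \<in> borel_measurable lebesgue"
    using assms by (simp add: set_borel_measurable_def)
  have "(\<lambda>x. indicator {0<..1} x *\<^sub>R h x) = (\<lambda>x. indicator {0<..1} x * (indicator {0..1} x *\<^sub>R h x))"
    by (auto simp: fun_eq_iff indicator_def)
  also have "\<dots> \<in> borel_measurable lebesgue"
    by (intro borel_measurable_times borel_measurable_indicator m) auto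
  finally show "(\<lambda>x. indicator {0<..1} x *\<^sub>R h x) \<in> borel_measurable lebesgue" .
  have "AE x in lebesgue. x \<noteq> (0::real)"
    by (rule AE_I'[of "{0}"]) (auto simp: null_sets_def)
  then show "AE x in lebesgue. indicator {0<..1} x *\<^sub>R h x = indicator {0..1} x *\<^sub>R h x"
    by eventually_elim (auto simp: indicator_def)
qed

locale volterra_noise = prob_space M for M :: "'a measure" +
  fixes B :: "real \<Rightarrow> 'a \<Rightarrow> real" and K :: "real \<Rightarrow> real \<Rightarrow> real" and X :: "real \<Rightarrow> 'a \<Rightarrow> real"
    and \<alpha> \<alpha>' T :: real
  assumes volterra: "volterra_process M B K X" and T: "0 < T" and noise: "\<not> (\<alpha> = 0 \<and> \<alpha>' = 0)"
begin

text \<open>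
  The share of the signal in the variance of the observed noisy Brownian motion; \<open>noise_weight\<close> is the
  complementary share.
\<close>

definition signal_weight where "signal_weight = \<alpha>\<^sup>2 / (\<alpha>\<^sup>2 + \<alpha>'\<^sup>2)"

definition noise_weight where "noise_weight = \<alpha>'\<^sup>2 / (\<alpha>\<^sup>2 + \<alpha>'\<^sup>2)"

lemma weights: "0 \<le> signal_weight" "0 \<le> noise_weight" "1 - signal_weight = noise_weight" "noise_weight + signal_weight = 1"
    "\<alpha>\<^sup>2 * \<alpha>'\<^sup>2 / (\<alpha>\<^sup>2 + \<alpha>'\<^sup>2)\<^sup>2 = signal_weight * noise_weight"
proof -
  have "0 < \<alpha>\<^sup>2 + \<alpha>'\<^sup>2" using noise by (simp add: sum_power2_gt_zero_iff)
  then have "\<alpha>\<^sup>2 + \<alpha>'\<^sup>2 \<noteq> 0" by linarith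
  then show one: "noise_weight + signal_weight = 1"
    unfolding signal_weight_def noise_weight_def add_divide_distrib[symmetric] add.commute[of "\<alpha>'\<^sup>2"] by (rule divide_self)
  then show "1 - signal_weight = noise_weight" by simp
qed (simp_all add: signal_weight_def noise_weight_def power2_eq_square)

lemma kernel_zero: "0 \<le> u \<Longrightarrow> u < w \<Longrightarrow> K u w = 0"
  using volterra by (simp add: volterra_process_def)

lemma kernel_measurable: "0 < S \<Longrightarrow> u \<in> {0..S} \<Longrightarrow> set_borel_measurable lebesgue {0..S} (K u)"
  and kernel_square_integrable: "0 < S \<Longrightarrow> u \<in> {0..S} \<Longrightarrow> set_integrable lebesgue {0..S} (\<lambda>w. (K u w)\<^sup>2)"
  using volterra by (auto simp: volterra_process_def is_wiener_integral_def square_integrable_def)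

lemma kernel_product_integrable:
  assumes "0 < S" "u \<in> {0..S}" "v \<in> {0..S}"
  shows "set_integrable lebesgue {0..S} (\<lambda>w. K u w * K v w)"
proof -
  have sq: "(indicator {0..S} w * y)\<^sup>2 = indicator {0..S} w * y\<^sup>2" for w y :: real by (simp add: indicator_def)
  have "integrable lebesgue (\<lambda>w. (indicator {0..S} w * K u w) * (indicator {0..S} w * K v w))"
    using kernel_measurable[OF assms(1,2)] kernel_measurable[OF assms(1,3)]
      kernel_square_integrable[OF assms(1,2)] kernel_square_integrable[OF assms(1,3)]
    by (intro square_integrable_mult) (simp_all add: set_borel_measurable_def set_integrable_def sq)
  moreover have "(indicator {0..S} w * K u w) * (indicator {0..S} w * K v w) = indicator {0..S} w *\<^sub>R (K u w * K v w)" for w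
    by (simp add: indicator_def)
  ultimately show ?thesis by (simp add: set_integrable_def)
qed

lemma volterra_measurable: "0 \<le> u \<Longrightarrow> X u \<in> borel_measurable M"
  and volterra_square_integrable: "0 \<le> u \<Longrightarrow> integrable M (\<lambda>\<omega>. (X u \<omega>)\<^sup>2)"
proof -
  assume "0 \<le> u"
  then have "u \<in> {0..u + 1}" "0 < u + 1" by auto
  then have "is_wiener_integral M B (u + 1) (K u) (X u)" using volterra by (auto simp: volterra_process_def)
  then show "X u \<in> borel_measurable M" "integrable M (\<lambda>\<omega>. (X u \<omega>)\<^sup>2)" by (auto simp: is_wiener_integral_def)
qed

lemma volterra_mean: "0 \<le> u \<Longrightarrow> expectation (X u) = 0"
  using volterra by (simp add: volterra_process_def)

lemma volterra_integrable: "0 \<le> u \<Longrightarrow> integrable M (X u)"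
  using square_integrable_imp_integrable[OF volterra_measurable volterra_square_integrable] by blast

lemma volterra_product:
  assumes "0 < S" "u \<in> {0..S}" "v \<in> {0..S}"
  shows "has_bochner_integral M (\<lambda>\<omega>. X u \<omega> * X v \<omega>) (LINT w:{0..S}|lebesgue. K u w * K v w)"
proof -
  have BM: "brownian_motion M B" and w: "is_wiener_integral M B S (K u) (X u)" "is_wiener_integral M B S (K v) (X v)"
    using volterra assms by (auto simp: volterra_process_def)
  have "integrable M (\<lambda>\<omega>. X u \<omega> * X v \<omega>)"
    using assms by (intro square_integrable_mult volterra_measurable volterra_square_integrable) auto
  then show ?thesis using wiener_isometry[OF BM w] by (simp add: has_bochner_integral_iff)
qed

text \<open>
  The part of the Volterra covariance that comes from the Brownian motion after the observation time.
\<close>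

definition tail_form :: "real \<Rightarrow> real \<Rightarrow> real \<Rightarrow> real" where
  "tail_form S u v = (LINT w:{T<..S}|lebesgue. K u w * K v w)"

text \<open>
  On \<open>{0..T}\<close> the weights of the two integrals in \<open>Upsilon\<close> sum to
  \<open>noise_weight\<^sup>2 + signal_weight * noise_weight = noise_weight\<close>, and after \<open>T\<close> the weight is 1. A single horizon \<open>S\<close>
  replaces the limit \<open>min u v\<close> of integration because the kernel vanishes beyond this time.
\<close>

lemma Upsilon_after_T:
  assumes u: "u \<in> {T..S}" and v: "v \<in> {T..S}"
  shows "Upsilon \<alpha> \<alpha>' K T u v = noise_weight * (LINT w:{0..S}|lebesgue. K u w * K v w) + signal_weight * tail_form S u v"
proof -
  define P where "P w = K u w * K v w" for w
  have S: "0 < S" "u \<in> {0..S}" "v \<in> {0..S}" "T \<le> S" using T u v by auto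
  have iS: "set_integrable lebesgue {0..S} P" unfolding P_def[abs_def] by (rule kernel_product_integrable[OF S(1-3)])
  have i1: "integrable lebesgue (\<lambda>w. indicator {0..T} w * P w)"
    using set_integrable_subset[OF iS, of "{0..T}"] S by (auto simp: set_integrable_def)
  have i2: "integrable lebesgue (\<lambda>w. indicator {T<..S} w * P w)"
  proof -
    have "{T<..S} \<subseteq> {0..S}" using T by auto
    from set_integrable_subset[OF iS _ this] show ?thesis by (simp add: set_integrable_def)
  qed
  define I1 I2 where "I1 = (\<integral>w. indicator {0..T} w * P w \<partial>lebesgue)" and "I2 = (\<integral>w. indicator {T<..S} w * P w \<partial>lebesgue)"
  have "(\<integral>w. indicator {0..S} w * P w \<partial>lebesgue) = (\<integral>w. indicator {0..T} w * P w + indicator {T<..S} w * P w \<partial>lebesgue)"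
    by (intro Bochner_Integration.integral_cong refl) (use S T in \<open>auto simp: indicator_def\<close>)
  also have "\<dots> = I1 + I2" unfolding I1_def I2_def by (rule Bochner_Integration.integral_add[OF i1 i2])
  finally have IS: "(LINT w:{0..S}|lebesgue. K u w * K v w) = I1 + I2"
    by (simp add: set_lebesgue_integral_def P_def)
  have P0: "P w = 0" if "min u v < w" for w
    using that kernel_zero[of u w] kernel_zero[of v w] u v T unfolding P_def by (auto simp: min_def split: if_splits)
  have pt: "indicator {0..min u v} w * ((1 - signal_weight * indicator {0..T} w)\<^sup>2 * P w) = noise_weight\<^sup>2 * (indicator {0..T} w * P w) + indicator {T<..S} w * P w" for w
  proof -
    consider "w < 0" | "0 \<le> w" "w \<le> T" | "T < w" "w \<le> min u v" | "min u v < w" by linarith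
    then show ?thesis
    proof cases
      case 2
      then have "w \<in> {0..min u v}" "w \<in> {0..T}" "w \<notin> {T<..S}" using u v by auto
      then show ?thesis using weights(3) by simp
    next
      case 3
      then have "w \<in> {0..min u v}" "w \<notin> {0..T}" "w \<in> {T<..S}" using u v T by auto
      then show ?thesis by simp
    next
      case 1
      then have "w \<notin> {0..min u v}" "w \<notin> {0..T}" "w \<notin> {T<..S}" using T by auto
      then show ?thesis by simp
    qed (simp add: P0)
  qed
  have "(LINT w:{0..min u v}|lebesgue. (1 - \<alpha>\<^sup>2 / (\<alpha>\<^sup>2 + \<alpha>'\<^sup>2) * indicator {0..T} w)\<^sup>2 * (K u w * K v w)) = noise_weight\<^sup>2 * I1 + I2"
  proof -
    have "(LINT w:{0..min u v}|lebesgue. (1 - signal_weight * indicator {0..T} w)\<^sup>2 * P w)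
      = (\<integral>w. noise_weight\<^sup>2 * (indicator {0..T} w * P w) + indicator {T<..S} w * P w \<partial>lebesgue)"
      unfolding set_lebesgue_integral_def real_scaleR_def pt ..
    also have "\<dots> = noise_weight\<^sup>2 * I1 + I2"
      unfolding I1_def I2_def using i1 i2 by simp
    finally show ?thesis by (simp only: signal_weight_def P_def)
  qed
  then have "Upsilon \<alpha> \<alpha>' K T u v = noise_weight\<^sup>2 * I1 + I2 + signal_weight * noise_weight * I1"
    unfolding Upsilon_def weights(5) by (simp add: I1_def set_lebesgue_integral_def P_def)
  also have "\<dots> = noise_weight * ((noise_weight + signal_weight) * I1) + I2" by (simp add: power2_eq_square algebra_simps)
  also have "\<dots> = noise_weight * (I1 + I2) + signal_weight * I2"
  proof -
    have "noise_weight * I2 + signal_weight * I2 = I2" by (simp add: weights(4) flip: distrib_right)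
    then show ?thesis by (simp add: weights(4) distrib_left)
  qed
  also have "I2 = tail_form S u v" by (simp add: tail_form_def set_lebesgue_integral_def I2_def P_def)
  finally show ?thesis unfolding IS \<open>I2 = tail_form S u v\<close> .
qed

lemma tail_form_T: "tail_form S u T = 0" "tail_form S T u = 0"
proof -
  have "indicator {T<..S} w *\<^sub>R (K u w * K T w) = 0" "indicator {T<..S} w *\<^sub>R (K T w * K u w) = 0" for w
    using kernel_zero[of T w] T by (auto simp: indicator_def)
  then show "tail_form S u T = 0" "tail_form S T u = 0"
    unfolding tail_form_def set_lebesgue_integral_def by (simp_all only: integral_zero)
qed

text \<open>
  The covariance of the increments from \<open>T\<close> of the conditioned process.
\<close>

definition increment_cov :: "real \<Rightarrow> real \<Rightarrow> real" where
  "increment_cov u v = Upsilon \<alpha> \<alpha>' K T u v - Upsilon \<alpha> \<alpha>' K T u T - Upsilon \<alpha> \<alpha>' K T T v + Upsilon \<alpha> \<alpha>' K T T T"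

lemma covariance_increment:
  assumes u: "u \<in> {T..S}" and v: "v \<in> {T..S}"
  shows "covariance M (\<lambda>\<omega>. X u \<omega> - X T \<omega>) (\<lambda>\<omega>. X v \<omega> - X T \<omega>)
    = (LINT w:{0..S}|lebesgue. K u w * K v w) - (LINT w:{0..S}|lebesgue. K u w * K T w)
      - (LINT w:{0..S}|lebesgue. K T w * K v w) + (LINT w:{0..S}|lebesgue. K T w * K T w)"
proof -
  have S: "0 < S" "u \<in> {0..S}" "v \<in> {0..S}" "T \<in> {0..S}" using T u v by auto
  have mean: "expectation (\<lambda>\<omega>. X u \<omega> - X T \<omega>) = 0" "expectation (\<lambda>\<omega>. X v \<omega> - X T \<omega>) = 0"
    using S T volterra_integrable volterra_mean by auto
  have "has_bochner_integral M (\<lambda>\<omega>. X u \<omega> * X v \<omega> - X u \<omega> * X T \<omega> - X T \<omega> * X v \<omega> + X T \<omega> * X T \<omega>)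
    ((LINT w:{0..S}|lebesgue. K u w * K v w) - (LINT w:{0..S}|lebesgue. K u w * K T w)
      - (LINT w:{0..S}|lebesgue. K T w * K v w) + (LINT w:{0..S}|lebesgue. K T w * K T w))"
    by (intro has_bochner_integral_add has_bochner_integral_diff volterra_product S)
  moreover have "X u \<omega> * X v \<omega> - X u \<omega> * X T \<omega> - X T \<omega> * X v \<omega> + X T \<omega> * X T \<omega> = (X u \<omega> - X T \<omega>) * (X v \<omega> - X T \<omega>)" for \<omega>
    by (simp add: algebra_simps)
  ultimately show ?thesis unfolding covariance_def mean by (simp add: has_bochner_integral_iff)
qed

text \<open>
  The tail form does not see \<open>T\<close> itself, since \<open>K T\<close> vanishes after \<open>T\<close>; so only the multiple of the
  Volterra covariance turns into a covariance of increments.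
\<close>

lemma increment_cov_eq:
  assumes u: "u \<in> {T..S}" and v: "v \<in> {T..S}"
  shows "increment_cov u v = noise_weight * covariance M (\<lambda>\<omega>. X u \<omega> - X T \<omega>) (\<lambda>\<omega>. X v \<omega> - X T \<omega>) + signal_weight * tail_form S u v"
proof -
  have TS: "T \<in> {T..S}" using u by auto
  show ?thesis
    unfolding increment_cov_def covariance_increment[OF u v]
    by (simp only: Upsilon_after_T[OF u v] Upsilon_after_T[OF u TS] Upsilon_after_T[OF TS v] Upsilon_after_T[OF TS TS] tail_form_T)
      (simp add: algebra_simps)
qed

text \<open>
  Conditioning does not increase variances: the integral of \<open>(K u - K v)\<^sup>2\<close> after \<open>T\<close> is at most the
  integral over the whole past, and the two weights sum to 1.
\<close>

lemma increment_cov_variance_le: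
  assumes u: "u \<in> {T..S}" and v: "v \<in> {T..S}"
  shows "increment_cov u u - 2 * increment_cov u v + increment_cov v v \<le> variance (\<lambda>\<omega>. X u \<omega> - X v \<omega>)"
proof -
  have S: "0 < S" "u \<in> {0..S}" "v \<in> {0..S}" using T u v by auto
  have TS: "T \<in> {T..S}" using u by auto
  have Usym: "Upsilon \<alpha> \<alpha>' K T s t = Upsilon \<alpha> \<alpha>' K T t s" for s t
  proof -
    have "K s w * K t w = K t w * K s w" for w by (rule mult.commute)
    then show ?thesis unfolding Upsilon_def min.commute[of s t] by (simp only:)
  qed
  define E where "E s t = (LINT w:{0..S}|lebesgue. K s w * K t w)" for s t
  define V where "V = E u u - 2 * E u v + E v v"
  define W where "W = tail_form S u u - 2 * tail_form S u v + tail_form S v v"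
  have "increment_cov u u - 2 * increment_cov u v + increment_cov v v
      = Upsilon \<alpha> \<alpha>' K T u u - 2 * Upsilon \<alpha> \<alpha>' K T u v + Upsilon \<alpha> \<alpha>' K T v v"
    unfolding increment_cov_def by (simp add: Usym[of T u] Usym[of T v])
  also have "\<dots> = noise_weight * V + signal_weight * W"
    by (simp only: Upsilon_after_T[OF u v] Upsilon_after_T[OF u u] Upsilon_after_T[OF v v] V_def W_def E_def)
      (simp add: algebra_simps)
  finally have eq: "increment_cov u u - 2 * increment_cov u v + increment_cov v v = noise_weight * V + signal_weight * W" .
  have iS: "integrable lebesgue (\<lambda>w. indicator {0..S} w * (K s w * K t w))" if "s \<in> {0..S}" "t \<in> {0..S}" for s t
    using kernel_product_integrable[OF S(1) that] by (simp add: set_integrable_def)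
  have iT: "integrable lebesgue (\<lambda>w. indicator {T<..S} w * (K s w * K t w))" if "s \<in> {0..S}" "t \<in> {0..S}" for s t
  proof -
    have "{T<..S} \<subseteq> {0..S}" using T by auto
    from set_integrable_subset[OF kernel_product_integrable[OF S(1) that] _ this] show ?thesis
      by (simp add: set_integrable_def)
  qed
  have V: "has_bochner_integral lebesgue (\<lambda>w. indicator {0..S} w * (K u w - K v w)\<^sup>2) V"
  proof -
    have "has_bochner_integral lebesgue (\<lambda>w. indicator {0..S} w * (K u w * K u w) - 2 * (indicator {0..S} w * (K u w * K v w)) + indicator {0..S} w * (K v w * K v w)) V"
      unfolding V_def E_def set_lebesgue_integral_def real_scaleR_def
      by (intro has_bochner_integral_add has_bochner_integral_diff has_bochner_integral_mult_right has_bochner_integral_integrable iS S)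
    then show ?thesis by (simp add: power2_eq_square algebra_simps)
  qed
  have W: "has_bochner_integral lebesgue (\<lambda>w. indicator {T<..S} w * (K u w - K v w)\<^sup>2) W"
  proof -
    have "has_bochner_integral lebesgue (\<lambda>w. indicator {T<..S} w * (K u w * K u w) - 2 * (indicator {T<..S} w * (K u w * K v w)) + indicator {T<..S} w * (K v w * K v w)) W"
      unfolding W_def tail_form_def set_lebesgue_integral_def real_scaleR_def
      by (intro has_bochner_integral_add has_bochner_integral_diff has_bochner_integral_mult_right has_bochner_integral_integrable iT S)
    then show ?thesis by (simp add: power2_eq_square algebra_simps)
  qed
  have "W \<le> V"
  proof -
    have "indicator {T<..S} w * (K u w - K v w)\<^sup>2 \<le> indicator {0..S} w * (K u w - K v w)\<^sup>2" for w
      using T by (auto simp: indicator_def)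
    with integral_mono[of lebesgue "\<lambda>w. indicator {T<..S} w * (K u w - K v w)\<^sup>2" "\<lambda>w. indicator {0..S} w * (K u w - K v w)\<^sup>2"] V W
    show ?thesis by (simp only: has_bochner_integral_iff)
  qed
  then have "noise_weight * V + signal_weight * W \<le> noise_weight * V + signal_weight * V"
    using weights by (intro add_left_mono mult_left_mono) auto
  also have "\<dots> = V" by (simp add: weights(4) flip: distrib_right)
  also have "V = variance (\<lambda>\<omega>. X u \<omega> - X v \<omega>)"
  proof -
    have mean: "expectation (\<lambda>\<omega>. X u \<omega> - X v \<omega>) = 0"
      using S volterra_integrable volterra_mean by auto
    have "has_bochner_integral M (\<lambda>\<omega>. X u \<omega> * X u \<omega> - 2 * (X u \<omega> * X v \<omega>) + X v \<omega> * X v \<omega>) V"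
      unfolding V_def E_def by (intro has_bochner_integral_add has_bochner_integral_diff has_bochner_integral_mult_right volterra_product S)
    moreover have "X u \<omega> * X u \<omega> - 2 * (X u \<omega> * X v \<omega>) + X v \<omega> * X v \<omega> = (X u \<omega> - X v \<omega>)\<^sup>2" for \<omega>
      by (simp add: power2_eq_square algebra_simps)
    ultimately show ?thesis unfolding mean by (simp add: has_bochner_integral_iff)
  qed
  finally show ?thesis unfolding eq .
qed

text \<open>
  On an interval of finite length, square integrability implies integrability, and the affine substitution
  preserves integrability and hence measurability.
\<close>

lemma rescaled_kernel_square_integrable:
  assumes \<epsilon>: "0 < \<epsilon>" and t: "t \<in> {0..1}"
  shows "square_integrable {0..1} (\<lambda>x. r * K (T + \<epsilon> * t) (T + \<epsilon> * x))"
proof -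
  define S where "S = T + \<epsilon>"
  have S: "0 < S" "T + \<epsilon> * t \<in> {0..S}" using \<epsilon> t T by (auto simp: S_def mult_left_le)
  define k where "k w = indicator {T..S} w * K (T + \<epsilon> * t) w" for w
  have kk: "k w = indicator {T..S} w * (indicator {0..S} w * K (T + \<epsilon> * t) w)" for w
    using T by (auto simp: k_def indicator_def)
  have km: "k \<in> borel_measurable lebesgue"
  proof -
    have "(\<lambda>w. indicator {0..S} w * K (T + \<epsilon> * t) w) \<in> borel_measurable lebesgue"
      using kernel_measurable[OF S] by (simp add: set_borel_measurable_def)
    from borel_measurable_times[OF borel_measurable_indicator this, of "{T..S}"] show ?thesis
      unfolding kk[abs_def] by simp
  qed
  have k2: "integrable lebesgue (\<lambda>w. (k w)\<^sup>2)"
  proof -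
    have "set_integrable lebesgue {T..S} (\<lambda>w. (K (T + \<epsilon> * t) w)\<^sup>2)"
      by (rule set_integrable_subset[OF kernel_square_integrable[OF S]]) (use T in auto)
    moreover have "(k w)\<^sup>2 = indicator {T..S} w *\<^sub>R (K (T + \<epsilon> * t) w)\<^sup>2" for w by (simp add: k_def indicator_def)
    ultimately show ?thesis by (simp add: set_integrable_def)
  qed
  have k1: "integrable lebesgue k"
  proof (rule Bochner_Integration.integrable_bound)
    show "integrable lebesgue (\<lambda>w. (k w)\<^sup>2 + indicator {T..S} w)"
    proof (rule Bochner_Integration.integrable_add[OF k2])
      show "integrable lebesgue (indicator {T..S} :: real \<Rightarrow> real)"
        using \<epsilon> by (intro integrable_real_indicator) (auto simp: S_def)
    qed
    have "\<bar>y\<bar> \<le> y\<^sup>2 + 1" for y :: real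
    proof -
      have "0 \<le> (\<bar>y\<bar> - 1)\<^sup>2" by simp
      then have "2 * \<bar>y\<bar> \<le> y\<^sup>2 + 1" by (simp add: power2_diff)
      then show ?thesis using abs_ge_zero[of y] by linarith
    qed
    then show "AE w in lebesgue. norm (k w) \<le> norm ((k w)\<^sup>2 + indicator {T..S} w)"
      by (intro AE_I2) (auto simp: k_def indicator_def)
  qed (rule km)
  have ind: "indicator {T..S} (T + \<epsilon> * x) = (indicator {0..1} x :: real)" for x
    using \<epsilon> by (auto simp: indicator_def S_def zero_le_mult_iff mult_le_cancel_left1)
  have "integrable lebesgue (\<lambda>x. k (T + \<epsilon> * x))"
    using k1 \<epsilon> by (intro lebesgue_integrable_real_affine) auto
  then have "integrable lebesgue (\<lambda>x. r * k (T + \<epsilon> * x))" by simp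
  then have m: "(\<lambda>x. r * k (T + \<epsilon> * x)) \<in> borel_measurable lebesgue" by (rule borel_measurable_integrable)
  have "integrable lebesgue (\<lambda>x. (k (T + \<epsilon> * x))\<^sup>2)"
    using lebesgue_integrable_real_affine[OF k2, of \<epsilon> T] \<epsilon> by simp
  then have i: "integrable lebesgue (\<lambda>x. r\<^sup>2 * (k (T + \<epsilon> * x))\<^sup>2)" by simp
  have e1: "r * k (T + \<epsilon> * x) = indicator {0..1} x *\<^sub>R (r * K (T + \<epsilon> * t) (T + \<epsilon> * x))" for x
    by (simp add: k_def ind)
  have e2: "r\<^sup>2 * (k (T + \<epsilon> * x))\<^sup>2 = indicator {0..1} x *\<^sub>R (r * K (T + \<epsilon> * t) (T + \<epsilon> * x))\<^sup>2" for x
    by (simp add: k_def ind power_mult_distrib) (simp add: indicator_def)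
  show ?thesis
    using m i unfolding e1 e2 square_integrable_def set_borel_measurable_def set_integrable_def by blast
qed

text \<open>
  The substitution \<open>w = T + \<epsilon> * x\<close> has the factor \<open>\<epsilon>\<close>, one square root of which goes to each kernel.
\<close>

lemma tail_form_rescaled:
  assumes \<epsilon>: "0 < \<epsilon>" and t: "t \<in> {0..1}" and s: "s \<in> {0..1}" and g: "0 < g"
  shows "tail_form (T + \<epsilon>) (T + \<epsilon> * t) (T + \<epsilon> * s) / g\<^sup>2
    = (LINT x:{0..1}|lebesgue. (sqrt \<epsilon> * (K (T + \<epsilon> * t) (T + \<epsilon> * x) / g)) * (sqrt \<epsilon> * (K (T + \<epsilon> * s) (T + \<epsilon> * x) / g)))"
proof -
  define k where "k t x = K (T + \<epsilon> * t) (T + \<epsilon> * x)" for t x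
  have ind: "indicator {T<..T + \<epsilon>} (T + \<epsilon> * x) = (indicator {0<..1} x :: real)" for x
    using \<epsilon> by (auto simp: indicator_def zero_less_mult_iff mult_le_cancel_left1)
  have sq: "square_integrable {0..1} (k t)" if "t \<in> {0..1}" for t
    using rescaled_kernel_square_integrable[OF \<epsilon> that, of 1] by (simp add: k_def[abs_def])
  have meas: "set_borel_measurable lebesgue {0..1} (\<lambda>x. k t x * k s x)"
  proof -
    have "(\<lambda>x. (indicator {0..1} x *\<^sub>R k t x) * (indicator {0..1} x *\<^sub>R k s x)) \<in> borel_measurable lebesgue"
      using sq[OF t] sq[OF s] by (intro borel_measurable_times) (auto simp: square_integrable_def set_borel_measurable_def)
    moreover have "(indicator {0..1} x *\<^sub>R k t x) * (indicator {0..1} x *\<^sub>R k s x) = indicator {0..1} x *\<^sub>R (k t x * k s x)" for x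
      by (simp add: indicator_def)
    ultimately show ?thesis unfolding set_borel_measurable_def by (simp only:)
  qed
  have "tail_form (T + \<epsilon>) (T + \<epsilon> * t) (T + \<epsilon> * s) = \<epsilon> * (LINT x:{0<..1}|lebesgue. k t x * k s x)"
    unfolding tail_form_def set_lebesgue_integral_def
    using lebesgue_integral_real_affine[of \<epsilon> "\<lambda>w. indicator {T<..T + \<epsilon>} w *\<^sub>R (K (T + \<epsilon> * t) w * K (T + \<epsilon> * s) w)" T] \<epsilon>
    by (simp add: ind k_def)
  also have "\<dots> = \<epsilon> * (LINT x:{0..1}|lebesgue. k t x * k s x)"
    by (simp only: half_open_unit_integral[OF meas])
  also have "\<dots> / g\<^sup>2 = (LINT x:{0..1}|lebesgue. (\<epsilon> / g\<^sup>2) * (k t x * k s x))"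
    by simp
  also have "(\<lambda>x. (\<epsilon> / g\<^sup>2) * (k t x * k s x)) = (\<lambda>x. (sqrt \<epsilon> * (k t x / g)) * (sqrt \<epsilon> * (k s x / g)))"
  proof
    fix x
    have "(sqrt \<epsilon> * (k t x / g)) * (sqrt \<epsilon> * (k s x / g)) = (sqrt \<epsilon> * sqrt \<epsilon>) / g\<^sup>2 * (k t x * k s x)"
      by (simp add: power2_eq_square)
    then show "(\<epsilon> / g\<^sup>2) * (k t x * k s x) = (sqrt \<epsilon> * (k t x / g)) * (sqrt \<epsilon> * (k s x / g))"
      using \<epsilon> by simp
  qed
  finally show ?thesis by (simp only: k_def)
qed

text \<open>
  The uniform limit \<open>Kbar\<close> vanishes above the diagonal as the rescaled kernels do, so that integrals over
  the unit interval are integrals up to \<open>min t s\<close>.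
\<close>

lemma increment_cov_tendsto:
  assumes \<gamma>: "\<And>\<epsilon>. 0 < \<epsilon> \<Longrightarrow> 0 < \<gamma> \<epsilon>" and t: "t \<in> {0..1}" and s: "s \<in> {0..1}"
    and kbar: "((\<lambda>\<epsilon>. covariance M (\<lambda>\<omega>. X (T + \<epsilon> * t) \<omega> - X T \<omega>) (\<lambda>\<omega>. X (T + \<epsilon> * s) \<omega> - X T \<omega>) / (\<gamma> \<epsilon>)\<^sup>2)
      \<longlongrightarrow> kbar t s) (at_right 0)"
    and Kbar: "uniform_limit ({0..1} \<times> {0..1}) (\<lambda>\<epsilon> (t, s). sqrt \<epsilon> * (K (T + \<epsilon> * t) (T + \<epsilon> * s) / \<gamma> \<epsilon>))
             (\<lambda>(t, s). Kbar t s) (at_right 0)"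
  shows "((\<lambda>\<epsilon>. increment_cov (T + \<epsilon> * t) (T + \<epsilon> * s) / (\<gamma> \<epsilon>)\<^sup>2) \<longlongrightarrow> Upsilon_bar \<alpha> \<alpha>' Kbar kbar t s) (at_right 0)"
proof -
  define f where "f t \<epsilon> x = sqrt \<epsilon> * (K (T + \<epsilon> * t) (T + \<epsilon> * x) / \<gamma> \<epsilon>)" for t \<epsilon> x
  have pos: "\<forall>\<^sub>F \<epsilon> in at_right (0::real). 0 < \<epsilon>" by (simp add: eventually_at_right_less)
  have unif: "uniform_limit {0..1} (f t) (Kbar t) (at_right 0)" if t: "t \<in> {0..1}" for t
  proof (rule uniform_limitI)
    fix e :: real assume "0 < e"
    from uniform_limitD[OF Kbar this] show "\<forall>\<^sub>F \<epsilon> in at_right 0. \<forall>x\<in>{0..1}. dist (f t \<epsilon> x) (Kbar t x) < e"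
      by eventually_elim (use t in \<open>auto simp: f_def\<close>)
  qed
  have sq: "square_integrable {0..1} (f t \<epsilon>)" if "t \<in> {0..1}" "0 < \<epsilon>" for t \<epsilon>
    using rescaled_kernel_square_integrable[OF that(2,1), of "sqrt \<epsilon> / \<gamma> \<epsilon>"] by (simp add: f_def[abs_def])
  have Kbar0: "Kbar t x = 0" if t: "t \<in> {0..1}" and x: "x \<in> {0..1}" "t < x" for t x
  proof -
    have "((\<lambda>\<epsilon>. f t \<epsilon> x) \<longlongrightarrow> Kbar t x) (at_right 0)"
      by (rule tendsto_uniform_limitI[OF unif[OF t] x(1)])
    moreover have "\<forall>\<^sub>F \<epsilon> in at_right 0. f t \<epsilon> x = 0"
      using pos
    proof eventually_elim
      case (elim \<epsilon>)
      have "K (T + \<epsilon> * t) (T + \<epsilon> * x) = 0" using elim t x T by (intro kernel_zero) auto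
      then show ?case by (simp add: f_def)
    qed
    then have "((\<lambda>\<epsilon>. f t \<epsilon> x) \<longlongrightarrow> 0) (at_right 0)" by (rule tendsto_eventually)
    ultimately show ?thesis by (intro tendsto_unique[of "at_right 0"]) auto
  qed
  have "((\<lambda>\<epsilon>. LINT x:{0..1}|lebesgue. f t \<epsilon> x * f s \<epsilon> x) \<longlongrightarrow> (LINT x:{0..1}|lebesgue. Kbar t x * Kbar s x)) (at_right 0)"
    by (intro uniform_limit_product_integral sq unif t s)
  moreover have "(LINT x:{0..1}|lebesgue. Kbar t x * Kbar s x) = (LINT x:{0..min t s}|lebesgue. Kbar t x * Kbar s x)"
    unfolding set_lebesgue_integral_def
  proof (intro Bochner_Integration.integral_cong refl)
    fix x
    show "indicator {0..1} x *\<^sub>R (Kbar t x * Kbar s x) = indicator {0..min t s} x *\<^sub>R (Kbar t x * Kbar s x)"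
      using Kbar0[OF t, of x] Kbar0[OF s, of x] t s by (cases "x \<in> {0..1}"; cases "t < x"; cases "s < x") (auto simp: indicator_def)
  qed
  ultimately have lim: "((\<lambda>\<epsilon>. noise_weight * (covariance M (\<lambda>\<omega>. X (T + \<epsilon> * t) \<omega> - X T \<omega>) (\<lambda>\<omega>. X (T + \<epsilon> * s) \<omega> - X T \<omega>) / (\<gamma> \<epsilon>)\<^sup>2)
      + signal_weight * (LINT x:{0..1}|lebesgue. f t \<epsilon> x * f s \<epsilon> x)) \<longlongrightarrow> noise_weight * kbar t s + signal_weight * (LINT x:{0..min t s}|lebesgue. Kbar t x * Kbar s x)) (at_right 0)"
    by (intro tendsto_intros kbar) simp
  have "\<forall>\<^sub>F \<epsilon> in at_right 0. noise_weight * (covariance M (\<lambda>\<omega>. X (T + \<epsilon> * t) \<omega> - X T \<omega>) (\<lambda>\<omega>. X (T + \<epsilon> * s) \<omega> - X T \<omega>) / (\<gamma> \<epsilon>)\<^sup>2)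
      + signal_weight * (LINT x:{0..1}|lebesgue. f t \<epsilon> x * f s \<epsilon> x) = increment_cov (T + \<epsilon> * t) (T + \<epsilon> * s) / (\<gamma> \<epsilon>)\<^sup>2"
    using pos
  proof eventually_elim
    case (elim \<epsilon>)
    have "T + \<epsilon> * t \<in> {T..T + \<epsilon>}" "T + \<epsilon> * s \<in> {T..T + \<epsilon>}" using elim t s by (auto simp: mult_left_le)
    from increment_cov_eq[OF this]
    have "increment_cov (T + \<epsilon> * t) (T + \<epsilon> * s) / (\<gamma> \<epsilon>)\<^sup>2
      = noise_weight * (covariance M (\<lambda>\<omega>. X (T + \<epsilon> * t) \<omega> - X T \<omega>) (\<lambda>\<omega>. X (T + \<epsilon> * s) \<omega> - X T \<omega>) / (\<gamma> \<epsilon>)\<^sup>2)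
        + signal_weight * (tail_form (T + \<epsilon>) (T + \<epsilon> * t) (T + \<epsilon> * s) / (\<gamma> \<epsilon>)\<^sup>2)"
      by (simp add: add_divide_distrib)
    then show ?case unfolding tail_form_rescaled[OF elim t s \<gamma>[OF elim]] f_def by (simp only:)
  qed
  from Lim_transform_eventually[OF lim this] show ?thesis
    by (simp add: Upsilon_bar_def signal_weight_def noise_weight_def add.commute)
qed

end

section \<open>Large deviations of the conditioned Volterra process\<close>

lemma centered_increments_uniform_limit:
  fixes \<mu> :: "real \<Rightarrow> real"
  assumes cont: "continuous_on {0..} \<mu>" and T: "0 \<le> T"
  shows "uniform_limit {0..1} (\<lambda>\<epsilon> t. \<mu> (T + \<epsilon> * t) - \<mu> T) (\<lambda>_. 0) (at_right 0)"
proof (rule uniform_limitI)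
  fix e :: real assume "0 < e"
  with cont T obtain d where d: "0 < d" "\<And>u. u \<in> {0..} \<Longrightarrow> dist u T < d \<Longrightarrow> dist (\<mu> u) (\<mu> T) < e"
    unfolding continuous_on_iff by (meson atLeast_iff)
  have "\<forall>\<^sub>F \<epsilon> in at_right 0. \<epsilon> \<in> {0<..<d}" by (rule eventually_at_right_real[OF d(1)])
  then show "\<forall>\<^sub>F \<epsilon> in at_right 0. \<forall>t\<in>{0..1}. dist (\<mu> (T + \<epsilon> * t) - \<mu> T) 0 < e"
  proof eventually_elim
    case (elim \<epsilon>)
    show ?case
    proof
      fix t :: real assume t: "t \<in> {0..1}"
      have "\<epsilon> * t \<le> \<epsilon>" "0 \<le> \<epsilon> * t" using elim t by (auto simp: mult_left_le)
      moreover have "\<epsilon> < d" using elim by simp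
      ultimately have "dist (T + \<epsilon> * t) T < d" "T + \<epsilon> * t \<in> {0..}"
        using T unfolding dist_real_def by simp_all
      then have "dist (\<mu> (T + \<epsilon> * t)) (\<mu> T) < e" by (intro d)
      then show "dist (\<mu> (T + \<epsilon> * t) - \<mu> T) 0 < e" by (simp add: dist_real_def)
    qed
  qed
qed

theorem theorem6:
  fixes M :: "'a measure" and N :: "(real \<Rightarrow> real) \<Rightarrow> 'b measure" and N\<^sub>0 :: "'c measure"
    and B B' X :: "real \<Rightarrow> 'a \<Rightarrow> real"
    and K Kbar kbar :: "real \<Rightarrow> real \<Rightarrow> real"
    and \<alpha> \<alpha>' T M' c \<tau> \<tau>' :: real
    and \<gamma> :: "real \<Rightarrow> real"
    and \<Psi> :: "real \<Rightarrow> (real \<Rightarrow> real) \<Rightarrow> real"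
    and Xc :: "(real \<Rightarrow> real) \<Rightarrow> real \<Rightarrow> 'b \<Rightarrow> real"
    and G :: "real \<Rightarrow> 'c \<Rightarrow> real"
    and H :: "(real \<Rightarrow> real) set" and ip :: "(real \<Rightarrow> real) \<Rightarrow> (real \<Rightarrow> real) \<Rightarrow> real"
  assumes volterra: "volterra_process M B K X" "continuous_paths M {0..} X"
    and noise: "brownian_motion M B'" "independent_processes M B B'" "\<not> (\<alpha> = 0 \<and> \<alpha>' = 0)"
    and T: "0 < T"
    and \<gamma>: "\<And>\<epsilon>. 0 < \<epsilon> \<Longrightarrow> 0 < \<gamma> \<epsilon>" "(\<gamma> \<longlongrightarrow> 0) (at_right 0)"
    and \<Psi>: "conditional_mean_functional M X (noisy_bm \<alpha> \<alpha>' B B') T \<Psi>"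
    and conditioned: "AE \<psi> in path_law M T (noisy_bm \<alpha> \<alpha>' B B').
          continuous_gaussian_process (N \<psi>) {0..} (\<lambda>t. \<Psi> t \<psi>) (Upsilon \<alpha> \<alpha>' K T) (Xc \<psi>)"
    and i: "uniform_limit ({0..1} \<times> {0..1})
          (\<lambda>\<epsilon> (t, s). covariance M (\<lambda>\<omega>. X (T + \<epsilon> * t) \<omega> - X T \<omega>) (\<lambda>\<omega>. X (T + \<epsilon> * s) \<omega> - X T \<omega>)
                       / (\<gamma> \<epsilon>)\<^sup>2)
          (\<lambda>(t, s). kbar t s) (at_right 0)"
    and ii: "0 < M'" "0 < \<tau>"
          "\<And>\<epsilon> s t. \<lbrakk>0 < \<epsilon>; s \<in> {0..1}; t \<in> {0..1}; s \<noteq> t\<rbrakk> \<Longrightarrow>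
             prob_space.variance M (\<lambda>\<omega>. X (T + \<epsilon> * t) \<omega> - X (T + \<epsilon> * s) \<omega>)
               / ((\<gamma> \<epsilon>)\<^sup>2 * \<bar>t - s\<bar> powr (2 * \<tau>)) \<le> M'"
    and iii: "square_integrable ({0..1} \<times> {0..1}) (\<lambda>(t, s). Kbar t s)"
          "uniform_limit ({0..1} \<times> {0..1})
             (\<lambda>\<epsilon> (t, s). sqrt \<epsilon> * (K (T + \<epsilon> * t) (T + \<epsilon> * s) / \<gamma> \<epsilon>))
             (\<lambda>(t, s). Kbar t s) (at_right 0)"
    and iv: "0 < c" "0 < \<tau>'"
          "\<And>\<epsilon> s t. \<lbrakk>0 < \<epsilon>; s \<in> {0..1}; t \<in> {0..1}; s \<noteq> t\<rbrakk> \<Longrightarrow>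
             (LINT u:{0..t}|lebesgue.
                (K (T + \<epsilon> * t) (T + \<epsilon> * u) - K (T + \<epsilon> * s) (T + \<epsilon> * u))\<^sup>2)
               / ((\<gamma> \<epsilon>)\<^sup>2 * \<bar>t - s\<bar> powr (2 * \<tau>')) \<le> c"
    and regular: "continuous_gaussian_process N\<^sub>0 {0..1} (\<lambda>_. 0) (Upsilon_bar \<alpha> \<alpha>' Kbar kbar) G"
    and rkhs: "rkhs {0..1} (Upsilon_bar \<alpha> \<alpha>' Kbar kbar) H ip"
  shows "good_rate_function (rkhs_rate H ip) \<and>
    (AE \<psi> in path_law M T (noisy_bm \<alpha> \<alpha>' B B').
       satisfies_LDP (N \<psi>) (\<lambda>\<epsilon> t \<omega>. Xc \<psi> (T + \<epsilon> * t) \<omega> - Xc \<psi> T \<omega>) (\<lambda>\<epsilon>. (\<gamma> \<epsilon>)\<^sup>2)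
         (rkhs_rate H ip))"
proof -
  have "prob_space M" using volterra(1) by (simp add: volterra_process_def brownian_motion_def)
  then interpret V: volterra_noise M B K X \<alpha> \<alpha>' T
    using volterra(1) T noise(3) by (intro volterra_noise.intro volterra_noise_axioms.intro) auto
  define R where "R \<epsilon> t s = V.increment_cov (T + \<epsilon> * t) (T + \<epsilon> * s) / (\<gamma> \<epsilon>)\<^sup>2" for \<epsilon> t s
  define Z where "Z \<psi> \<epsilon> t \<omega> = (Xc \<psi> (T + \<epsilon> * t) \<omega> - Xc \<psi> T \<omega>) - (\<Psi> (T + \<epsilon> * t) \<psi> - \<Psi> T \<psi>)" for \<psi> \<epsilon> t \<omega>
  define m where "m \<psi> \<epsilon> t = \<Psi> (T + \<epsilon> * t) \<psi> - \<Psi> T \<psi>" for \<psi> \<epsilon> t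
  have Tin: "T \<in> {0..}" using T by simp
  have time: "T + \<epsilon> * t \<in> {0..}" if "0 < \<epsilon>" "t \<in> {0..1}" for \<epsilon> t
    using that T by simp
  have time_T: "T + \<epsilon> * t \<in> {T..T + \<epsilon>}" if "0 < \<epsilon>" "t \<in> {0..1}" for \<epsilon> t
    using that by (auto simp: mult_left_le)
  have g0: "0 < (\<gamma> \<epsilon>)\<^sup>2" if "0 < \<epsilon>" for \<epsilon> using \<gamma>(1)[OF that] by simp
  have U_sym: "Upsilon \<alpha> \<alpha>' K T u v = Upsilon \<alpha> \<alpha>' K T v u" for u v
  proof -
    have "K u w * K v w = K v w * K u w" for w by (rule mult.commute)
    then show ?thesis unfolding Upsilon_def min.commute[of u v] by (simp only:)
  qed
  have R_sym: "R \<epsilon> s t = R \<epsilon> t s" for \<epsilon> s t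
    unfolding R_def V.increment_cov_def
    using U_sym[of "T + \<epsilon> * s" "T + \<epsilon> * t"] U_sym[of "T + \<epsilon> * s" T] U_sym[of T "T + \<epsilon> * t"] by simp
  have R_lim: "((\<lambda>\<epsilon>. R \<epsilon> s t) \<longlongrightarrow> Upsilon_bar \<alpha> \<alpha>' Kbar kbar s t) (at_right 0)"
    if "s \<in> {0..1}" "t \<in> {0..1}" for s t
    unfolding R_def
  proof (rule V.increment_cov_tendsto[OF \<gamma>(1) that _ iii(2)])
    have "(s, t) \<in> {0..1} \<times> {0..1}" using that by simp
    from tendsto_uniform_limitI[OF i this]
    show "((\<lambda>\<epsilon>. covariance M (\<lambda>\<omega>. X (T + \<epsilon> * s) \<omega> - X T \<omega>) (\<lambda>\<omega>. X (T + \<epsilon> * t) \<omega> - X T \<omega>) / (\<gamma> \<epsilon>)\<^sup>2)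
        \<longlongrightarrow> kbar s t) (at_right 0)" by simp
  qed
  have R_incr: "R \<epsilon> t t - 2 * R \<epsilon> t s + R \<epsilon> s s \<le> M' * \<bar>t - s\<bar> powr (2 * \<tau>)"
    if \<epsilon>: "0 < \<epsilon>" and s: "s \<in> {0..1}" and t: "t \<in> {0..1}" for \<epsilon> s t
  proof (cases "s = t")
    case False
    have "R \<epsilon> t t - 2 * R \<epsilon> t s + R \<epsilon> s s
        = (V.increment_cov (T + \<epsilon> * t) (T + \<epsilon> * t) - 2 * V.increment_cov (T + \<epsilon> * t) (T + \<epsilon> * s)
            + V.increment_cov (T + \<epsilon> * s) (T + \<epsilon> * s)) / (\<gamma> \<epsilon>)\<^sup>2"
      by (simp add: R_def add_divide_distrib diff_divide_distrib)
    also have "\<dots> \<le> prob_space.variance M (\<lambda>\<omega>. X (T + \<epsilon> * t) \<omega> - X (T + \<epsilon> * s) \<omega>) / (\<gamma> \<epsilon>)\<^sup>2"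
      using V.increment_cov_variance_le[OF time_T[OF \<epsilon> t] time_T[OF \<epsilon> s]] by (rule divide_right_mono) simp
    also have "\<dots> \<le> M' * \<bar>t - s\<bar> powr (2 * \<tau>)"
    proof -
      have "0 < (\<gamma> \<epsilon>)\<^sup>2 * \<bar>t - s\<bar> powr (2 * \<tau>)" using g0[OF \<epsilon>] False by simp
      with ii(3)[OF \<epsilon> s t False]
      have "prob_space.variance M (\<lambda>\<omega>. X (T + \<epsilon> * t) \<omega> - X (T + \<epsilon> * s) \<omega>) \<le> M' * ((\<gamma> \<epsilon>)\<^sup>2 * \<bar>t - s\<bar> powr (2 * \<tau>))"
        by (simp only: pos_divide_le_eq)
      then show ?thesis using g0[OF \<epsilon>] by (simp only: pos_divide_le_eq mult_ac)
    qed
    finally show ?thesis .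
  qed simp
  have limit_rkhs: "holder_rkhs (Upsilon_bar \<alpha> \<alpha>' Kbar kbar) H ip M' \<tau>"
  proof (intro holder_rkhs.intro holder_rkhs_axioms.intro rkhs ii(1,2))
    have pos: "\<forall>\<^sub>F \<epsilon> in at_right (0::real). 0 < \<epsilon>" by (simp add: eventually_at_right_less)
    let ?Q = "Upsilon_bar \<alpha> \<alpha>' Kbar kbar"
    show "?Q t t - 2 * ?Q t s + ?Q s s \<le> M' * \<bar>t - s\<bar> powr (2 * \<tau>)" if st: "s \<in> {0..1}" "t \<in> {0..1}" for s t
    proof (rule tendsto_upperbound)
      show "((\<lambda>\<epsilon>. R \<epsilon> t t - 2 * R \<epsilon> t s + R \<epsilon> s s) \<longlongrightarrow> ?Q t t - 2 * ?Q t s + ?Q s s) (at_right 0)"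
        by (intro tendsto_intros R_lim st)
      show "\<forall>\<^sub>F \<epsilon> in at_right 0. R \<epsilon> t t - 2 * R \<epsilon> t s + R \<epsilon> s s \<le> M' * \<bar>t - s\<bar> powr (2 * \<tau>)"
        using pos by eventually_elim (rule R_incr[OF _ st])
    qed simp
    have "R \<epsilon> 0 0 = 0" for \<epsilon> by (simp add: R_def V.increment_cov_def)
    with R_lim[of 0 0] have "((\<lambda>_. 0) \<longlongrightarrow> ?Q 0 0) (at_right (0::real))" by simp
    then show "?Q 0 0 = 0" by (simp add: tendsto_const_iff)
  qed
  have family: "small_gaussian_rkhs (N \<psi>) (Z \<psi>) R (Upsilon_bar \<alpha> \<alpha>' Kbar kbar) \<gamma> M' \<tau> (m \<psi>) H ip"
    if cg: "continuous_gaussian_process (N \<psi>) {0..} (\<lambda>t. \<Psi> t \<psi>) (Upsilon \<alpha> \<alpha>' K T) (Xc \<psi>)"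
      and cont: "continuous_on {0..} (\<lambda>t. \<Psi> t \<psi>)" for \<psi>
  proof -
    have gp: "gaussian_process (N \<psi>) {0..} (Xc \<psi>)" and cp: "continuous_paths (N \<psi>) {0..} (Xc \<psi>)"
      and mean: "\<And>t. t \<in> {0..} \<Longrightarrow> (\<integral>\<omega>. Xc \<psi> t \<omega> \<partial>N \<psi>) = \<Psi> t \<psi>"
      and cov: "\<And>s t. s \<in> {0..} \<Longrightarrow> t \<in> {0..} \<Longrightarrow> covariance (N \<psi>) (Xc \<psi> s) (Xc \<psi> t) = Upsilon \<alpha> \<alpha>' K T s t"
      using cg by (simp_all add: continuous_gaussian_process_def)
    have pN: "prob_space (N \<psi>)" using gp by (simp add: gaussian_process_def)
    have meas: "Xc \<psi> t \<in> borel_measurable (N \<psi>)" if "t \<in> {0..}" for t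
      using gaussian_process_lincomb[OF gp, of "{0::nat}" "\<lambda>_. t" "\<lambda>_. 1"] that by (simp add: gaussian_rv_def)
    have shift: "continuous_on {0..1} (\<lambda>t. f (T + \<epsilon> * t))" if "continuous_on {0..} f" "0 < \<epsilon>" for f :: "real \<Rightarrow> real" and \<epsilon>
      by (rule continuous_on_compose2[OF that(1)]) (use time[OF that(2)] in \<open>auto intro!: continuous_intros\<close>)
    have "small_gaussian_family (N \<psi>) (Z \<psi>) R (Upsilon_bar \<alpha> \<alpha>' Kbar kbar) \<gamma> M' \<tau> (m \<psi>)"
    proof (intro small_gaussian_family.intro small_gaussian_family_axioms.intro pN)
      show "Z \<psi> \<epsilon> t \<in> borel_measurable (N \<psi>)" if "0 < \<epsilon>" "t \<in> {0..1}" for \<epsilon> t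
        unfolding Z_def[abs_def] by (intro borel_measurable_diff borel_measurable_const meas time[OF that] Tin)
      show "continuous_paths (N \<psi>) {0..1} (Z \<psi> \<epsilon>)" if "0 < \<epsilon>" for \<epsilon>
        unfolding continuous_paths_def Z_def
        using cp by (intro ballI continuous_on_diff continuous_on_const shift that cont) (auto simp: continuous_paths_def)
      show "Z \<psi> \<epsilon> 0 \<omega> = 0" for \<epsilon> \<omega> by (simp add: Z_def)
      show "has_bochner_integral (N \<psi>) (\<lambda>\<omega>. exp (\<Sum>t\<in>J. c t * Z \<psi> \<epsilon> t \<omega>)) (exp ((\<gamma> \<epsilon>)\<^sup>2 * kernel_form (R \<epsilon>) J c c / 2))"
        if \<epsilon>: "0 < \<epsilon>" and J: "finite J" "J \<subseteq> {0..1}" for \<epsilon> J c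
      proof -
        have "(\<lambda>t. T + \<epsilon> * t) ` J \<subseteq> {0..}" using time[OF \<epsilon>] J by auto
        from gaussian_process_increment_mgf[OF gp mean cov J(1) this Tin, of c]
        have "has_bochner_integral (N \<psi>) (\<lambda>\<omega>. exp (\<Sum>t\<in>J. c t * Z \<psi> \<epsilon> t \<omega>))
          (exp ((\<Sum>t\<in>J. \<Sum>s\<in>J. c t * c s * V.increment_cov (T + \<epsilon> * t) (T + \<epsilon> * s)) / 2))"
          unfolding Z_def V.increment_cov_def .
        moreover have "(\<Sum>t\<in>J. \<Sum>s\<in>J. c t * c s * V.increment_cov (T + \<epsilon> * t) (T + \<epsilon> * s)) = (\<gamma> \<epsilon>)\<^sup>2 * kernel_form (R \<epsilon>) J c c"
          unfolding kernel_form_def sum_distrib_left R_def using g0[OF \<epsilon>] by (intro sum.cong refl) simp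
        ultimately show ?thesis by (simp only:)
      qed
      show "continuous_on {0..1} (m \<psi> \<epsilon>)" if "0 < \<epsilon>" for \<epsilon>
        unfolding m_def[abs_def] by (intro continuous_on_diff continuous_on_const shift[OF cont that])
      show "uniform_limit {0..1} (m \<psi>) (\<lambda>_. 0) (at_right 0)"
        unfolding m_def[abs_def] using T by (intro centered_increments_uniform_limit cont) simp
      show "0 < \<gamma> \<epsilon>" if "0 < \<epsilon>" for \<epsilon> by (rule \<gamma>(1)[OF that])
      show "(\<gamma> \<longlongrightarrow> 0) (at_right 0)" by (rule \<gamma>(2))
      show "R \<epsilon> s t = R \<epsilon> t s" for \<epsilon> s t by (rule R_sym)
      show "((\<lambda>\<epsilon>. R \<epsilon> s t) \<longlongrightarrow> Upsilon_bar \<alpha> \<alpha>' Kbar kbar s t) (at_right 0)"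
        if "s \<in> {0..1}" "t \<in> {0..1}" for s t by (rule R_lim[OF that])
      show "R \<epsilon> t t - 2 * R \<epsilon> t s + R \<epsilon> s s \<le> M' * \<bar>t - s\<bar> powr (2 * \<tau>)"
        if "0 < \<epsilon>" "s \<in> {0..1}" "t \<in> {0..1}" for \<epsilon> s t by (rule R_incr[OF that])
      show "0 < M'" "0 < \<tau>" by (rule ii(1,2))+
    qed
    then show ?thesis using limit_rkhs by (rule small_gaussian_rkhs.intro)
  qed
  have U_eq: "small_gaussian_family.U (Z \<psi>) (m \<psi>) = (\<lambda>\<epsilon> t \<omega>. Xc \<psi> (T + \<epsilon> * t) \<omega> - Xc \<psi> T \<omega>)"
    if "small_gaussian_rkhs (N \<psi>) (Z \<psi>) R (Upsilon_bar \<alpha> \<alpha>' Kbar kbar) \<gamma> M' \<tau> (m \<psi>) H ip" for \<psi>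
  proof -
    interpret small_gaussian_rkhs "N \<psi>" "Z \<psi>" R "Upsilon_bar \<alpha> \<alpha>' Kbar kbar" \<gamma> M' \<tau> "m \<psi>" H ip by (rule that)
    show ?thesis by (intro ext) (simp add: U_def Z_def m_def)
  qed
  have cont: "AE \<psi> in path_law M T (noisy_bm \<alpha> \<alpha>' B B'). continuous_on {0..} (\<lambda>t. \<Psi> t \<psi>)"
    using \<Psi> by (simp add: conditional_mean_functional_def)
  from conditioned cont have fam: "AE \<psi> in path_law M T (noisy_bm \<alpha> \<alpha>' B B').
      small_gaussian_rkhs (N \<psi>) (Z \<psi>) R (Upsilon_bar \<alpha> \<alpha>' Kbar kbar) \<gamma> M' \<tau> (m \<psi>) H ip"
    by eventually_elim (rule family)
  show ?thesis
  proof
    show "AE \<psi> in path_law M T (noisy_bm \<alpha> \<alpha>' B B').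
       satisfies_LDP (N \<psi>) (\<lambda>\<epsilon> t \<omega>. Xc \<psi> (T + \<epsilon> * t) \<omega> - Xc \<psi> T \<omega>) (\<lambda>\<epsilon>. (\<gamma> \<epsilon>)\<^sup>2) (rkhs_rate H ip)"
      using fam
    proof eventually_elim
      case (elim \<psi>)
      from small_gaussian_rkhs.gaussian_LDP[OF elim] show ?case unfolding U_eq[OF elim] .
    qed
    show "good_rate_function (rkhs_rate H ip)"
      by (rule holder_rkhs.good_rate_function_rkhs[OF limit_rkhs])
  qed
qed

end
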